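(* Let $X$ be a real random variable with $\mathbb{E}X=0$, $\mathbb{E}X^2=1$, $\mathbb{E}X^4<\infty$, and put $v=\mathbb{E}X^4-1$. For each $n$ let $d=d_n$ be an integer with $1\le d\le n$, let $p=\binom nd$, let $N=N_n\ge 1$ be an integer, and let $S_n$ be the sample covariance matrix of $N$ independent copies of the degree-$d$ square-free tensor $x$ built from $n$ i.i.d. copies of $X$. Assume that, as $n\to\infty$, \[ \frac{d^2}{n}\to\lambda\in[0,\infty),\qquad \frac pN\to c\in(0,\infty). \] Let $R=\exp\bigl(\sqrt{\lambda v}\,Z-\tfrac{\lambda v}{2}\bigr)$ with $Z\sim N(0,1)$, and let $\nu_{\lambda,v}$ be the law of $R$. Then the empirical spectral distribution of $S_n$ converges weakly almost surely to a deterministic probability measure $\mu_{c,\lambda,v}$ on $[0,\infty)$. Its Stieltjes transform $s$ is characterized as follows: for every $z\in\mathbb{C}_+$, $s(z)$ is the unique element of $\mathbb{C}_+$ satisfying \[ 1+z\,s(z)=s(z)\int_0^\infty\frac{r}{1+cr\,s(z)}\,\nu_{\lambda,v}(dr), \] or equivalently \[ \frac1{s(z)}+z=\mathbb{E}\left[\frac{R}{1+cR\,s(z)}\right]. \]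
   Context: Let $X_1,\dots,X_n$ be i.i.d. copies of $X$. Index coordinates of $\mathbb{R}^p$, $p=\binom nd$, by the $d$-element subsets $I$ of $[n]=\{1,\dots,n\}$. The square-free (principal) tensor of degree $d$ is the random vector $x=(x_I)_I\in\mathbb{R}^p$ with $x_I=\prod_{i\in I}X_i$. With $x^{(1)},\dots,x^{(N)}$ independent copies of $x$, \[ S_n=\frac1N\sum_{\alpha=1}^N x^{(\alpha)}x^{(\alpha)\mathsf T}. \] All random objects for different $n$ live on one probability space; no assumption is made on the dependence between different $n$. The empirical spectral distribution (ESD) of a $p\times p$ Hermitian matrix is the uniform probability measure on its $p$ eigenvalues counted with multiplicity. $\mathbb{C}_+=\{z:\operatorname{Im}z>0\}$, and the Stieltjes transform of a probability measure $\mu$ on $\mathbb{R}$ is $s_\mu(z)=\int_{\mathbb{R}}\frac{1}{t-z}\,\mu(dt)$, $z\in\mathbb{C}_+$. *)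

theory Defs
  imports "HOL-Probability.Probability" "Jordan_Normal_Form.Char_Poly"
begin

definition dsubsets :: "nat \<Rightarrow> nat \<Rightarrow> nat set set" where
  "dsubsets n d = {I. I \<subseteq> {1..n} \<and> card I = d}"

(* Vectors indexed by a finite set of coordinates are extensional functions on it, i.e. points of
   the product measurable space PiM. *)
abbreviation tensor_space :: "nat \<Rightarrow> nat \<Rightarrow> (nat set \<Rightarrow> real) measure" where
  "tensor_space n d \<equiv> PiM (dsubsets n d) (\<lambda>_. borel)"

definition sqfree_tensor :: "nat \<Rightarrow> nat \<Rightarrow> (nat \<Rightarrow> real) \<Rightarrow> (nat set \<Rightarrow> real)" where
  "sqfree_tensor n d y = (\<lambda>I\<in>dsubsets n d. \<Prod>i\<in>I. y i)"

(* The law of the square-free tensor built from X_1, ..., X_n i.i.d. with common law D: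
   the product measure is the joint law of (X_1, ..., X_n). *)
definition sqfree_tensor_law :: "nat \<Rightarrow> nat \<Rightarrow> real measure \<Rightarrow> (nat set \<Rightarrow> real) measure" where
  "sqfree_tensor_law n d D = distr (PiM {1..n} (\<lambda>_. D)) (tensor_space n d) (sqfree_tensor n d)"

(* A matrix with rows and columns indexed by a finite set, as a library matrix. For finite A,
   from_nat_into A is a bijection from {..<card A} onto A; changing the enumeration conjugates the
   matrix by a permutation, so its eigenvalues do not depend on it. *)
definition mat_on :: "'i set \<Rightarrow> ('i \<Rightarrow> 'i \<Rightarrow> 'a) \<Rightarrow> 'a Matrix.mat" where
  "mat_on A f = Matrix.mat (card A) (card A) (\<lambda>(k, l). f (from_nat_into A k) (from_nat_into A l))"

definition sample_cov :: "nat \<Rightarrow> nat \<Rightarrow> nat \<Rightarrow> (nat \<Rightarrow> nat set \<Rightarrow> real) \<Rightarrow> real Matrix.mat" where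
  "sample_cov n d N x =
     mat_on (dsubsets n d) (\<lambda>I J. (1 / real N) * (\<Sum>\<alpha>=1..N. x \<alpha> I * x \<alpha> J))"

(* Only used for real symmetric matrices of positive size: then all roots of the characteristic
   polynomial are real, and proots lists all eigenvalues with multiplicity. *)
definition esd :: "real Matrix.mat \<Rightarrow> real measure" where
  "esd A = distr (measure_pmf (pmf_of_multiset (proots (char_poly A)))) borel (\<lambda>t. t)"

definition stieltjes :: "real measure \<Rightarrow> complex \<Rightarrow> complex" where
  "stieltjes \<mu> z = (LINT t|\<mu>. 1 / (complex_of_real t - z))"

end

theory Submission
  imports Defs "Jordan_Normal_Form.Schur_Decomposition" "HOL-Complex_Analysis.Complex_Analysis"
begin

text \<open>
  Everything is read off from the values \<open>m(u) = \<integral> 1 / (t + u)\<close> of the transforms at rational \<open>u > 0\<close>,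
  where resolvents of positive semidefinite matrices are bounded. For the Gram matrix of the samples,
  the Sherman--Morrison formula expresses \<open>p (1 - u m(u))\<close> as the sum of \<open>q / (1 + q)\<close> over the samples, with \<open>q\<close> the
  quadratic form of a leave-one-out resolvent in one sample. McDiarmid's inequality concentrates \<open>m(u)\<close>
  around its mean, strongly enough for the Borel--Cantelli lemma.

  The quadratic form of a bounded matrix in a square-free tensor \<open>x\<close> does not concentrate around its
  trace, because \<open>|x|\<^sup>2 / p\<close> is not close to 1 once \<open>d\<^sup>2\<close> is comparable with \<open>n\<close>; but it is close in
  mean to the trace times \<open>|x|\<^sup>2 / p\<close>. The variable \<open>|x|\<^sup>2 / p\<close> is a normalized elementary symmetric
  polynomial in the \<open>X\<^sub>i\<^sup>2\<close>, and it converges in law to the lognormal variable \<open>R\<close>. In the limit \<open>m(u)\<close>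
  is therefore the root of \<open>u m + E (m R / (1 + c m R)) = 1\<close>. The transforms determine the
  limit law, and the equation extends from the positive half-line to the slit plane by the identity theorem.
\<close>

section \<open>Resolvents of Gram matrices\<close>

text \<open>The norm of the tensor fluctuates, so a quadratic form has to be split before it is
  estimated. Once its trace is removed, the diagonal part is a linear statistic of the
  \<open>x_I^2\<close> with coefficients of sum zero. The zero sum kills the top eigenvalue of the
  inclusion matrices between k-sets and d-sets, and the next one is smaller by about a factor k / d.
  This yields second moments of relative size d / n, which tends to 0 because d^2 / n converges; for
  the same reason constants like exp (2 v d^2 / n) stay bounded. The arguments u are rational
  because the almost sure limits must hold simultaneously, which costs nothing for countably many u.
  Nothing relates different n, so the tails must be summable: their exponent p^2 / N is about c p,
  and p >= n eventually. In the limit the equation is read through the law of 1 / R. Since r / (1 +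
  c r s) = 1 / (1 / r + c s), its right side is again a transform of a law on the half-line, so both
  sides are holomorphic on the same plane.\<close>

definition is_inverse_on :: "'i set \<Rightarrow> ('i \<Rightarrow> 'i \<Rightarrow> real) \<Rightarrow> ('i \<Rightarrow> 'i \<Rightarrow> real) \<Rightarrow> bool" where
  "is_inverse_on A H G \<longleftrightarrow>
     (\<forall>i\<in>A. \<forall>j\<in>A. (\<Sum>k\<in>A. H i k * G k j) = (if i = j then 1 else 0)) \<and>
     (\<forall>i\<in>A. \<forall>j\<in>A. G i j = G j i)"

text \<open>The divisor \<open>N\<close> is separate from the number of samples in \<open>B\<close>,
  so that deleting a sample keeps the normalization and is an exact rank-one change.\<close>

definition gram_shift :: "real \<Rightarrow> real \<Rightarrow> 's set \<Rightarrow> ('s \<Rightarrow> 'i \<Rightarrow> real) \<Rightarrow> 'i \<Rightarrow> 'i \<Rightarrow> real" where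
  "gram_shift u N B x i j = (if i = j then u else 0) + (\<Sum>\<alpha>\<in>B. x \<alpha> i * x \<alpha> j) / N"

text \<open>The choice is arbitrary when no inverse exists; for \<open>u > 0\<close> the shifted Gram matrix is invertible.\<close>

definition resolvent :: "real \<Rightarrow> real \<Rightarrow> 'i set \<Rightarrow> 's set \<Rightarrow> ('s \<Rightarrow> 'i \<Rightarrow> real) \<Rightarrow> 'i \<Rightarrow> 'i \<Rightarrow> real" where
  "resolvent u N A B x = (SOME G. is_inverse_on A (gram_shift u N B x) G)"

definition mat_app :: "'i set \<Rightarrow> ('i \<Rightarrow> 'i \<Rightarrow> real) \<Rightarrow> ('i \<Rightarrow> real) \<Rightarrow> 'i \<Rightarrow> real" where
  "mat_app A G w i = (\<Sum>j\<in>A. G i j * w j)"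

definition quad_form :: "'i set \<Rightarrow> ('i \<Rightarrow> 'i \<Rightarrow> real) \<Rightarrow> ('i \<Rightarrow> real) \<Rightarrow> real" where
  "quad_form A G w = (\<Sum>i\<in>A. w i * mat_app A G w i)"

definition ktrace :: "'i set \<Rightarrow> ('i \<Rightarrow> 'i \<Rightarrow> real) \<Rightarrow> real" where
  "ktrace A G = (\<Sum>i\<in>A. G i i)"

lemma is_inverse_onD:
  assumes "is_inverse_on A H G" "i \<in> A" "j \<in> A"
  shows "(\<Sum>k\<in>A. H i k * G k j) = (if i = j then 1 else 0)" and "G i j = G j i"
  using assms by (auto simp: is_inverse_on_def)

lemma gram_shift_sym: "gram_shift u N B x i j = gram_shift u N B x j i"
  by (simp add: gram_shift_def mult.commute)

lemma gram_shift_insert: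
  assumes "finite B" "\<alpha> \<notin> B"
  shows "gram_shift u N (insert \<alpha> B) x i j = gram_shift u N B x i j + x \<alpha> i * x \<alpha> j / N"
  using assms by (simp add: gram_shift_def add_divide_distrib)

lemma gram_shift_insert':
  assumes "finite B" "\<alpha> \<notin> B"
  shows "gram_shift u N (insert \<alpha> B) x = (\<lambda>i j. gram_shift u N B x i j + x \<alpha> i * x \<alpha> j / N)"
  using assms by (intro ext) (rule gram_shift_insert)

lemma resolvent_cong:
  assumes "\<And>\<alpha>. \<alpha> \<in> B \<Longrightarrow> x \<alpha> = y \<alpha>"
  shows "resolvent u N A B x = resolvent u N A B y"
proof -
  have "gram_shift u N B x = gram_shift u N B y"
    using assms by (intro ext) (simp add: gram_shift_def)
  then show ?thesis by (simp add: resolvent_def)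
qed

lemma sum_delta_times:
  fixes f :: "'i \<Rightarrow> real"
  assumes "finite A" "i \<in> A"
  shows "(\<Sum>k\<in>A. (if i = k then c else 0) * f k) = c * f i"
    and "(\<Sum>k\<in>A. (if k = i then c else 0) * f k) = c * f i"
    and "(\<Sum>k\<in>A. f k * (if i = k then c else 0)) = f i * c"
    and "(\<Sum>k\<in>A. f k * (if k = i then c else 0)) = f i * c"
proof -
  have "(\<Sum>k\<in>A. (if i = k then c else 0) * f k) = (\<Sum>k\<in>A. if i = k then c * f k else 0)"
    by (intro sum.cong) auto
  also have "\<dots> = c * f i" using assms by (simp add: sum.delta')
  finally show a: "(\<Sum>k\<in>A. (if i = k then c else 0) * f k) = c * f i" .
  then show "(\<Sum>k\<in>A. (if k = i then c else 0) * f k) = c * f i"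
    by (simp add: eq_commute[of _ i])
  from a show "(\<Sum>k\<in>A. f k * (if i = k then c else 0)) = f i * c"
    by (simp add: mult.commute)
  from a show "(\<Sum>k\<in>A. f k * (if k = i then c else 0)) = f i * c"
    by (simp add: eq_commute[of _ i] mult.commute)
qed

lemma is_inverse_on_left:
  assumes "is_inverse_on A H G" and "\<And>i j. H i j = H j i" and "i \<in> A" "j \<in> A"
  shows "(\<Sum>k\<in>A. G i k * H k j) = (if i = j then 1 else 0)"
proof -
  have "(\<Sum>k\<in>A. G i k * H k j) = (\<Sum>k\<in>A. H j k * G k i)"
    using is_inverse_onD(2)[OF assms(1)] assms(2-) by (intro sum.cong) (simp_all add: mult.commute)
  then show ?thesis using is_inverse_onD(1)[OF assms(1,4,3)] by auto
qed

text \<open>The usual G = G (H G') = (G H) G', the left inverse coming from the symmetry of both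
  matrices. This turns the arbitrary choice in \<open>resolvent\<close> into explicit update
  formulas.\<close>

lemma is_inverse_on_unique:
  assumes G: "is_inverse_on A H G" and G': "is_inverse_on A H G'"
    and sym: "\<And>i j. H i j = H j i" and "finite A" and ij: "i \<in> A" "j \<in> A"
  shows "G i j = G' i j"
proof -
  have "G i j = (\<Sum>k\<in>A. G i k * (\<Sum>l\<in>A. H k l * G' l j))"
  proof -
    have "(\<Sum>k\<in>A. G i k * (\<Sum>l\<in>A. H k l * G' l j)) = (\<Sum>k\<in>A. G i k * (if k = j then 1 else 0))"
      using G' ij by (intro sum.cong) (auto simp: is_inverse_on_def)
    then show ?thesis using sum_delta_times(4)[OF \<open>finite A\<close> ij(2), of "G i" 1] by simp
  qed
  also have "\<dots> = (\<Sum>k\<in>A. \<Sum>l\<in>A. G i k * H k l * G' l j)"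
    by (simp add: sum_distrib_left mult.assoc)
  also have "\<dots> = (\<Sum>l\<in>A. \<Sum>k\<in>A. G i k * H k l * G' l j)"
    by (rule sum.swap)
  also have "\<dots> = (\<Sum>l\<in>A. (if i = l then 1 else 0) * G' l j)"
    using is_inverse_on_left[OF G sym ij(1)]
    by (intro sum.cong) (simp_all add: sum_distrib_right[symmetric])
  also have "\<dots> = G' i j"
    using sum_delta_times(1)[OF \<open>finite A\<close> ij(1), of 1] by simp
  finally show ?thesis .
qed

lemma mat_app_inverse:
  assumes "is_inverse_on A H G" "finite A" "i \<in> A"
  shows "(\<Sum>k\<in>A. H i k * mat_app A G w k) = w i"
proof -
  have "(\<Sum>k\<in>A. H i k * mat_app A G w k) = (\<Sum>k\<in>A. \<Sum>j\<in>A. H i k * G k j * w j)"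
    by (simp add: mat_app_def sum_distrib_left mult.assoc)
  also have "\<dots> = (\<Sum>j\<in>A. \<Sum>k\<in>A. H i k * G k j * w j)" by (rule sum.swap)
  also have "\<dots> = (\<Sum>j\<in>A. (if i = j then 1 else 0) * w j)"
    using is_inverse_onD(1)[OF assms(1,3)] by (intro sum.cong) (simp_all add: sum_distrib_right[symmetric])
  also have "\<dots> = w i" using sum_delta_times(1)[OF assms(2,3), of 1 w] by simp
  finally show ?thesis .
qed

lemma gram_shift_quad:
  assumes "finite A"
  shows "(\<Sum>i\<in>A. g i * (\<Sum>k\<in>A. gram_shift u N B x i k * g k)) =
    u * (\<Sum>i\<in>A. (g i)^2) + (\<Sum>\<alpha>\<in>B. (\<Sum>i\<in>A. x \<alpha> i * g i)^2) / N"
proof -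
  have "(\<Sum>k\<in>A. gram_shift u N B x i k * g k) =
      u * g i + (\<Sum>\<alpha>\<in>B. x \<alpha> i * (\<Sum>k\<in>A. x \<alpha> k * g k)) / N" if "i \<in> A" for i
  proof -
    have "(\<Sum>k\<in>A. gram_shift u N B x i k * g k) =
        (\<Sum>k\<in>A. (if i = k then u else 0) * g k) + (\<Sum>k\<in>A. (\<Sum>\<alpha>\<in>B. x \<alpha> i * x \<alpha> k * g k) / N)"
      by (simp add: gram_shift_def algebra_simps sum.distrib sum_distrib_left)
    also have "(\<Sum>k\<in>A. (\<Sum>\<alpha>\<in>B. x \<alpha> i * x \<alpha> k * g k) / N) =
        (\<Sum>k\<in>A. \<Sum>\<alpha>\<in>B. x \<alpha> i * x \<alpha> k * g k) / N"
      by (simp add: sum_divide_distrib)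
    also have "(\<Sum>k\<in>A. \<Sum>\<alpha>\<in>B. x \<alpha> i * x \<alpha> k * g k) = (\<Sum>\<alpha>\<in>B. \<Sum>k\<in>A. x \<alpha> i * x \<alpha> k * g k)"
      by (rule sum.swap)
    finally show ?thesis
      using sum_delta_times(1)[OF assms that, of u g] by (simp add: sum_distrib_left mult.assoc)
  qed
  then have "(\<Sum>i\<in>A. g i * (\<Sum>k\<in>A. gram_shift u N B x i k * g k)) =
      (\<Sum>i\<in>A. g i * (u * g i + (\<Sum>\<alpha>\<in>B. x \<alpha> i * (\<Sum>k\<in>A. x \<alpha> k * g k)) / N))"
    by simp
  also have "\<dots> = (\<Sum>i\<in>A. u * (g i)^2) + (\<Sum>i\<in>A. \<Sum>\<alpha>\<in>B. x \<alpha> i * g i * (\<Sum>k\<in>A. x \<alpha> k * g k)) / N"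
    by (simp add: distrib_left sum.distrib sum_distrib_left sum_divide_distrib power2_eq_square mult_ac)
  also have "(\<Sum>i\<in>A. \<Sum>\<alpha>\<in>B. x \<alpha> i * g i * (\<Sum>k\<in>A. x \<alpha> k * g k)) =
      (\<Sum>\<alpha>\<in>B. \<Sum>i\<in>A. x \<alpha> i * g i * (\<Sum>k\<in>A. x \<alpha> k * g k))"
    by (rule sum.swap)
  also have "\<dots> = (\<Sum>\<alpha>\<in>B. (\<Sum>i\<in>A. x \<alpha> i * g i)^2)"
    by (simp add: sum_distrib_right[symmetric] power2_eq_square)
  finally show ?thesis by (simp add: sum_distrib_left)
qed

text \<open>With g = G w one has w = H g, so the form equals that of H at g, and the Gram part of H
  is positive semidefinite. Positivity, the entry bounds and the effect of one sample on the trace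
  all come from this inequality.\<close>

lemma quad_form_ge:
  assumes G: "is_inverse_on A (gram_shift u N B x) G" and "finite A" "0 \<le> N"
  shows "u * (\<Sum>i\<in>A. (mat_app A G w i)^2) \<le> quad_form A G w"
proof -
  let ?g = "mat_app A G w"
  have "quad_form A G w = (\<Sum>i\<in>A. ?g i * (\<Sum>k\<in>A. gram_shift u N B x i k * ?g k))"
    unfolding quad_form_def using mat_app_inverse[OF G assms(2)]
    by (intro sum.cong) (simp_all add: mult.commute)
  also have "\<dots> = u * (\<Sum>i\<in>A. (?g i)^2) + (\<Sum>\<alpha>\<in>B. (\<Sum>i\<in>A. x \<alpha> i * ?g i)^2) / N"
    by (rule gram_shift_quad) fact
  finally show ?thesis using \<open>0 \<le> N\<close> by (simp add: sum_nonneg)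
qed

lemma quad_form_nonneg:
  assumes G: "is_inverse_on A (gram_shift u N B x) G" and "finite A" "0 \<le> N" "0 \<le> u"
  shows "0 \<le> quad_form A G w"
  using quad_form_ge[OF G assms(2,3), of w] assms(4)
  by (meson mult_nonneg_nonneg order_trans sum_nonneg zero_le_power2)

lemma sherman_morrison:
  assumes G: "is_inverse_on A H G" and "finite A"
    and sym: "\<And>i j. H i j = H j i" and N: "0 < N" and Q: "0 \<le> quad_form A G w"
  shows "is_inverse_on A (\<lambda>i j. H i j + w i * w j / N)
    (\<lambda>i j. G i j - mat_app A G w i * mat_app A G w j / (N + quad_form A G w))"
proof -
  let ?g = "mat_app A G w" and ?Q = "quad_form A G w"
  have pos: "N + ?Q > 0" using N Q by simp
  have "(\<Sum>k\<in>A. (H i k + w i * w k / N) * (G k j - ?g k * ?g j / (N + ?Q))) = (if i = j then 1 else 0)"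
    if ij: "i \<in> A" "j \<in> A" for i j
  proof -
    have g: "(\<Sum>k\<in>A. w k * G k j) = ?g j"
      unfolding mat_app_def using G ij
      by (intro sum.cong) (auto simp: is_inverse_on_def mult.commute)
    have "(\<Sum>k\<in>A. (H i k + w i * w k / N) * (G k j - ?g k * ?g j / (N + ?Q))) =
       (\<Sum>k\<in>A. H i k * G k j) - (\<Sum>k\<in>A. H i k * ?g k) * (?g j / (N + ?Q))
         + (w i / N) * (\<Sum>k\<in>A. w k * G k j) - (w i / N) * (\<Sum>k\<in>A. w k * ?g k) * (?g j / (N + ?Q))"
      unfolding sum_distrib_left sum_distrib_right sum.distrib[symmetric] sum_subtractf[symmetric]
      by (intro sum.cong) (simp_all add: divide_inverse algebra_simps)
    also have "\<dots> = (if i = j then 1 else 0) - w i * (?g j / (N + ?Q)) + (w i / N) * ?g j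
        - (w i / N) * ?Q * (?g j / (N + ?Q))"
      using G ij mat_app_inverse[OF G \<open>finite A\<close> ij(1), of w]
      by (simp add: g is_inverse_on_def quad_form_def)
    finally have eq: "(\<Sum>k\<in>A. (H i k + w i * w k / N) * (G k j - ?g k * ?g j / (N + ?Q))) =
        (if i = j then 1 else 0) - w i * (?g j / (N + ?Q)) + (w i / N) * ?g j
        - (w i / N) * ?Q * (?g j / (N + ?Q))" .
    \<comment> \<open>The common factor is - 1 / (N + Q) + 1 / N - Q / (N (N + Q)), which
      vanishes.\<close>
    have "- w i * (?g j / (N + ?Q)) + (w i / N) * ?g j - (w i / N) * ?Q * (?g j / (N + ?Q)) = 0"
      using pos N by (simp add: field_simps)
    with eq show ?thesis by simp
  qed
  then show ?thesis
    using G by (auto simp: is_inverse_on_def mult.commute)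
qed

text \<open>Induction on the samples: the multiple of the identity is inverted by hand, and each
  further sample is a rank-one update whose denominator is at least \<open>N\<close>.\<close>

lemma is_inverse_on_gram_shift_ex:
  assumes "finite A" "finite B" "0 < u" "0 < N"
  shows "\<exists>G. is_inverse_on A (gram_shift u N B x) G"
  using assms(2)
proof induction
  case empty
  have "is_inverse_on A (gram_shift u N {} x) (\<lambda>i j. if i = j then 1 / u else 0)"
  proof -
    have "(\<Sum>k\<in>A. (if i = k then u else 0) * (if k = j then 1 / u else 0)) = (if i = j then 1 else 0)"
      if "i \<in> A" for i j
      using sum_delta_times(1)[OF \<open>finite A\<close> that, of u "\<lambda>k. if k = j then 1 / u else 0"] \<open>0 < u\<close> by simp
    then show ?thesis by (auto simp: is_inverse_on_def gram_shift_def)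
  qed
  then show ?case by blast
next
  case (insert \<alpha> B)
  then obtain G where G: "is_inverse_on A (gram_shift u N B x) G" by blast
  have "is_inverse_on A (\<lambda>i j. gram_shift u N B x i j + x \<alpha> i * x \<alpha> j / N)
    (\<lambda>i j. G i j - mat_app A G (x \<alpha>) i * mat_app A G (x \<alpha>) j / (N + quad_form A G (x \<alpha>)))"
    using assms quad_form_nonneg[OF G \<open>finite A\<close>, of "x \<alpha>"]
    by (intro sherman_morrison G gram_shift_sym) auto
  then show ?case using insert by (auto simp: gram_shift_insert')
qed

section \<open>Identities and uniform bounds for the resolvent\<close>

context
  fixes u N :: real and A :: "'i set"
  assumes fin: "finite A" and u: "0 < u" and N: "0 < N"
begin

lemma resolvent_inverse:
  assumes "finite B"
  shows "is_inverse_on A (gram_shift u N B x) (resolvent u N A B x)"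
  unfolding resolvent_def by (rule someI_ex[OF is_inverse_on_gram_shift_ex[OF fin assms u N]])

lemma resolvent_sym:
  assumes "finite B" "i \<in> A" "j \<in> A"
  shows "resolvent u N A B x i j = resolvent u N A B x j i"
  using resolvent_inverse[OF assms(1)] assms by (auto simp: is_inverse_on_def)

lemma resolvent_quad_form_nonneg:
  assumes "finite B" shows "0 \<le> quad_form A (resolvent u N A B x) w"
  using quad_form_nonneg[OF resolvent_inverse[OF assms] fin] u N by simp

lemma resolvent_quad_form_ge:
  assumes "finite B"
  shows "u * (\<Sum>i\<in>A. (mat_app A (resolvent u N A B x) w i)^2) \<le> quad_form A (resolvent u N A B x) w"
  using quad_form_ge[OF resolvent_inverse[OF assms] fin] N by simp

lemma resolvent_empty:
  assumes "i \<in> A" "j \<in> A"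
  shows "resolvent u N A {} x i j = (if i = j then 1 / u else 0)"
proof -
  have "(\<Sum>k\<in>A. (if i = k then u else 0) * (if k = j then 1 / u else 0)) = (if i = j then 1 else 0)"
    if "i \<in> A" for i j
    using sum_delta_times(1)[OF fin that, of u "\<lambda>k. if k = j then 1 / u else 0"] u by simp
  then have "is_inverse_on A (gram_shift u N {} x) (\<lambda>i j. if i = j then 1 / u else 0)"
    by (auto simp: is_inverse_on_def gram_shift_def)
  then show ?thesis
    by (intro is_inverse_on_unique[OF resolvent_inverse _ gram_shift_sym fin assms]) auto
qed

lemma resolvent_insert:
  fixes x
  assumes "finite B" "\<alpha> \<notin> B" "i \<in> A" "j \<in> A"
  defines "G \<equiv> resolvent u N A B x"
  shows "resolvent u N A (insert \<alpha> B) x i j =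
    G i j - mat_app A G (x \<alpha>) i * mat_app A G (x \<alpha>) j / (N + quad_form A G (x \<alpha>))"
proof -
  have "is_inverse_on A (\<lambda>i j. gram_shift u N B x i j + x \<alpha> i * x \<alpha> j / N)
    (\<lambda>i j. G i j - mat_app A G (x \<alpha>) i * mat_app A G (x \<alpha>) j / (N + quad_form A G (x \<alpha>)))"
    unfolding G_def
    by (intro sherman_morrison resolvent_inverse gram_shift_sym N fin
        resolvent_quad_form_nonneg assms)
  then have "is_inverse_on A (gram_shift u N (insert \<alpha> B) x)
    (\<lambda>i j. G i j - mat_app A G (x \<alpha>) i * mat_app A G (x \<alpha>) j / (N + quad_form A G (x \<alpha>)))"
    using assms by (simp add: gram_shift_insert')
  then show ?thesis
    using assms(1) by (intro is_inverse_on_unique[OF resolvent_inverse _ gram_shift_sym fin assms(3,4)]) auto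
qed

text \<open>Measurability cannot be read off the choice operator; the rank-one recursion exhibits
  every entry as a rational expression in finitely many sample coordinates.\<close>

lemma resolvent_measurable:
  assumes "finite B"
    and "\<And>\<alpha> i. \<alpha> \<in> B \<Longrightarrow> i \<in> A \<Longrightarrow> (\<lambda>\<omega>. x \<omega> \<alpha> i) \<in> borel_measurable M"
    and "i \<in> A" "j \<in> A"
  shows "(\<lambda>\<omega>. resolvent u N A B (x \<omega>) i j) \<in> borel_measurable M"
  using assms
proof (induction B arbitrary: i j)
  case empty
  then show ?case by (simp add: resolvent_empty)
next
  case (insert \<alpha> B)
  have [measurable]: "(\<lambda>\<omega>. resolvent u N A B (x \<omega>) i j) \<in> borel_measurable M" if "i \<in> A" "j \<in> A" for i j
    using insert that by auto
  have [measurable]: "(\<lambda>\<omega>. x \<omega> \<alpha> i) \<in> borel_measurable M" if "i \<in> A" for i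
    using insert that by auto
  show ?case
    using insert.hyps insert.prems
    by (simp add: resolvent_insert mat_app_def quad_form_def)
qed

text \<open>The form at a basis vector is the diagonal entry, so the lower bound for forms reads u
  |G e_j|^2 <= G_jj. Keeping only the j-th coordinate on the left gives u G_jj^2 <= G_jj, hence the
  upper bound.\<close>

lemma resolvent_diag:
  fixes x
  assumes "finite B" "j \<in> A"
  defines "G \<equiv> resolvent u N A B x"
  shows "u * (\<Sum>i\<in>A. (G i j)^2) \<le> G j j" and "0 \<le> G j j" and "G j j \<le> 1 / u"
proof -
  let ?e = "\<lambda>i. if i = j then 1 else (0::real)"
  have app: "mat_app A G ?e i = G i j" for i
    unfolding mat_app_def using sum_delta_times(4)[OF fin assms(2), of "G i" 1] by simp
  have "quad_form A G ?e = G j j"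
    unfolding quad_form_def app using sum_delta_times(2)[OF fin assms(2), of 1 "\<lambda>i. G i j"] by simp
  then show 1: "u * (\<Sum>i\<in>A. (G i j)^2) \<le> G j j"
    using resolvent_quad_form_ge[OF assms(1), of x ?e] app by (simp add: G_def)
  then show 0: "0 \<le> G j j"
    using u by (meson less_imp_le mult_nonneg_nonneg order_trans sum_nonneg zero_le_power2)
  have "(G j j)^2 \<le> (\<Sum>i\<in>A. (G i j)^2)"
    using fin assms(2) by (intro member_le_sum) auto
  then have "u * (G j j)^2 \<le> G j j" using 1 u by (smt (verit) mult_left_mono)
  then have "G j j * (u * G j j) \<le> G j j * 1" by (simp add: power2_eq_square mult_ac)
  then have "u * G j j \<le> 1" if "G j j > 0" using that by (simp only: mult_le_cancel_left_pos)
  then show "G j j \<le> 1 / u" using 0 u by (cases "G j j = 0") (auto simp: field_simps)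
qed

lemma resolvent_trace_bounds:
  assumes "finite B"
  shows "0 \<le> ktrace A (resolvent u N A B x)" and "ktrace A (resolvent u N A B x) \<le> card A / u"
proof -
  show "0 \<le> ktrace A (resolvent u N A B x)"
    unfolding ktrace_def by (intro sum_nonneg resolvent_diag assms)
  have "ktrace A (resolvent u N A B x) \<le> (\<Sum>i\<in>A. 1 / u)"
    unfolding ktrace_def by (intro sum_mono resolvent_diag assms)
  then show "ktrace A (resolvent u N A B x) \<le> card A / u" by simp
qed

lemma resolvent_frobenius:
  assumes "finite B"
  shows "(\<Sum>i\<in>A. \<Sum>j\<in>A. (resolvent u N A B x i j)^2) \<le> card A / u^2"
proof -
  let ?G = "resolvent u N A B x"
  have "(\<Sum>i\<in>A. \<Sum>j\<in>A. (?G i j)^2) = (\<Sum>j\<in>A. \<Sum>i\<in>A. (?G i j)^2)"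
    by (rule sum.swap)
  also have "\<dots> \<le> (\<Sum>j\<in>A. 1 / u^2)"
  proof (rule sum_mono)
    fix j assume "j \<in> A"
    then have "u * (\<Sum>i\<in>A. (?G i j)^2) \<le> 1 / u"
      using resolvent_diag[OF assms \<open>j \<in> A\<close>, of x] by linarith
    then show "(\<Sum>i\<in>A. (?G i j)^2) \<le> 1 / u^2"
      using u by (simp add: field_simps power2_eq_square)
  qed
  finally show ?thesis by simp
qed

text \<open>The trace drops by |G x|^2 / (N + Q), where u |G x|^2 <= Q. The resulting bound 1 / u
  does not depend on the sample vector, which makes a bounded difference inequality applicable to
  unbounded data.\<close>

lemma resolvent_trace_insert:
  assumes "finite B" "\<alpha> \<notin> B"
  shows "ktrace A (resolvent u N A (insert \<alpha> B) x) \<le> ktrace A (resolvent u N A B x)"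
    and "ktrace A (resolvent u N A B x) \<le> ktrace A (resolvent u N A (insert \<alpha> B) x) + 1 / u"
proof -
  let ?G = "resolvent u N A B x"
  let ?g = "mat_app A ?G (x \<alpha>)" and ?Q = "quad_form A ?G (x \<alpha>)"
  have Q: "0 \<le> ?Q" by (rule resolvent_quad_form_nonneg) fact
  have "ktrace A (resolvent u N A (insert \<alpha> B) x) = (\<Sum>i\<in>A. ?G i i - ?g i * ?g i / (N + ?Q))"
    unfolding ktrace_def by (intro sum.cong) (simp_all add: resolvent_insert assms)
  also have "\<dots> = ktrace A ?G - (\<Sum>i\<in>A. (?g i)^2) / (N + ?Q)"
    by (simp add: ktrace_def sum_subtractf sum_divide_distrib power2_eq_square)
  finally have eq: "ktrace A (resolvent u N A (insert \<alpha> B) x) = ktrace A ?G - (\<Sum>i\<in>A. (?g i)^2) / (N + ?Q)" .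
  have "0 \<le> (\<Sum>i\<in>A. (?g i)^2) / (N + ?Q)" using Q N by (simp add: sum_nonneg)
  moreover have "(\<Sum>i\<in>A. (?g i)^2) / (N + ?Q) \<le> 1 / u"
  proof -
    have "u * (\<Sum>i\<in>A. (?g i)^2) \<le> N + ?Q"
      using resolvent_quad_form_ge[OF assms(1), of x "x \<alpha>"] N by linarith
    then show ?thesis using u N Q by (simp add: field_simps)
  qed
  ultimately show "ktrace A (resolvent u N A (insert \<alpha> B) x) \<le> ktrace A ?G"
    and "ktrace A ?G \<le> ktrace A (resolvent u N A (insert \<alpha> B) x) + 1 / u"
    using eq by linarith+
qed

text \<open>The trace of the identity \<open>(S + u) G = 1\<close>, with every sample vector separated from
  the resolvent by a rank-one update.\<close>

lemma resolvent_trace_identity: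
  fixes x
  assumes "finite B"
  defines "q \<equiv> \<lambda>\<alpha>. quad_form A (resolvent u N A (B - {\<alpha>}) x) (x \<alpha>) / N"
  shows "card A = u * ktrace A (resolvent u N A B x) + (\<Sum>\<alpha>\<in>B. q \<alpha> / (1 + q \<alpha>))"
proof -
  let ?G = "resolvent u N A B x"
  \<comment> \<open>Putting the sample back turns the leave-one-out form Q into Q - Q^2 / (N + Q) =
    N Q / (N + Q).\<close>
  have full: "quad_form A ?G (x \<alpha>) / N = q \<alpha> / (1 + q \<alpha>)" if "\<alpha> \<in> B" for \<alpha>
  proof -
    let ?G' = "resolvent u N A (B - {\<alpha>}) x"
    let ?g = "mat_app A ?G' (x \<alpha>)" and ?Q = "quad_form A ?G' (x \<alpha>)"
    have B: "B = insert \<alpha> (B - {\<alpha>})" using that by auto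
    have Q: "0 \<le> ?Q" using assms by (intro resolvent_quad_form_nonneg) auto
    have "?G i j = ?G' i j - ?g i * ?g j / (N + ?Q)" if "i \<in> A" "j \<in> A" for i j
      using that assms by (subst B, subst resolvent_insert) auto
    then have "mat_app A ?G (x \<alpha>) i = (\<Sum>j\<in>A. (?G' i j - ?g i * ?g j / (N + ?Q)) * x \<alpha> j)" if "i \<in> A" for i
      using that by (simp add: mat_app_def)
    moreover have "(\<Sum>j\<in>A. (?G' i j - ?g i * ?g j / (N + ?Q)) * x \<alpha> j) =
        ?g i - ?g i * ?Q / (N + ?Q)" for i
    proof -
      have "(\<Sum>j\<in>A. (?G' i j - ?g i * ?g j / (N + ?Q)) * x \<alpha> j) =
          (\<Sum>j\<in>A. ?G' i j * x \<alpha> j) - ?g i * (\<Sum>j\<in>A. x \<alpha> j * ?g j) / (N + ?Q)"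
        by (simp add: left_diff_distrib right_diff_distrib sum_subtractf sum_distrib_left divide_inverse mult_ac)
      then show ?thesis by (simp add: quad_form_def mat_app_def)
    qed
    ultimately have app: "mat_app A ?G (x \<alpha>) i = ?g i - ?g i * ?Q / (N + ?Q)" if "i \<in> A" for i
      using that by simp
    have "quad_form A ?G (x \<alpha>) = (\<Sum>i\<in>A. x \<alpha> i * mat_app A ?G (x \<alpha>) i)"
      by (rule quad_form_def)
    also have "\<dots> = (\<Sum>i\<in>A. x \<alpha> i * (?g i - ?g i * ?Q / (N + ?Q)))"
      by (simp add: app)
    also have "\<dots> = (\<Sum>i\<in>A. x \<alpha> i * ?g i) - (\<Sum>i\<in>A. x \<alpha> i * ?g i) * (?Q / (N + ?Q))"
      unfolding sum_distrib_right sum_subtractf[symmetric] by (simp add: right_diff_distrib mult_ac)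
    also have "\<dots> = ?Q - ?Q * (?Q / (N + ?Q))" by (simp add: quad_form_def)
    finally show ?thesis using Q N unfolding q_def by (simp add: field_simps)
  qed
  have "card A = (\<Sum>i\<in>A. \<Sum>k\<in>A. gram_shift u N B x i k * ?G k i)"
    by (simp add: is_inverse_onD(1)[OF resolvent_inverse[OF assms(1)]])
  also have "\<dots> = (\<Sum>i\<in>A. \<Sum>k\<in>A. (if i = k then u else 0) * ?G k i)
      + (\<Sum>i\<in>A. \<Sum>k\<in>A. \<Sum>\<alpha>\<in>B. x \<alpha> i * x \<alpha> k * ?G k i) / N"
    by (simp add: gram_shift_def distrib_right sum.distrib sum_divide_distrib sum_distrib_right)
  also have "(\<Sum>i\<in>A. \<Sum>k\<in>A. (if i = k then u else 0) * ?G k i) = u * ktrace A ?G"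
    using sum_delta_times(1)[OF fin] by (simp add: ktrace_def sum_distrib_left)
  also have "(\<Sum>i\<in>A. \<Sum>k\<in>A. \<Sum>\<alpha>\<in>B. x \<alpha> i * x \<alpha> k * ?G k i) =
      (\<Sum>i\<in>A. \<Sum>\<alpha>\<in>B. \<Sum>k\<in>A. x \<alpha> i * x \<alpha> k * ?G k i)"
    by (intro sum.cong refl sum.swap)
  also have "\<dots> = (\<Sum>\<alpha>\<in>B. \<Sum>i\<in>A. \<Sum>k\<in>A. x \<alpha> i * x \<alpha> k * ?G k i)"
    by (rule sum.swap)
  also have "\<dots> = (\<Sum>\<alpha>\<in>B. quad_form A ?G (x \<alpha>))"
    unfolding quad_form_def mat_app_def sum_distrib_left
    by (intro sum.cong refl) (simp add: resolvent_sym[OF assms(1)] mult_ac)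
  finally show ?thesis using full by (simp add: sum_divide_distrib)
qed

end

section \<open>Empirical spectral distributions\<close>

lemma trace_mult_comm:
  fixes X Y :: "real Matrix.mat"
  assumes "X \<in> carrier_mat n n" "Y \<in> carrier_mat n n"
  shows "(\<Sum>k<n. (X * Y) $$ (k, k)) = (\<Sum>k<n. (Y * X) $$ (k, k))"
proof -
  have "(\<Sum>k<n. (X * Y) $$ (k, k)) = (\<Sum>k<n. \<Sum>l<n. X $$ (k, l) * Y $$ (l, k))"
    using assms by (intro sum.cong) (auto simp: scalar_prod_def lessThan_atLeast0)
  also have "\<dots> = (\<Sum>l<n. \<Sum>k<n. X $$ (k, l) * Y $$ (l, k))" by (rule sum.swap)
  also have "\<dots> = (\<Sum>l<n. (Y * X) $$ (l, l))"
    using assms by (intro sum.cong) (auto simp: scalar_prod_def lessThan_atLeast0 mult.commute)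
  finally show ?thesis .
qed

text \<open>The inverse is again upper triangular: from the last row upwards, the terms left of the
  diagonal vanish by the shape of T and those right of it by induction. Then only the product of the
  two diagonal entries survives in the diagonal of T G.\<close>

lemma upper_triangular_inverse_diag:
  fixes T G :: "real Matrix.mat"
  assumes T: "T \<in> carrier_mat n n" and G: "G \<in> carrier_mat n n"
    and ut: "\<And>i j. i < n \<Longrightarrow> j < i \<Longrightarrow> T $$ (i, j) = 0"
    and nz: "\<And>i. i < n \<Longrightarrow> T $$ (i, i) \<noteq> 0"
    and inv: "T * G = 1\<^sub>m n" and "i < n"
  shows "G $$ (i, i) = 1 / T $$ (i, i)"
proof -
  have entry: "(\<Sum>k<n. T $$ (i, k) * G $$ (k, j)) = (if i = j then 1 else 0)" if "i < n" "j < n" for i j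
  proof -
    have "(T * G) $$ (i, j) = (\<Sum>k<n. T $$ (i, k) * G $$ (k, j))"
      using T G that by (simp add: scalar_prod_def lessThan_atLeast0)
    then show ?thesis using that by (simp add: inv)
  qed
  have low: "G $$ (i, j) = 0" if "i < n" "j < i" for i j
    using that
  proof (induction "n - i" arbitrary: i rule: less_induct)
    case less
    have "T $$ (i, k) * G $$ (k, j) = 0" if "k \<in> {..<n} - {i}" for k
    proof (cases "k < i")
      case False
      with that have "i < k" "k < n" by auto
      then have "G $$ (k, j) = 0" using less by (intro less.hyps) auto
      then show ?thesis by simp
    qed (use ut less in auto)
    then have "(\<Sum>k\<in>{..<n} - {i}. T $$ (i, k) * G $$ (k, j)) = 0" by (intro sum.neutral) blast
    then have "(\<Sum>k<n. T $$ (i, k) * G $$ (k, j)) = T $$ (i, i) * G $$ (i, j)"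
      using less.prems by (subst sum.remove[of _ i]) auto
    then show ?case using entry[of i j] less.prems nz[of i] by simp
  qed
  have "T $$ (i, k) * G $$ (k, i) = 0" if "k \<in> {..<n} - {i}" for k
    using that ut[of i k] low[of k i] \<open>i < n\<close> by (cases "k < i") auto
  then have "(\<Sum>k\<in>{..<n} - {i}. T $$ (i, k) * G $$ (k, i)) = 0" by (intro sum.neutral) blast
  then have "(\<Sum>k<n. T $$ (i, k) * G $$ (k, i)) = T $$ (i, i) * G $$ (i, i)"
    using \<open>i < n\<close> by (subst sum.remove[of _ i]) auto
  then show ?thesis using entry[of i i] nz[of i] \<open>i < n\<close> by (simp add: field_simps)
qed

text \<open>Schur triangularization puts the listed roots, with multiplicity, on the diagonal of a
  triangular matrix B similar to A. The trace is invariant under the conjugation, which carries G to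
  the inverse of B + u.\<close>

lemma trace_resolvent_char_poly:
  fixes A G :: "real Matrix.mat"
  assumes A: "A \<in> carrier_mat n n" and G: "G \<in> carrier_mat n n"
    and cp: "char_poly A = (\<Prod>a\<leftarrow>es. [:- a, 1:])" and nz: "\<And>a. a \<in> set es \<Longrightarrow> a + u \<noteq> 0"
    and inv: "(A + u \<cdot>\<^sub>m 1\<^sub>m n) * G = 1\<^sub>m n"
  shows "(\<Sum>k<n. G $$ (k, k)) = (\<Sum>a\<leftarrow>es. 1 / (a + u))"
proof -
  obtain B P Q where dec: "schur_decomposition A es = (B, P, Q)"
    by (cases "schur_decomposition A es") auto
  from schur_decomposition[OF A cp dec]
  have wit: "similar_mat_wit A B P Q" and ut: "upper_triangular B" and diag: "diag_mat B = es" by auto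
  from similar_mat_witD2[OF A wit]
  have PQ: "P * Q = 1\<^sub>m n" and QP: "Q * P = 1\<^sub>m n" and dA: "A = P * B * Q"
    and car: "B \<in> carrier_mat n n" "P \<in> carrier_mat n n" "Q \<in> carrier_mat n n" by blast+
  define T where "T = B + u \<cdot>\<^sub>m 1\<^sub>m n"
  define R where "R = A + u \<cdot>\<^sub>m 1\<^sub>m n"
  define H where "H = Q * (G * P)"
  have T: "T \<in> carrier_mat n n" and R: "R \<in> carrier_mat n n" and H: "H \<in> carrier_mat n n"
    using car G A by (auto simp: T_def R_def H_def)
  have PT: "P * T = R * P"
  proof -
    have "A * P = P * B * (Q * P)"
      unfolding dA using car by (intro assoc_mult_mat) auto
    then have AP: "A * P = P * B" using car by (simp add: QP)
    have "R * P = A * P + u \<cdot>\<^sub>m 1\<^sub>m n * P"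
      unfolding R_def using A car by (intro add_mult_distrib_mat) auto
    moreover have "u \<cdot>\<^sub>m 1\<^sub>m n * P = u \<cdot>\<^sub>m P" using car by (subst mult_smult_assoc_mat) auto
    moreover have "P * (u \<cdot>\<^sub>m 1\<^sub>m n) = u \<cdot>\<^sub>m P" using car by (subst mult_smult_distrib) auto
    moreover have "P * T = P * B + P * (u \<cdot>\<^sub>m 1\<^sub>m n)"
      unfolding T_def using car by (intro mult_add_distrib_mat) auto
    ultimately show ?thesis using AP by simp
  qed
  have "P * (T * H) = (P * T) * H" using car T H by (intro assoc_mult_mat[symmetric]) auto
  moreover have "(R * P) * H = R * (P * H)" using car R H by (intro assoc_mult_mat) auto
  moreover have "P * H = G * P"
  proof -
    have "P * H = (P * Q) * (G * P)"
      unfolding H_def using car G by (intro assoc_mult_mat[symmetric]) auto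
    then show ?thesis using car G by (simp add: PQ)
  qed
  moreover have "R * (G * P) = (R * G) * P" using car G R by (intro assoc_mult_mat[symmetric]) auto
  moreover have "(R * G) * P = P" using car inv by (simp add: R_def)
  ultimately have PTH: "P * (T * H) = P" by (simp add: PT)
  have "T * H = (Q * P) * (T * H)" using T H by (simp add: QP)
  moreover have "(Q * P) * (T * H) = Q * (P * (T * H))" using car T H by (intro assoc_mult_mat) auto
  ultimately have TG: "T * H = 1\<^sub>m n" by (simp add: PTH QP)
  have len: "length es = n" using diag car by (auto simp: diag_mat_def)
  have B_diag: "B $$ (i, i) = es ! i" if "i < n" for i
    using that car by (simp flip: diag add: diag_mat_def)
  have T_diag: "T $$ (i, i) = es ! i + u" if "i < n" for i
    using that car B_diag[OF that] by (simp add: T_def)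
  have entry: "H $$ (i, i) = 1 / (es ! i + u)" if i: "i < n" for i
  proof -
    have "H $$ (i, i) = 1 / T $$ (i, i)"
    proof (rule upper_triangular_inverse_diag[OF T H _ _ TG i])
      fix i j assume ij: "i < n" "j < i"
      then have "B $$ (i, j) = 0" using upper_triangularD[OF ut, of j i] car by simp
      then show "T $$ (i, j) = 0" using ij car by (simp add: T_def)
    next
      fix i assume "i < n"
      then show "T $$ (i, i) \<noteq> 0"
        using nz[of "es ! i"] len T_diag[of i] by simp
    qed
    then show ?thesis using T_diag[OF i] by simp
  qed
  have "G * P * Q = G"
  proof -
    have "G * P * Q = G * (P * Q)" using car G by (intro assoc_mult_mat) auto
    then show ?thesis using G by (simp add: PQ)
  qed
  then have "(\<Sum>k<n. G $$ (k, k)) = (\<Sum>k<n. (G * P * Q) $$ (k, k))" by simp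
  also have "\<dots> = (\<Sum>k<n. H $$ (k, k))"
    unfolding H_def using car G by (intro trace_mult_comm) auto
  also have "\<dots> = (\<Sum>k<n. 1 / (es ! k + u))" by (simp add: entry)
  also have "\<dots> = (\<Sum>a\<leftarrow>es. 1 / (a + u))"
    by (simp add: sum_list_sum_nth len lessThan_atLeast0)
  finally show ?thesis .
qed

text \<open>For an eigenvector w, the Hermitian form at w equals a |w|^2. Its real part is the sum
  of the real forms at Re w and Im w, and its imaginary part is a difference of two terms that agree
  by symmetry.\<close>

lemma psd_eigenvalue:
  fixes f :: "nat \<Rightarrow> nat \<Rightarrow> real" and n :: nat
  defines "A \<equiv> Matrix.mat n n (\<lambda>(i, j). f i j)"
  assumes sym: "\<And>i j. i < n \<Longrightarrow> j < n \<Longrightarrow> f i j = f j i"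
    and psd: "\<And>w :: nat \<Rightarrow> real. 0 \<le> (\<Sum>i<n. \<Sum>j<n. w i * f i j * w j)"
    and ev: "eigenvalue (map_mat complex_of_real A) a"
  shows "Im a = 0" and "0 \<le> Re a"
proof -
  let ?C = "map_mat complex_of_real A"
  from ev obtain v where v: "v \<in> carrier_vec n" "v \<noteq> 0\<^sub>v n" and eq: "?C *\<^sub>v v = a \<cdot>\<^sub>v v"
    by (auto simp: eigenvalue_def eigenvector_def A_def)
  define w where "w i = vec_index v i" for i
  have row: "(\<Sum>j<n. complex_of_real (f i j) * w j) = a * w i" if "i < n" for i
  proof -
    have "vec_index (?C *\<^sub>v v) i = (\<Sum>j<n. complex_of_real (f i j) * w j)"
      using v that by (simp add: scalar_prod_def lessThan_atLeast0 A_def w_def)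
    then show ?thesis using eq v that by (simp add: w_def)
  qed
  define S where "S = (\<Sum>i<n. (cmod (w i))^2)"
  let ?b = "\<lambda>i. Re (w i)" and ?c = "\<lambda>i. Im (w i)"
  have S: "0 < S"
  proof -
    obtain i where i: "i < n" "w i \<noteq> 0"
      unfolding w_def using v by (metis carrier_vecD eq_vecI index_zero_vec(1) index_zero_vec(2))
    then have "0 < (cmod (w i))^2" by simp
    also have "\<dots> \<le> S" unfolding S_def using i by (intro member_le_sum) auto
    finally show ?thesis .
  qed
  have L: "(\<Sum>i<n. \<Sum>j<n. cnj (w i) * complex_of_real (f i j) * w j) = a * complex_of_real S"
  proof -
    have "(\<Sum>i<n. \<Sum>j<n. cnj (w i) * complex_of_real (f i j) * w j)
        = (\<Sum>i<n. cnj (w i) * (a * w i))"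
      by (intro sum.cong refl) (simp add: row[symmetric] sum_distrib_left mult.assoc)
    also have "\<dots> = (\<Sum>i<n. a * complex_of_real ((cmod (w i))^2))"
    proof (intro sum.cong refl)
      fix i
      have "complex_of_real ((cmod (w i))^2) = w i * cnj (w i)"
        by (rule complex_norm_square)
      then show "cnj (w i) * (a * w i) = a * complex_of_real ((cmod (w i))^2)"
        by (simp only: mult_ac)
    qed
    finally show ?thesis by (simp add: S_def sum_distrib_left)
  qed
  have reim: "Re (cnj (w i) * complex_of_real r * w j) = ?b i * r * ?b j + ?c i * r * ?c j"
    "Im (cnj (w i) * complex_of_real r * w j) = ?b i * r * ?c j - ?c i * r * ?b j" for i j r
    by (simp_all add: algebra_simps)
  have "Re a * S = (\<Sum>i<n. \<Sum>j<n. ?b i * f i j * ?b j) + (\<Sum>i<n. \<Sum>j<n. ?c i * f i j * ?c j)"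
    using arg_cong[OF L, of Re] by (simp only: Re_sum reim sum.distrib) simp
  moreover have "0 \<le> \<dots>" using psd[of ?b] psd[of ?c] by simp
  ultimately have "0 \<le> Re a * S" by simp
  then show "0 \<le> Re a" using S by (simp add: zero_le_mult_iff)
  have "Im a * S = (\<Sum>i<n. \<Sum>j<n. ?b i * f i j * ?c j) - (\<Sum>i<n. \<Sum>j<n. ?c i * f i j * ?b j)"
    using arg_cong[OF L, of Im] by (simp only: Im_sum reim sum_subtractf) simp
  also have "(\<Sum>i<n. \<Sum>j<n. ?c i * f i j * ?b j) = (\<Sum>j<n. \<Sum>i<n. ?c i * f i j * ?b j)"
    by (rule sum.swap)
  also have "\<dots> = (\<Sum>i<n. \<Sum>j<n. ?b i * f i j * ?c j)"
    by (intro sum.cong refl) (simp add: sym mult_ac)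
  finally show "Im a = 0" using S by simp
qed

text \<open>The polynomial splits over the complex numbers and its roots turn out to be real, so the
  factorization descends through the injective map of real into complex polynomials.\<close>

lemma psd_char_poly:
  fixes f :: "nat \<Rightarrow> nat \<Rightarrow> real" and n :: nat
  defines "A \<equiv> Matrix.mat n n (\<lambda>(i, j). f i j)"
  assumes sym: "\<And>i j. i < n \<Longrightarrow> j < n \<Longrightarrow> f i j = f j i"
    and psd: "\<And>w :: nat \<Rightarrow> real. 0 \<le> (\<Sum>i<n. \<Sum>j<n. w i * f i j * w j)"
  obtains es where "char_poly A = (\<Prod>a\<leftarrow>es. [:- a, 1:])" "length es = n" "\<And>a. a \<in> set es \<Longrightarrow> 0 \<le> a"
proof -
  let ?C = "map_mat complex_of_real A"
  have A: "A \<in> carrier_mat n n" by (simp add: A_def)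
  then have C: "?C \<in> carrier_mat n n" by simp
  obtain as where as: "char_poly ?C = (\<Prod>a\<leftarrow>as. [:- a, 1:])" "length as = n"
    using char_poly_factorized[OF C] by blast
  have ev: "Im a = 0 \<and> 0 \<le> Re a" if "a \<in> set as" for a
  proof -
    have "poly (char_poly ?C) a = 0" using that unfolding as(1) by (induction as) auto
    then have "eigenvalue ?C a" using eigenvalue_root_char_poly[OF C] by simp
    then show ?thesis using psd_eigenvalue[OF sym psd] unfolding A_def by blast
  qed
  interpret mh: map_poly_inj_idom_hom complex_of_real ..
  have "map_poly complex_of_real (\<Prod>a\<leftarrow>as. [:- Re a, 1:]) = (\<Prod>a\<leftarrow>as. [:- a, 1:])"
    using ev
  proof (induction as)
    case (Cons a as)
    have "map_poly complex_of_real [:- Re a, 1:] = [:- a, 1:]"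
      using Cons.prems[of a] by (simp add: complex_eq_iff)
    then show ?case using Cons by (simp add: mh.hom_mult del: mult_pCons_left)
  qed simp
  also have "\<dots> = map_poly complex_of_real (char_poly A)"
    by (rule trans[OF as(1)[symmetric] of_real_hom.char_poly_hom[OF A]])
  finally have "char_poly A = (\<Prod>a\<leftarrow>map Re as. [:- a, 1:])"
    by (simp add: mh.eq_iff comp_def)
  then show ?thesis using as(2) ev by (intro that[of "map Re as"]) auto
qed

lemma proots_linear_factors: "proots (\<Prod>a\<leftarrow>es. [:- a, 1:]) = mset (es :: real list)"
proof (induction es)
  case (Cons a es)
  have "(\<Prod>a\<leftarrow>es. [:- a, 1:]) \<noteq> 0" by (induction es) (auto simp del: mult_pCons_left)
  then show ?case using Cons by (simp add: proots_mult del: mult_pCons_left)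
qed simp

lemma integral_pmf_of_multiset_mset:
  fixes h :: "real \<Rightarrow> real"
  assumes "es \<noteq> []"
  shows "(LINT t|measure_pmf (pmf_of_multiset (mset es)). h t) = (\<Sum>a\<leftarrow>es. h a) / length es"
proof -
  have ne: "mset es \<noteq> {#}" using assms by simp
  have cnt: "(\<Sum>a\<in>set es. real (count (mset es) a) * h a) = (\<Sum>a\<leftarrow>es. h a)" for es
  proof (induction es)
    case (Cons b es)
    have "(\<Sum>a\<in>set (b # es). real (count (mset (b # es)) a) * h a)
        = (\<Sum>a\<in>insert b (set es). real (count (mset es) a) * h a + (if a = b then h a else 0))"
      by (intro sum.cong) (auto simp: algebra_simps)
    also have "\<dots> = (\<Sum>a\<in>insert b (set es). real (count (mset es) a) * h a) + h b"
      by (simp add: sum.distrib)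
    also have "(\<Sum>a\<in>insert b (set es). real (count (mset es) a) * h a)
        = (\<Sum>a\<in>set es. real (count (mset es) a) * h a)"
      by (cases "b \<in> set es") (auto simp: insert_absorb count_mset_0_iff)
    finally show ?case using Cons by simp
  qed simp
  have "(LINT t|measure_pmf (pmf_of_multiset (mset es)). h t)
      = (\<Sum>a\<in>set es. pmf (pmf_of_multiset (mset es)) a *\<^sub>R h a)"
    using ne by (intro integral_measure_pmf) auto
  also have "\<dots> = (\<Sum>a\<in>set es. real (count (mset es) a) * h a) / length es"
    using ne by (simp add: sum_divide_distrib)
  finally show ?thesis by (simp add: cnt)
qed

lemma real_distribution_esd: "real_distribution (esd A)"
proof -
  interpret prob_space "esd A"
    unfolding esd_def by (intro prob_space.prob_space_distr prob_space_measure_pmf) simp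
  show ?thesis by unfold_locales (auto simp: esd_def)
qed

context
  fixes N :: real and A :: "'i set" and B :: "'s set" and x :: "'s \<Rightarrow> 'i \<Rightarrow> real" and E :: "real measure"
  assumes fin: "finite A" and ne: "A \<noteq> {}" and finB: "finite B" and N: "0 < N"
  defines "E \<equiv> esd (mat_on A (\<lambda>i j. (1 / N) * (\<Sum>\<alpha>\<in>B. x \<alpha> i * x \<alpha> j)))"
begin

text \<open>The bridge between the two matrix formalisms: the enumeration behind
  \<open>mat_on\<close> carries the resolvent on an arbitrary index set to a library inverse, whose
  trace is a sum over the eigenvalues.\<close>

lemma esd_gram:
  shows "AE t in E. 0 \<le> t"
    and "0 < u \<Longrightarrow> (LINT t|E. 1 / (t + u)) = ktrace A (resolvent u N A B x) / card A"
proof -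
  let ?n = "card A" and ?e = "from_nat_into A"
  have bij: "bij_betw ?e {..<?n} A" by (rule bij_betw_from_nat_into_finite) (rule fin)
  have eA: "?e k \<in> A" if "k < ?n" for k using bij that by (auto simp: bij_betw_def)
  have n0: "0 < ?n" using fin ne by (simp add: card_gt_0_iff)
  define f where "f k l = (1 / N) * (\<Sum>\<alpha>\<in>B. x \<alpha> (?e k) * x \<alpha> (?e l))" for k l
  define S where "S = Matrix.mat ?n ?n (\<lambda>(k, l). f k l)"
  have S: "S \<in> carrier_mat ?n ?n" by (simp add: S_def)
  have psd: "0 \<le> (\<Sum>i<?n. \<Sum>j<?n. w i * f i j * w j)" for w
  proof -
    have "(\<Sum>i<?n. \<Sum>j<?n. w i * f i j * w j)
        = (1 / N) * (\<Sum>i<?n. \<Sum>j<?n. \<Sum>\<alpha>\<in>B. (w i * x \<alpha> (?e i)) * (w j * x \<alpha> (?e j)))"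
      by (simp add: f_def sum_distrib_left sum_distrib_right mult_ac)
    also have "(\<Sum>i<?n. \<Sum>j<?n. \<Sum>\<alpha>\<in>B. (w i * x \<alpha> (?e i)) * (w j * x \<alpha> (?e j)))
        = (\<Sum>i<?n. \<Sum>\<alpha>\<in>B. \<Sum>j<?n. (w i * x \<alpha> (?e i)) * (w j * x \<alpha> (?e j)))"
      by (intro sum.cong refl sum.swap)
    also have "\<dots> = (\<Sum>\<alpha>\<in>B. \<Sum>i<?n. \<Sum>j<?n. (w i * x \<alpha> (?e i)) * (w j * x \<alpha> (?e j)))"
      by (rule sum.swap)
    also have "\<dots> = (\<Sum>\<alpha>\<in>B. (\<Sum>i<?n. w i * x \<alpha> (?e i))\<^sup>2)"
      by (simp add: power2_eq_square sum_product)
    finally show ?thesis using N by (simp add: sum_nonneg)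
  qed
  have sym: "f i j = f j i" for i j by (simp add: f_def mult.commute)
  obtain es where es: "char_poly S = (\<Prod>a\<leftarrow>es. [:- a, 1:])" "length es = ?n" "\<And>a. a \<in> set es \<Longrightarrow> 0 \<le> a"
    using psd_char_poly[OF sym psd] unfolding S_def by blast
  have es0: "es \<noteq> []" using es(2) n0 by auto
  have E: "E = distr (measure_pmf (pmf_of_multiset (mset es))) borel (\<lambda>t. t)"
  proof -
    have "mat_on A (\<lambda>i j. (1 / N) * (\<Sum>\<alpha>\<in>B. x \<alpha> i * x \<alpha> j)) = S"
      by (simp add: mat_on_def S_def f_def)
    then show ?thesis by (simp add: E_def esd_def es(1) proots_linear_factors)
  qed
  show "AE t in E. 0 \<le> t"
    unfolding E using es0 es(3) by (subst AE_distr_iff) (auto simp: AE_measure_pmf_iff)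
  assume u: "0 < u"
  let ?R = "resolvent u N A B x"
  define G where "G = Matrix.mat ?n ?n (\<lambda>(k, l). ?R (?e k) (?e l))"
  have inv: "(S + u \<cdot>\<^sub>m 1\<^sub>m ?n) * G = 1\<^sub>m ?n"
  proof (rule eq_matI)
    fix k l assume kl: "k < dim_row (1\<^sub>m ?n)" "l < dim_col (1\<^sub>m ?n)"
    have "((S + u \<cdot>\<^sub>m 1\<^sub>m ?n) * G) $$ (k, l)
        = (\<Sum>m<?n. (f k m + (if k = m then u else 0)) * ?R (?e m) (?e l))"
      using kl by (auto simp: scalar_prod_def lessThan_atLeast0 S_def G_def intro!: sum.cong)
    also have "\<dots> = (\<Sum>m<?n. gram_shift u N B x (?e k) (?e m) * ?R (?e m) (?e l))"
    proof (intro sum.cong refl)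
      fix m assume "m \<in> {..<?n}"
      then have "?e k = ?e m \<longleftrightarrow> k = m" using bij kl by (auto simp: bij_betw_def inj_on_def)
      then show "(f k m + (if k = m then u else 0)) * ?R (?e m) (?e l) = gram_shift u N B x (?e k) (?e m) * ?R (?e m) (?e l)"
        by (simp add: gram_shift_def f_def)
    qed
    also have "\<dots> = (\<Sum>a\<in>A. gram_shift u N B x (?e k) a * ?R a (?e l))"
      using sum.reindex_bij_betw[OF bij, of "\<lambda>a. gram_shift u N B x (?e k) a * ?R a (?e l)"] by simp
    also have "\<dots> = (if ?e k = ?e l then 1 else 0)"
      using kl eA by (intro is_inverse_onD(1)[OF resolvent_inverse[OF fin u N finB]]) auto
    also have "\<dots> = 1\<^sub>m ?n $$ (k, l)"
      using kl bij by (auto simp: bij_betw_def inj_on_def)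
    finally show "((S + u \<cdot>\<^sub>m 1\<^sub>m ?n) * G) $$ (k, l) = 1\<^sub>m ?n $$ (k, l)" .
  qed (auto simp: S_def G_def)
  have "(LINT t|E. 1 / (t + u)) = (LINT t|measure_pmf (pmf_of_multiset (mset es)). 1 / (t + u))"
    unfolding E by (subst integral_distr) auto
  also have "\<dots> = (\<Sum>a\<leftarrow>es. 1 / (a + u)) / length es"
    by (rule integral_pmf_of_multiset_mset) (rule es0)
  also have "(\<Sum>a\<leftarrow>es. 1 / (a + u)) = (\<Sum>k<?n. G $$ (k, k))"
  proof (rule trace_resolvent_char_poly[OF S _ es(1) _ inv, symmetric])
    show "G \<in> carrier_mat ?n ?n" by (simp add: G_def)
    show "a + u \<noteq> 0" if "a \<in> set es" for a using es(3)[OF that] u by simp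
  qed
  also have "\<dots> = (\<Sum>k<?n. ?R (?e k) (?e k))" by (simp add: G_def)
  also have "\<dots> = ktrace A ?R"
    unfolding ktrace_def by (rule sum.reindex_bij_betw[OF bij])
  finally show "(LINT t|E. 1 / (t + u)) = ktrace A ?R / card A" by (simp add: es(2))
qed

end

section \<open>McDiarmid's inequality\<close>

text \<open>Induction on the coordinates: averaging over the new coordinate leaves a function
  \<open>g\<close> of the others with the same difference bound, and Hoeffding's lemma controls the
  exponential moment of the inner fluctuation.\<close>

lemma bounded_differences_mgf:
  fixes L :: "'s measure" and f :: "('k \<Rightarrow> 's) \<Rightarrow> real"
  assumes L: "prob_space L" and "finite I" and l: "0 < l"
    and "f \<in> borel_measurable (PiM I (\<lambda>_. L))"
    and "\<And>x. x \<in> space (PiM I (\<lambda>_. L)) \<Longrightarrow> \<bar>f x\<bar> \<le> C"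
    and "\<And>x i y. x \<in> space (PiM I (\<lambda>_. L)) \<Longrightarrow> i \<in> I \<Longrightarrow> y \<in> space L \<Longrightarrow> \<bar>f (x(i := y)) - f x\<bar> \<le> b"
  shows "(\<integral>\<^sup>+x. ennreal (exp (l * (f x - (LINT x|PiM I (\<lambda>_. L). f x)))) \<partial>PiM I (\<lambda>_. L))
    \<le> ennreal (exp (l\<^sup>2 * b\<^sup>2 / 2 * card I))"
  using assms(2,4-)
proof (induction I arbitrary: f)
  case empty
  show ?case by (simp add: PiM_empty nn_integral_count_space_finite lebesgue_integral_count_space_finite)
next
  case (insert i I f)
  interpret L: prob_space L by fact
  interpret product_prob_space "\<lambda>_. L" by unfold_locales
  let ?P = "\<lambda>I. PiM I (\<lambda>_. L)"
  have prob: "prob_space (?P J)" for J :: "'k set" by (rule prob_space_PiM) (rule L)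
  have [measurable]: "f \<in> borel_measurable (?P (insert i I))" by fact
  have upd[measurable]: "(\<lambda>(x, y). x(i := y)) \<in> ?P I \<Otimes>\<^sub>M L \<rightarrow>\<^sub>M ?P (insert i I)"
    by (rule measurable_add_dim)
  have upd_space: "x(i := y) \<in> space (?P (insert i I))" if "x \<in> space (?P I)" "y \<in> space L" for x y
    using that by (auto simp: space_PiM PiE_iff extensional_def)
  have fm: "(\<lambda>(x, y). f (x(i := y))) \<in> borel_measurable (?P I \<Otimes>\<^sub>M L)"
    using measurable_compose[OF upd, of f borel] by (simp add: split_beta')
  define g where "g x = (LINT y|L. f (x(i := y)))" for x
  have gm: "g \<in> borel_measurable (?P I)"
    unfolding g_def using fm by (intro L.borel_measurable_lebesgue_integral) (simp add: split_beta')
  have hm: "(\<lambda>y. f (x(i := y))) \<in> borel_measurable L" if "x \<in> space (?P I)" for x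
    using measurable_Pair2[OF fm that] by simp
  have hi: "integrable L (\<lambda>y. f (x(i := y)))" if "x \<in> space (?P I)" for x
    using insert.prems(2) upd_space that hm
    by (intro L.integrable_const_bound[where B = C]) auto
  have gC: "\<bar>g x\<bar> \<le> C" if "x \<in> space (?P I)" for x
  proof -
    have "\<bar>g x\<bar> \<le> (LINT y|L. \<bar>f (x(i := y))\<bar>)" unfolding g_def by (rule integral_abs_bound)
    also have "\<dots> \<le> (LINT y|L. C)"
      using hi[OF that] insert.prems(2) upd_space that by (intro integral_mono) auto
    finally show ?thesis by (simp add: L.prob_space)
  qed
  have gd: "\<bar>g (x(j := y)) - g x\<bar> \<le> b" if x: "x \<in> space (?P I)" and j: "j \<in> I" and y: "y \<in> space L" for x j y
  proof -
    have ij: "i \<noteq> j" using j insert.hyps by auto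
    have xj: "x(j := y) \<in> space (?P I)"
      using x y j by (auto simp: space_PiM PiE_iff extensional_def)
    have "g (x(j := y)) - g x = (LINT t|L. f (x(j := y, i := t)) - f (x(i := t)))"
      unfolding g_def using hi[OF x] hi[OF xj] by simp
    also have "\<bar>\<dots>\<bar> \<le> (LINT t|L. \<bar>f (x(j := y, i := t)) - f (x(i := t))\<bar>)"
      by (rule integral_abs_bound)
    also have "\<dots> \<le> (LINT t|L. b)"
    proof (intro integral_mono)
      fix t assume t: "t \<in> space L"
      show "\<bar>f (x(j := y, i := t)) - f (x(i := t))\<bar> \<le> b"
        unfolding fun_upd_twist[OF ij[symmetric]]
        by (rule insert.prems(3)[OF upd_space[OF x t]]) (use j y in auto)
    qed (use hi[OF x] hi[OF xj] in auto)
    finally show ?thesis by (simp add: L.prob_space)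
  qed
  have fi: "integrable (?P (insert i I)) f"
    using insert.prems(2) by (intro finite_measure.integrable_const_bound[where B = C] prob_space.finite_measure prob) auto
  have Ef: "(LINT x|?P (insert i I). f x) = (LINT x|?P I. g x)"
    unfolding g_def using insert.hyps fi by (intro product_integral_insert) auto
  define E where "E = (LINT x|?P I. g x)"
  have "(\<integral>\<^sup>+x. ennreal (exp (l * (f x - E))) \<partial>?P (insert i I))
      = (\<integral>\<^sup>+x. \<integral>\<^sup>+y. ennreal (exp (l * (f (x(i := y)) - E))) \<partial>L \<partial>?P I)"
    using insert.hyps by (intro product_nn_integral_insert) auto
  also have "\<dots> \<le> (\<integral>\<^sup>+x. ennreal (exp (l\<^sup>2 * b\<^sup>2 / 2)) * ennreal (exp (l * (g x - E))) \<partial>?P I)"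
  proof (intro nn_integral_mono)
    fix x assume x: "x \<in> space (?P I)"
    have dev: "\<bar>f (x(i := y)) - g x\<bar> \<le> b" if "y \<in> space L" for y
    proof -
      have "f (x(i := y)) - g x = (LINT t|L. f (x(i := y)) - f (x(i := t)))"
        unfolding g_def using hi[OF x] by (simp add: L.prob_space)
      also have "\<bar>\<dots>\<bar> \<le> (LINT t|L. \<bar>f (x(i := y)) - f (x(i := t))\<bar>)" by (rule integral_abs_bound)
      also have "\<dots> \<le> (LINT t|L. b)"
      proof (intro integral_mono)
        fix t assume "t \<in> space L"
        then show "\<bar>f (x(i := y)) - f (x(i := t))\<bar> \<le> b"
          using insert.prems(3)[OF upd_space[OF x], of t i y, unfolded fun_upd_upd] that by blast
      qed (use hi[OF x] in auto)
      finally show ?thesis by (simp add: L.prob_space)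
    qed
    \<comment> \<open>The function stays within b of its conditional mean, so the interval has
      length 2 b; this is why Hoeffding's (2 b)^2 / 8 appears as b^2 / 2.\<close>
    interpret interval_bounded_random_variable L "\<lambda>y. f (x(i := y))" "g x - b" "g x + b"
    proof unfold_locales
      show "(\<lambda>y. f (x(i := y))) \<in> borel_measurable L" by (rule hm) fact
      show "AE y in L. f (x(i := y)) \<in> {g x - b..g x + b}"
        by (intro AE_I2) (auto dest!: dev simp: abs_le_iff)
    qed
    have "(\<integral>\<^sup>+y. ennreal (exp (l * (f (x(i := y)) - E))) \<partial>L)
        = (\<integral>\<^sup>+y. ennreal (exp (l * (f (x(i := y)) - g x))) * ennreal (exp (l * (g x - E))) \<partial>L)"
      by (intro nn_integral_cong) (simp add: ennreal_mult[symmetric] exp_add[symmetric] algebra_simps)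
    also have "\<dots> = (\<integral>\<^sup>+y. ennreal (exp (l * (f (x(i := y)) - g x))) \<partial>L) * ennreal (exp (l * (g x - E)))"
      using hm[OF x] by (intro nn_integral_multc) measurable
    also have "\<dots> \<le> ennreal (exp (l\<^sup>2 * b\<^sup>2 / 2)) * ennreal (exp (l * (g x - E)))"
    proof (rule mult_right_mono)
      have "(\<integral>\<^sup>+y. ennreal (exp (l * (f (x(i := y)) - g x))) \<partial>L) \<le> ennreal (exp (l\<^sup>2 * ((g x + b) - (g x - b))\<^sup>2 / 8))"
        unfolding g_def[of x] by (rule Hoeffdings_lemma_nn_integral[OF l, unfolded g_def])
      also have "l\<^sup>2 * ((g x + b) - (g x - b))\<^sup>2 / 8 = l\<^sup>2 * b\<^sup>2 / 2" by (simp add: power2_eq_square)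
      finally show "(\<integral>\<^sup>+y. ennreal (exp (l * (f (x(i := y)) - g x))) \<partial>L) \<le> ennreal (exp (l\<^sup>2 * b\<^sup>2 / 2))" .
    qed simp
    finally show "(\<integral>\<^sup>+y. ennreal (exp (l * (f (x(i := y)) - E))) \<partial>L)
      \<le> ennreal (exp (l\<^sup>2 * b\<^sup>2 / 2)) * ennreal (exp (l * (g x - E)))" .
  qed
  also have "\<dots> = ennreal (exp (l\<^sup>2 * b\<^sup>2 / 2)) * (\<integral>\<^sup>+x. ennreal (exp (l * (g x - E))) \<partial>?P I)"
    using measurable_compose[OF gm, of "\<lambda>t. ennreal (exp (l * (t - E)))" borel]
    by (intro nn_integral_cmult) simp
  also have "\<dots> \<le> ennreal (exp (l\<^sup>2 * b\<^sup>2 / 2)) * ennreal (exp (l\<^sup>2 * b\<^sup>2 / 2 * card I))"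
    using insert.IH[OF gm gC gd] unfolding E_def by (intro mult_left_mono) auto
  also have "\<dots> = ennreal (exp (l\<^sup>2 * b\<^sup>2 / 2 * card (insert i I)))"
    using insert.hyps by (simp add: ennreal_mult[symmetric] exp_add[symmetric] algebra_simps)
  finally show ?case by (simp add: Ef E_def)
qed

lemma bounded_differences_upper_tail:
  fixes L :: "'s measure" and f :: "('k \<Rightarrow> 's) \<Rightarrow> real"
  assumes L: "prob_space L" and I: "finite I" "I \<noteq> {}" and eps: "0 < \<epsilon>" and b: "0 < b"
    and f: "f \<in> borel_measurable (PiM I (\<lambda>_. L))"
    and C: "\<And>x. x \<in> space (PiM I (\<lambda>_. L)) \<Longrightarrow> \<bar>f x\<bar> \<le> C"
    and diff: "\<And>x i y. x \<in> space (PiM I (\<lambda>_. L)) \<Longrightarrow> i \<in> I \<Longrightarrow> y \<in> space L \<Longrightarrow> \<bar>f (x(i := y)) - f x\<bar> \<le> b"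
  shows "Sigma_Algebra.measure (PiM I (\<lambda>_. L)) {x \<in> space (PiM I (\<lambda>_. L)). \<epsilon> \<le> f x - (LINT x|PiM I (\<lambda>_. L). f x)}
    \<le> exp (- (\<epsilon>\<^sup>2 / (2 * b\<^sup>2 * card I)))"
proof -
  let ?P = "PiM I (\<lambda>_. L)" and ?E = "LINT x|PiM I (\<lambda>_. L). f x"
  interpret prob_space ?P by (rule prob_space_PiM) (rule L)
  \<comment> \<open>The minimizer of - l \<epsilon> + l^2 b^2 |I| / 2 over l.\<close>
  define l where "l = \<epsilon> / (b\<^sup>2 * card I)"
  have cI: "card I > 0" using I by (simp add: card_gt_0_iff)
  have l: "0 < l" using eps b cI by (simp add: l_def)
  have "emeasure ?P {x \<in> space ?P. \<epsilon> \<le> f x - ?E}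
      = emeasure ?P {x \<in> space ?P. 1 \<le> ennreal (exp (- l * \<epsilon>)) * ennreal (exp (l * (f x - ?E)))}"
    using l by (intro arg_cong[where f = "emeasure ?P"])
      (auto simp: ennreal_mult[symmetric] exp_add[symmetric] ennreal_1[symmetric] simp del: ennreal_1)
  also have "\<dots> \<le> ennreal (exp (- l * \<epsilon>)) * (\<integral>\<^sup>+x. ennreal (exp (l * (f x - ?E))) * indicator (space ?P) x \<partial>?P)"
    using f by (intro nn_integral_Markov_inequality) auto
  also have "(\<integral>\<^sup>+x. ennreal (exp (l * (f x - ?E))) * indicator (space ?P) x \<partial>?P) = (\<integral>\<^sup>+x. ennreal (exp (l * (f x - ?E))) \<partial>?P)"
    by (intro nn_integral_cong) auto
  also have "\<dots> \<le> ennreal (exp (l\<^sup>2 * b\<^sup>2 / 2 * card I))"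
    by (rule bounded_differences_mgf[OF L I(1) l f C diff])
  finally have "emeasure ?P {x \<in> space ?P. \<epsilon> \<le> f x - ?E} \<le> ennreal (exp (- l * \<epsilon>)) * ennreal (exp (l\<^sup>2 * b\<^sup>2 / 2 * card I))"
    by (simp add: mult_left_mono)
  also have "\<dots> = ennreal (exp (- l * \<epsilon> + l\<^sup>2 * b\<^sup>2 / 2 * card I))"
    by (simp add: ennreal_mult[symmetric] exp_add[symmetric])
  also have "- l * \<epsilon> + l\<^sup>2 * b\<^sup>2 / 2 * card I = - (\<epsilon>\<^sup>2 / (2 * b\<^sup>2 * card I))"
    using b cI by (simp add: l_def field_simps power2_eq_square)
  finally show ?thesis by (simp add: emeasure_eq_measure)
qed

lemma bounded_differences_tail:
  fixes L :: "'s measure" and f :: "('k \<Rightarrow> 's) \<Rightarrow> real"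
  assumes L: "prob_space L" and I: "finite I" "I \<noteq> {}" and eps: "0 < \<epsilon>" and b: "0 < b"
    and f: "f \<in> borel_measurable (PiM I (\<lambda>_. L))"
    and C: "\<And>x. x \<in> space (PiM I (\<lambda>_. L)) \<Longrightarrow> \<bar>f x\<bar> \<le> C"
    and diff: "\<And>x i y. x \<in> space (PiM I (\<lambda>_. L)) \<Longrightarrow> i \<in> I \<Longrightarrow> y \<in> space L \<Longrightarrow> \<bar>f (x(i := y)) - f x\<bar> \<le> b"
  shows "Sigma_Algebra.measure (PiM I (\<lambda>_. L)) {x \<in> space (PiM I (\<lambda>_. L)). \<epsilon> \<le> \<bar>f x - (LINT x|PiM I (\<lambda>_. L). f x)\<bar>}
    \<le> 2 * exp (- (\<epsilon>\<^sup>2 / (2 * b\<^sup>2 * card I)))"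
proof -
  let ?P = "PiM I (\<lambda>_. L)" and ?E = "LINT x|PiM I (\<lambda>_. L). f x"
  interpret prob_space ?P by (rule prob_space_PiM) (rule L)
  let ?U = "{x \<in> space ?P. \<epsilon> \<le> f x - ?E}" and ?D = "{x \<in> space ?P. \<epsilon> \<le> - f x - (LINT x|?P. - f x)}"
  have [measurable]: "f \<in> borel_measurable ?P" by fact
  have "measure ?P {x \<in> space ?P. \<epsilon> \<le> \<bar>f x - ?E\<bar>} \<le> measure ?P (?U \<union> ?D)"
    by (intro finite_measure_mono) (auto simp: abs_if split: if_splits)
  also have "\<dots> \<le> measure ?P ?U + measure ?P ?D" by (rule measure_Un_le) measurable
  also have "\<dots> \<le> exp (- (\<epsilon>\<^sup>2 / (2 * b\<^sup>2 * card I))) + exp (- (\<epsilon>\<^sup>2 / (2 * b\<^sup>2 * card I)))"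
  proof (intro add_mono)
    show "measure ?P ?U \<le> exp (- (\<epsilon>\<^sup>2 / (2 * b\<^sup>2 * card I)))"
      by (rule bounded_differences_upper_tail[OF L I eps b f C diff])
    show "measure ?P ?D \<le> exp (- (\<epsilon>\<^sup>2 / (2 * b\<^sup>2 * card I)))"
    proof (rule bounded_differences_upper_tail[OF L I eps b, where C = C])
      show "\<bar>- f (x(i := y)) - - f x\<bar> \<le> b" if "x \<in> space ?P" "i \<in> I" "y \<in> space L" for x i y
        using diff[OF that] by linarith
    qed (use f C in auto)
  qed
  finally show ?thesis by simp
qed

section \<open>Walks on the subsets of fixed size\<close>

lemma dsubsets_iff: "I \<in> dsubsets n d \<longleftrightarrow> I \<subseteq> {1..n} \<and> card I = d"
  by (simp add: dsubsets_def)

lemma finite_dsubsets [simp]: "finite (dsubsets n d)"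
  by (rule finite_subset[of _ "Pow {1..n}"]) (auto simp: dsubsets_def)

lemma card_dsubsets: "card (dsubsets n d) = n choose d"
  unfolding dsubsets_def using n_subsets[of "{1..n}" d] by simp

lemma dsubsets_finite: "I \<in> dsubsets n d \<Longrightarrow> finite I"
  using finite_subset[of I "{1..n}"] by (simp add: dsubsets_iff)

text \<open>Double counting: a k-set with a point outside it is the same as a (k + 1)-set with a
  marked point. It serves as the adjointness of adding and removing a point.\<close>

lemma sum_dsubsets_Suc:
  fixes h :: "nat set \<Rightarrow> nat \<Rightarrow> real"
  shows "(\<Sum>U\<in>dsubsets n k. \<Sum>i\<in>{1..n} - U. h U i) = (\<Sum>V\<in>dsubsets n (Suc k). \<Sum>i\<in>V. h (V - {i}) i)"
proof -
  have r: "Suc 0 \<le> b \<and> b \<le> n" if "b \<in> V" "V \<subseteq> {Suc 0..n}" for b V using that by auto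
  have "(\<Sum>U\<in>dsubsets n k. \<Sum>i\<in>{1..n} - U. h U i) = (\<Sum>(U, i)\<in>Sigma (dsubsets n k) (\<lambda>U. {1..n} - U). h U i)"
    by (subst sum.Sigma) auto
  also have "\<dots> = (\<Sum>(V, i)\<in>Sigma (dsubsets n (Suc k)) (\<lambda>V. V). h (V - {i}) i)"
    by (rule sum.reindex_bij_witness[where i = "\<lambda>(V, i). (V - {i}, i)" and j = "\<lambda>(U, i). (insert i U, i)"])
      (auto simp: dsubsets_iff insert_absorb card_insert_if finite_subset[OF _ finite_atLeastAtMost] dest: r)
  also have "\<dots> = (\<Sum>V\<in>dsubsets n (Suc k). \<Sum>i\<in>V. h (V - {i}) i)"
    by (subst sum.Sigma) (auto simp: dsubsets_finite)
  finally show ?thesis .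
qed

lemma sum_dsubsets_Suc_Suc:
  fixes h :: "nat set \<Rightarrow> nat \<Rightarrow> nat \<Rightarrow> real"
  shows "(\<Sum>W\<in>dsubsets n k. \<Sum>i\<in>{1..n} - W. \<Sum>j\<in>{1..n} - W - {i}. h W i j) =
    (\<Sum>V\<in>dsubsets n (Suc (Suc k)). \<Sum>i\<in>V. \<Sum>j\<in>V - {i}. h (V - {i, j}) i j)"
proof -
  have "(\<Sum>W\<in>dsubsets n k. \<Sum>i\<in>{1..n} - W. \<Sum>j\<in>{1..n} - W - {i}. h W i j)
      = (\<Sum>V\<in>dsubsets n (Suc k). \<Sum>i\<in>V. \<Sum>j\<in>{1..n} - (V - {i}) - {i}. h (V - {i}) i j)"
    by (rule sum_dsubsets_Suc)
  also have "\<dots> = (\<Sum>V\<in>dsubsets n (Suc k). \<Sum>i\<in>V. \<Sum>j\<in>{1..n} - V. h (V - {i}) i j)"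
    by (intro sum.cong refl) auto
  also have "\<dots> = (\<Sum>V\<in>dsubsets n (Suc k). \<Sum>j\<in>{1..n} - V. \<Sum>i\<in>V. h (V - {i}) i j)"
    by (intro sum.cong refl sum.swap)
  also have "\<dots> = (\<Sum>V\<in>dsubsets n (Suc (Suc k)). \<Sum>j\<in>V. \<Sum>i\<in>V - {j}. h (V - {j} - {i}) i j)"
    by (rule sum_dsubsets_Suc)
  also have "\<dots> = (\<Sum>V\<in>dsubsets n (Suc (Suc k)). \<Sum>i\<in>V. \<Sum>j\<in>V - {i}. h (V - {i, j}) i j)"
  proof (rule sum.cong)
    fix V assume "V \<in> dsubsets n (Suc (Suc k))"
    then have fin: "finite V" by (rule dsubsets_finite)
    have "(\<Sum>j\<in>V. \<Sum>i\<in>V - {j}. h (V - {j} - {i}) i j) = (\<Sum>j\<in>V. \<Sum>i\<in>V. if i \<noteq> j then h (V - {i, j}) i j else 0)"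
    proof (rule sum.cong)
      fix j assume "j \<in> V"
      show "(\<Sum>i\<in>V - {j}. h (V - {j} - {i}) i j) = (\<Sum>i\<in>V. if i \<noteq> j then h (V - {i, j}) i j else 0)"
        using fin by (intro sum.mono_neutral_cong_left) (auto intro: arg_cong[where f = "\<lambda>W. h W _ _"])
    qed simp
    also have "\<dots> = (\<Sum>i\<in>V. \<Sum>j\<in>V. if i \<noteq> j then h (V - {i, j}) i j else 0)" by (rule sum.swap)
    also have "\<dots> = (\<Sum>i\<in>V. \<Sum>j\<in>V - {i}. h (V - {i, j}) i j)"
      using fin by (intro sum.cong refl sum.mono_neutral_cong_right) auto
    finally show "(\<Sum>j\<in>V. \<Sum>i\<in>V - {j}. h (V - {j} - {i}) i j) = (\<Sum>i\<in>V. \<Sum>j\<in>V - {i}. h (V - {i, j}) i j)" .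
  qed simp
  finally show ?thesis .
qed

text \<open>For \<open>B\<close> the diagonal of a quadratic form in the tensor, this is the
  coefficient of the form at the product of the \<open>y_i^2 - 1\<close> over
  \<open>U\<close>.\<close>

definition up_sum :: "nat \<Rightarrow> nat \<Rightarrow> (nat set \<Rightarrow> real) \<Rightarrow> nat set \<Rightarrow> real" where
  "up_sum n d B U = (\<Sum>I\<in>{I\<in>dsubsets n d. U \<subseteq> I}. B I)"

definition up_energy :: "nat \<Rightarrow> nat \<Rightarrow> (nat set \<Rightarrow> real) \<Rightarrow> nat \<Rightarrow> real" where
  "up_energy n d B k = (\<Sum>U\<in>dsubsets n k. (up_sum n d B U)^2)"

lemma up_energy_nonneg: "0 \<le> up_energy n d B k"
  by (simp add: up_energy_def sum_nonneg)

text \<open>Every d-set containing \<open>U\<close> is reached once through each of its d - k points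
  outside \<open>U\<close>.\<close>

lemma up_sum_extend:
  assumes "U \<in> dsubsets n k"
  shows "(\<Sum>i\<in>{1..n} - U. up_sum n d B (insert i U)) = (real d - real k) * up_sum n d B U"
proof -
  have "(\<Sum>i\<in>{1..n} - U. up_sum n d B (insert i U))
      = (\<Sum>i\<in>{1..n} - U. \<Sum>I\<in>{I\<in>dsubsets n d. U \<subseteq> I}. if i \<in> I then B I else 0)"
    unfolding up_sum_def by (intro sum.cong refl sum.mono_neutral_cong_left) auto
  also have "\<dots> = (\<Sum>I\<in>{I\<in>dsubsets n d. U \<subseteq> I}. \<Sum>i\<in>{1..n} - U. if i \<in> I then B I else 0)"
    by (rule sum.swap)
  also have "\<dots> = (\<Sum>I\<in>{I\<in>dsubsets n d. U \<subseteq> I}. (real d - real k) * B I)"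
  proof (intro sum.cong refl)
    fix I assume I: "I \<in> {I\<in>dsubsets n d. U \<subseteq> I}"
    have "(\<Sum>i\<in>{1..n} - U. if i \<in> I then B I else 0) = (\<Sum>i\<in>I - U. B I)"
      using I by (intro sum.mono_neutral_cong_right) (auto simp: dsubsets_iff)
    also have "\<dots> = real (card (I - U)) * B I" by simp
    also have "card (I - U) = d - k"
      using I assms dsubsets_finite[OF assms] by (simp add: card_Diff_subset dsubsets_iff)
    also have "real (d - k) = real d - real k"
    proof -
      have "k \<le> d" using I assms dsubsets_finite[of I n d] card_mono[of I U] by (auto simp: dsubsets_iff)
      then show ?thesis by simp
    qed
    finally show "(\<Sum>i\<in>{1..n} - U. if i \<in> I then B I else 0) = (real d - real k) * B I" .
  qed
  finally show ?thesis by (simp add: up_sum_def sum_distrib_left)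
qed

lemma square_sum_split:
  fixes f :: "nat \<Rightarrow> real"
  assumes "finite V"
  shows "(\<Sum>i\<in>V. f i)^2 = (\<Sum>i\<in>V. (f i)^2) + (\<Sum>i\<in>V. \<Sum>j\<in>V - {i}. f i * f j)"
proof -
  have "(\<Sum>i\<in>V. f i)^2 = (\<Sum>i\<in>V. \<Sum>j\<in>V. f i * f j)"
    by (simp add: power2_eq_square sum_product)
  also have "\<dots> = (\<Sum>i\<in>V. f i * f i + (\<Sum>j\<in>V - {i}. f i * f j))"
    using assms by (intro sum.cong refl sum.remove)
  finally show ?thesis by (simp add: sum.distrib power2_eq_square)
qed

text \<open>The off-diagonal parts of the up-down and of the down-up walk on \<open>k\<close>-sets coincide, so
  the two quadratic forms differ by a multiple of the identity.\<close>

lemma up_down_energy: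
  fixes b :: "nat set \<Rightarrow> real"
  shows "(\<Sum>V\<in>dsubsets n (Suc (Suc k)). (\<Sum>i\<in>V. b (V - {i}))^2) =
   (\<Sum>W\<in>dsubsets n k. (\<Sum>i\<in>{1..n} - W. b (insert i W))^2)
     + (real n - 2 * real (Suc k)) * (\<Sum>U\<in>dsubsets n (Suc k). (b U)^2)"
proof -
  have "(\<Sum>V\<in>dsubsets n (Suc (Suc k)). (\<Sum>i\<in>V. b (V - {i}))^2)
      = (\<Sum>V\<in>dsubsets n (Suc (Suc k)). \<Sum>i\<in>V. (b (V - {i}))^2)
        + (\<Sum>V\<in>dsubsets n (Suc (Suc k)). \<Sum>i\<in>V. \<Sum>j\<in>V - {i}. b (V - {i}) * b (V - {j}))"
    by (simp add: square_sum_split dsubsets_finite sum.distrib)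
  also have "(\<Sum>V\<in>dsubsets n (Suc (Suc k)). \<Sum>i\<in>V. (b (V - {i}))^2)
      = (\<Sum>U\<in>dsubsets n (Suc k). \<Sum>i\<in>{1..n} - U. (b U)^2)"
    by (rule sum_dsubsets_Suc[symmetric])
  also have "\<dots> = (\<Sum>U\<in>dsubsets n (Suc k). (real n - real (Suc k)) * (b U)^2)"
  proof (intro sum.cong refl)
    fix U assume U: "U \<in> dsubsets n (Suc k)"
    then have "card ({1..n} - U) = n - Suc k" and "Suc k \<le> n"
      using card_mono[of "{1..n}" U] by (auto simp: dsubsets_iff card_Diff_subset dsubsets_finite[OF U])
    then show "(\<Sum>i\<in>{1..n} - U. (b U)^2) = (real n - real (Suc k)) * (b U)^2" by simp
  qed
  also have "(\<Sum>V\<in>dsubsets n (Suc (Suc k)). \<Sum>i\<in>V. \<Sum>j\<in>V - {i}. b (V - {i}) * b (V - {j}))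
      = (\<Sum>V\<in>dsubsets n (Suc (Suc k)). \<Sum>i\<in>V. \<Sum>j\<in>V - {i}. b (insert j (V - {i, j})) * b (insert i (V - {i, j})))"
  proof (intro sum.cong refl)
    fix V :: "nat set" and i j assume "i \<in> V" "j \<in> V - {i}"
    then have "V - {i} = insert j (V - {i, j})" "V - {j} = insert i (V - {i, j})" by auto
    then show "b (V - {i}) * b (V - {j}) = b (insert j (V - {i, j})) * b (insert i (V - {i, j}))" by simp
  qed
  also have "\<dots> = (\<Sum>W\<in>dsubsets n k. \<Sum>i\<in>{1..n} - W. \<Sum>j\<in>{1..n} - W - {i}. b (insert j W) * b (insert i W))"
    by (rule sum_dsubsets_Suc_Suc[symmetric])
  also have "\<dots> = (\<Sum>W\<in>dsubsets n k. (\<Sum>i\<in>{1..n} - W. b (insert i W))^2)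
      - (\<Sum>W\<in>dsubsets n k. \<Sum>i\<in>{1..n} - W. (b (insert i W))^2)"
    by (simp add: square_sum_split sum.distrib mult.commute)
  also have "(\<Sum>W\<in>dsubsets n k. \<Sum>i\<in>{1..n} - W. (b (insert i W))^2)
      = (\<Sum>U\<in>dsubsets n (Suc k). \<Sum>i\<in>U. (b (insert i (U - {i})))^2)"
    by (rule sum_dsubsets_Suc)
  also have "\<dots> = (\<Sum>U\<in>dsubsets n (Suc k). real (Suc k) * (b U)^2)"
    by (intro sum.cong refl) (simp add: insert_absorb dsubsets_iff)
  finally show ?thesis
    by (simp only: sum_distrib_left[symmetric]) (simp add: algebra_simps)
qed

text \<open>A spectral gap obtained by induction on the level instead of by eigenvectors.
  Cauchy-Schwarz compares level k + 2 with the down-sums of level k + 1, and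
  \<open>up_down_energy\<close> expresses the norm of those through levels k and k + 1.\<close>

lemma up_energy_step:
  assumes zero: "(\<Sum>I\<in>dsubsets n d. B I) = 0" and "k < d" "d \<le> n"
  shows "(real d - real k)^2 * up_energy n d B k \<le> real k * (real n - real k - 1) * up_energy n d B (Suc k)"
  using \<open>k < d\<close>
proof (induction k)
  case 0
  \<comment> \<open>The zero sum enters here: the energy of level 0 is the square of the
    total.\<close>
  have "dsubsets n 0 = {{}}" by (auto simp: dsubsets_iff dsubsets_def card_eq_0_iff finite_subset)
  then show ?case using zero by (simp add: up_energy_def up_sum_def)
next
  case (Suc k)
  let ?a = "up_energy n d B" and ?b = "up_sum n d B"
  have kn: "Suc (Suc k) \<le> n" using Suc.prems \<open>d \<le> n\<close> by simp
  have IH: "(real d - real k)^2 * ?a k \<le> real k * (real n - real k - 1) * ?a (Suc k)"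
    using Suc by simp
  let ?C = "\<Sum>V\<in>dsubsets n (Suc (Suc k)). (\<Sum>i\<in>V. ?b (V - {i}))^2"
  have "(\<Sum>W\<in>dsubsets n k. (\<Sum>i\<in>{1..n} - W. ?b (insert i W))^2) = (real d - real k)^2 * ?a k"
    unfolding up_energy_def sum_distrib_left
    by (intro sum.cong refl) (simp only: up_sum_extend power_mult_distrib)
  then have C: "?C = (real d - real k)^2 * ?a k + (real n - 2 * real (Suc k)) * ?a (Suc k)"
    unfolding up_down_energy by (simp add: up_energy_def)
  \<comment> \<open>Adding and removing a point are adjoint, which writes this energy as an inner
    product of level k + 2 with the down-sums of level k + 1.\<close>
  have "(real d - real (Suc k)) * ?a (Suc k) = (\<Sum>U\<in>dsubsets n (Suc k). ?b U * ((real d - real (Suc k)) * ?b U))"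
    by (simp add: up_energy_def sum_distrib_left power2_eq_square mult_ac)
  also have "\<dots> = (\<Sum>U\<in>dsubsets n (Suc k). \<Sum>i\<in>{1..n} - U. ?b U * ?b (insert i U))"
    by (intro sum.cong refl) (simp only: up_sum_extend[symmetric] sum_distrib_left)
  also have "\<dots> = (\<Sum>V\<in>dsubsets n (Suc (Suc k)). \<Sum>i\<in>V. ?b (V - {i}) * ?b (insert i (V - {i})))"
    by (rule sum_dsubsets_Suc)
  also have "\<dots> = (\<Sum>V\<in>dsubsets n (Suc (Suc k)). ?b V * (\<Sum>i\<in>V. ?b (V - {i})))"
    by (intro sum.cong refl) (simp add: insert_absorb sum_distrib_left mult.commute)
  finally have "((real d - real (Suc k)) * ?a (Suc k))^2 \<le> ?a (Suc (Suc k)) * ?C"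
    using Cauchy_Schwarz_ineq_sum[of ?b "\<lambda>V. \<Sum>i\<in>V. ?b (V - {i})" "dsubsets n (Suc (Suc k))"]
    by (simp add: up_energy_def)
  also have "\<dots> \<le> ?a (Suc (Suc k)) * (real k * (real n - real k - 1) * ?a (Suc k) + (real n - 2 * real (Suc k)) * ?a (Suc k))"
    unfolding C using IH by (intro mult_left_mono up_energy_nonneg) simp
  \<comment> \<open>The induction closes because k (n - k - 1) + n - 2 (k + 1) = (k + 1) (n - k -
    2).\<close>
  also have "\<dots> = (real (Suc k) * (real n - real (Suc k) - 1) * ?a (Suc (Suc k))) * ?a (Suc k)"
    by (simp add: algebra_simps)
  finally have *: "((real d - real (Suc k))^2 * ?a (Suc k)) * ?a (Suc k)
      \<le> (real (Suc k) * (real n - real (Suc k) - 1) * ?a (Suc (Suc k))) * ?a (Suc k)"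
    by (simp add: power2_eq_square mult_ac)
  show ?case
  proof (cases "?a (Suc k) = 0")
    case True
    have "0 \<le> real n - real (Suc k) - 1" using kn by simp
    then show ?thesis using True up_energy_nonneg[of n d B "Suc (Suc k)"] by simp
  next
    case False
    then have "0 < ?a (Suc k)" using up_energy_nonneg[of n d B "Suc k"] by simp
    with * show ?thesis by (simp only: mult_le_cancel_right_pos)
  qed
qed

lemma choose_Suc_times:
  assumes "k < m" "m \<le> n"
  shows "real ((n - Suc k) choose (m - Suc k)) * (real n - real k) = (real m - real k) * real ((n - k) choose (m - k))"
proof -
  have "Suc (m - Suc k) * (Suc (n - Suc k) choose Suc (m - Suc k)) = Suc (n - Suc k) * (n - Suc k choose (m - Suc k))"
    by (rule Suc_times_binomial)
  moreover have "Suc (m - Suc k) = m - k" "Suc (n - Suc k) = n - k" using assms by auto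
  ultimately have "(m - k) * (n - k choose (m - k)) = (n - k) * (n - Suc k choose (m - Suc k))" by simp
  then have "real (m - k) * real (n - k choose (m - k)) = real (n - k) * real (n - Suc k choose (m - Suc k))"
    by (metis of_nat_mult)
  then show ?thesis using assms by (simp add: of_nat_diff mult.commute)
qed

text \<open>The successive ratios (d - k) / (n - k) are at most d / n: a random d-set contains a
  given k-set with probability at most (d / n)^k.\<close>

lemma choose_diff_le:
  assumes "k \<le> d" "d \<le> n" "0 < n"
  shows "real ((n - k) choose (d - k)) \<le> real (n choose d) * (real d / real n)^k"
  using assms(1)
proof (induction k)
  case (Suc k)
  have pos: "real n - real k > 0" using Suc.prems assms by simp
  have "real ((n - Suc k) choose (d - Suc k)) = real ((n - k) choose (d - k)) * ((real d - real k) / (real n - real k))"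
    using choose_Suc_times[of k d n] Suc.prems assms pos by (simp add: field_simps)
  also have "\<dots> \<le> real ((n - k) choose (d - k)) * (real d / real n)"
  proof (intro mult_left_mono)
    show "(real d - real k) / (real n - real k) \<le> real d / real n"
      using pos assms mult_left_mono[of "real d" "real n" "real k"] by (simp add: field_simps)
  qed simp
  also have "\<dots> \<le> real (n choose d) * (real d / real n)^k * (real d / real n)"
    using Suc by (intro mult_right_mono) auto
  finally show ?case by (simp add: mult_ac)
qed simp

text \<open>The second eigenvalue of the inclusion matrices of the Johnson scheme, up to a factor
  close to one.\<close>

lemma up_energy_le:
  assumes zero: "(\<Sum>I\<in>dsubsets n d. B I) = 0" and "k \<le> d" "1 \<le> d" "d \<le> n"
  shows "up_energy n d B k \<le> real k / real d * real (d choose k) * real ((n - k) choose (d - k)) * (\<Sum>I\<in>dsubsets n d. (B I)^2)"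
  using \<open>k \<le> d\<close>
proof (induction rule: inc_induct)
  case base
  have "up_sum n d B U = B U" if "U \<in> dsubsets n d" for U
  proof -
    have "I = U" if "I \<in> dsubsets n d" "U \<subseteq> I" for I
      using that \<open>U \<in> dsubsets n d\<close> card_subset_eq[of I U] by (auto simp: dsubsets_iff dsubsets_finite[OF that(1)])
    then have "{I\<in>dsubsets n d. U \<subseteq> I} = {U}" using that by auto
    then show ?thesis by (simp add: up_sum_def)
  qed
  then show ?case using \<open>1 \<le> d\<close> by (simp add: up_energy_def)
next
  case (step k)
  let ?s = "\<Sum>I\<in>dsubsets n d. (B I)^2"
  let ?h = "\<lambda>k. real k / real d * real (d choose k) * real ((n - k) choose (d - k))"
  have s: "0 \<le> ?s" by (simp add: sum_nonneg)
  have dk: "real d - real k > 0" and nk: "real n - real k - 1 \<ge> 0" using step \<open>d \<le> n\<close> by auto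
  have "(real d - real k)^2 * up_energy n d B k \<le> real k * (real n - real k - 1) * up_energy n d B (Suc k)"
    using step by (intro up_energy_step zero \<open>d \<le> n\<close>) auto
  also have "\<dots> \<le> real k * (real n - real k - 1) * (?h (Suc k) * ?s)"
    using step.IH nk by (intro mult_left_mono) auto
  \<comment> \<open>Replacing n - k - 1 by n - k is the only loss; in exchange the factor fits the
    recursion of the binomial coefficients exactly.\<close>
  also have "\<dots> \<le> real k * (real n - real k) * (?h (Suc k) * ?s)"
    using s by (intro mult_right_mono mult_left_mono) auto
  also have "\<dots> = (real d - real k)^2 * (?h k * ?s)"
  proof -
    have 1: "real (Suc k) * real (d choose Suc k) = (real d - real k) * real (d choose k)"
    proof -
      obtain m where d: "d = Suc m" using \<open>1 \<le> d\<close> by (cases d) auto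
      have "Suc k * (d choose Suc k) = d * (m choose k)" unfolding d by (rule Suc_times_binomial)
      also have "\<dots> = (d - k) * (d choose k)" using binomial_absorb_comp[of d k] by (simp add: d)
      finally have "real (Suc k) * real (d choose Suc k) = real (d - k) * real (d choose k)"
        by (metis of_nat_mult)
      then show ?thesis using step by (simp add: of_nat_diff)
    qed
    have 2: "real ((n - Suc k) choose (d - Suc k)) * (real n - real k) = (real d - real k) * real ((n - k) choose (d - k))"
      using step \<open>d \<le> n\<close> by (intro choose_Suc_times) auto
    have "real k * (real n - real k) * (?h (Suc k) * ?s)
        = real k / real d * (real (Suc k) * real (d choose Suc k)) * (real ((n - Suc k) choose (d - Suc k)) * (real n - real k)) * ?s"
      by (simp add: field_simps)
    also have "\<dots> = (real d - real k)^2 * (?h k * ?s)" unfolding 1 2 by (simp add: power2_eq_square field_simps)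
    finally show ?thesis .
  qed
  finally show ?case using dk by (simp only: mult_le_cancel_left_pos zero_less_power)
qed

lemma sum_Pow_card:
  assumes "finite V"
  shows "(\<Sum>U\<in>Pow V. q ^ card U) = (1 + q :: real) ^ card V"
  using prod_add[OF assms, of "\<lambda>_. q" "\<lambda>_. 1"] by (simp add: add.commute)

text \<open>This is q times the derivative of the binomial theorem. The weight k, inherited from the
  spectral gap, is what produces the small factor q in front.\<close>

lemma sum_times_binomial_power:
  fixes q :: real
  assumes "1 \<le> d"
  shows "(\<Sum>k\<le>d. real k * real (d choose k) * q^k) = real d * q * (1 + q)^(d - 1)"
proof -
  obtain m where d: "d = Suc m" using assms by (cases d) auto
  have "(\<Sum>k\<le>d. real k * real (d choose k) * q^k) = (\<Sum>k\<le>m. real (Suc k) * real (Suc m choose Suc k) * q^Suc k)"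
    unfolding d by (subst sum.atMost_Suc_shift) simp
  also have "\<dots> = (\<Sum>k\<le>m. real (Suc m) * q * (real (m choose k) * q^k))"
  proof (intro sum.cong refl)
    fix k
    have "real (Suc k) * real (Suc m choose Suc k) = real (Suc m) * real (m choose k)"
      by (metis Suc_times_binomial of_nat_mult)
    then show "real (Suc k) * real (Suc m choose Suc k) * q^Suc k = real (Suc m) * q * (real (m choose k) * q^k)"
      by simp
  qed
  also have "\<dots> = real (Suc m) * q * (\<Sum>k\<le>m. real (m choose k) * q^k)"
    by (simp add: sum_distrib_left)
  also have "(\<Sum>k\<le>m. real (m choose k) * q^k) = (q + 1)^m"
    using binomial_ring[of q 1 m] by simp
  finally show ?thesis by (simp add: d add.commute)
qed

lemma one_plus_power_le_exp:
  assumes "0 \<le> (q::real)" shows "(1 + q)^m \<le> exp (q * m)"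
proof -
  have "(1 + q)^m \<le> exp q ^ m" using assms by (intro power_mono) auto
  also have "\<dots> = exp (q * m)" by (simp add: exp_of_nat_mult[symmetric] mult.commute)
  finally show ?thesis .
qed

section \<open>Quadratic forms in the square-free tensor\<close>

text \<open>The products of \<open>y\<^sub>i\<close> over \<open>E\<close> and of \<open>y\<^sub>i\<^sup>2 - 1\<close> over \<open>U\<close>, for disjoint \<open>E\<close> and \<open>U\<close>, are orthogonal
  for the product law; variances of quadratic forms in the tensor are computed in this basis.\<close>

definition chaos_factor :: "nat set \<Rightarrow> nat set \<Rightarrow> nat \<Rightarrow> real \<Rightarrow> real" where
  "chaos_factor E U i t = (if i \<in> E then t else if i \<in> U then t\<^sup>2 - 1 else 1)"

definition chaos :: "nat \<Rightarrow> nat set \<Rightarrow> nat set \<Rightarrow> (nat \<Rightarrow> real) \<Rightarrow> real" where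
  "chaos n E U y = (\<Prod>i\<in>{1..n}. chaos_factor E U i (y i))"

lemma chaos_eq:
  assumes "E \<subseteq> {1..n}" "U \<subseteq> {1..n}" "E \<inter> U = {}"
  shows "chaos n E U y = (\<Prod>i\<in>E. y i) * (\<Prod>i\<in>U. (y i)\<^sup>2 - 1)"
proof -
  have fin: "finite E" "finite U" using assms finite_subset by blast+
  have "chaos n E U y = (\<Prod>i\<in>{1..n}. (if i \<in> E then y i else 1) * (if i \<in> U then (y i)\<^sup>2 - 1 else 1))"
    unfolding chaos_def chaos_factor_def using assms(3) by (intro prod.cong) auto
  also have "\<dots> = (\<Prod>i\<in>{1..n}. if i \<in> E then y i else 1) * (\<Prod>i\<in>{1..n}. if i \<in> U then (y i)\<^sup>2 - 1 else 1)"
    by (rule prod.distrib)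
  also have "(\<Prod>i\<in>{1..n}. if i \<in> E then y i else 1) = (\<Prod>i\<in>E. y i)"
    using assms fin by (intro prod.mono_neutral_cong_right) auto
  also have "(\<Prod>i\<in>{1..n}. if i \<in> U then (y i)\<^sup>2 - 1 else 1) = (\<Prod>i\<in>U. (y i)\<^sup>2 - 1)"
    using assms fin by (intro prod.mono_neutral_cong_right) auto
  finally show ?thesis .
qed

text \<open>Indices in only one of the sets occur linearly and form the symmetric difference; over
  the common ones \<open>y_i^2\<close> is expanded as \<open>(y_i^2 - 1) + 1\<close>.\<close>

lemma monomial_product_chaos:
  assumes "I \<subseteq> {1..n}" "J \<subseteq> {1..n}"
  shows "(\<Prod>i\<in>I. y i) * (\<Prod>i\<in>J. y i) = (\<Sum>U\<in>Pow (I \<inter> J). chaos n (sym_diff I J) U y)"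
proof -
  have fin: "finite I" "finite J" using assms finite_subset by blast+
  have "(\<Prod>i\<in>I. y i) * (\<Prod>i\<in>J. y i) = (\<Prod>i\<in>I - J. y i) * (\<Prod>i\<in>I \<inter> J. y i) * ((\<Prod>i\<in>J - I. y i) * (\<Prod>i\<in>I \<inter> J. y i))"
    using prod.Int_Diff[OF fin(1), of y J] prod.Int_Diff[OF fin(2), of y I] by (simp add: mult_ac Int_commute)
  also have "\<dots> = ((\<Prod>i\<in>I - J. y i) * (\<Prod>i\<in>J - I. y i)) * (\<Prod>i\<in>I \<inter> J. ((y i)\<^sup>2 - 1) + 1)"
    by (simp add: power2_eq_square prod.distrib mult_ac)
  also have "(\<Prod>i\<in>I - J. y i) * (\<Prod>i\<in>J - I. y i) = (\<Prod>i\<in>sym_diff I J. y i)"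
    using fin by (intro prod.union_disjoint[symmetric]) auto
  also have "(\<Prod>i\<in>I \<inter> J. ((y i)\<^sup>2 - 1) + 1) = (\<Sum>U\<in>Pow (I \<inter> J). (\<Prod>i\<in>U. (y i)\<^sup>2 - 1))"
    using fin by (subst prod_add) auto
  also have "(\<Prod>i\<in>sym_diff I J. y i) * \<dots> = (\<Sum>U\<in>Pow (I \<inter> J). chaos n (sym_diff I J) U y)"
    unfolding sum_distrib_left using assms by (intro sum.cong refl chaos_eq[symmetric]) auto
  finally show ?thesis .
qed

section \<open>Second moments of chaos expansions\<close>

locale standardized_law =
  fixes D :: "real measure" and v :: real
  assumes prob: "prob_space D" and sets_D [measurable_cong]: "sets D = sets borel"
    and int4: "integrable D (\<lambda>t. t^4)" and m1: "(LINT t|D. t) = 0" and m2: "(LINT t|D. t\<^sup>2) = 1"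
    and v: "v = (LINT t|D. t^4) - 1"
begin

sublocale D: prob_space D by (rule prob)

sublocale PD: product_prob_space "\<lambda>_::nat. D" by unfold_locales

lemma integrable_power_le4:
  assumes "k \<le> 4" shows "integrable D (\<lambda>t. t^k)"
proof (rule Bochner_Integration.integrable_bound[of D "\<lambda>t. 1 + t^4"])
  show "AE t in D. norm (t^k) \<le> norm (1 + t^4)"
  proof (intro AE_I2)
    fix t :: real
    have "\<bar>t\<bar>^k \<le> 1 + \<bar>t\<bar>^4"
    proof (cases "\<bar>t\<bar> \<le> 1")
      case True
      then have "\<bar>t\<bar>^k \<le> 1" by (simp add: power_le_one)
      then show ?thesis by (smt (verit) zero_le_power abs_ge_zero)
    next
      case False
      then have "\<bar>t\<bar>^k \<le> \<bar>t\<bar>^4" using assms by (intro power_increasing) auto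
      then show ?thesis by simp
    qed
    then show "norm (t^k) \<le> norm (1 + t^4)" by (simp add: power_abs)
  qed
qed (use int4 in auto)

lemma integrable_moments:
  "integrable D (\<lambda>t. t)" "integrable D (\<lambda>t. t\<^sup>2)" "integrable D (\<lambda>t. t^3)"
  using integrable_power_le4[of 1] integrable_power_le4[of 2] integrable_power_le4[of 3] by auto

lemma integral_square_centered: "(LINT t|D. t\<^sup>2 - 1) = 0" "(LINT t|D. (t\<^sup>2 - 1)\<^sup>2) = v"
  and integrable_square_centered: "integrable D (\<lambda>t. t\<^sup>2 - 1)" "integrable D (\<lambda>t. (t\<^sup>2 - 1)\<^sup>2)"
proof -
  have eq: "(t\<^sup>2 - 1)\<^sup>2 = t^4 - 2 * t\<^sup>2 + (1::real)" for t
    by (simp add: power2_eq_square power4_eq_xxxx algebra_simps)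
  show "(LINT t|D. t\<^sup>2 - 1) = 0" using integrable_moments m2 by (simp add: D.prob_space)
  show "(LINT t|D. (t\<^sup>2 - 1)\<^sup>2) = v"
    unfolding eq using integrable_moments int4 m2 v by (simp add: D.prob_space)
  show "integrable D (\<lambda>t. t\<^sup>2 - 1)" using integrable_moments by simp
  show "integrable D (\<lambda>t. (t\<^sup>2 - 1)\<^sup>2)" unfolding eq using integrable_moments int4 by simp
qed

lemma v_nonneg: "0 \<le> v"
  unfolding integral_square_centered(2)[symmetric] by (intro integral_nonneg_AE) simp

lemma chaos_factor_integrable:
  "integrable D (\<lambda>t. chaos_factor E U i t * chaos_factor E' U' i t)"
proof -
  have 1: "integrable D (\<lambda>t. t * (t\<^sup>2 - 1))" "integrable D (\<lambda>t. (t\<^sup>2 - 1) * t)"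
    "integrable D (\<lambda>t. t * t)" "integrable D (\<lambda>t. (t\<^sup>2 - 1) * (t\<^sup>2 - 1))"
  proof -
    have "integrable D (\<lambda>t. t^3 - t)" using integrable_moments by simp
    then show "integrable D (\<lambda>t. t * (t\<^sup>2 - 1))" "integrable D (\<lambda>t. (t\<^sup>2 - 1) * t)"
      by (simp_all add: algebra_simps power3_eq_cube power2_eq_square)
  qed (use integrable_moments integrable_square_centered in \<open>simp_all add: power2_eq_square\<close>)
  show ?thesis
    unfolding chaos_factor_def
    using 1 integrable_moments integrable_square_centered
    by (cases "i \<in> E"; cases "i \<in> U"; cases "i \<in> E'"; cases "i \<in> U'") simp_all
qed

lemma chaos_integral:
  shows "integrable (PiM {1..n} (\<lambda>_. D)) (\<lambda>y. chaos n E U y * chaos n E' U' y)"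
    and "(LINT y|PiM {1..n} (\<lambda>_. D). chaos n E U y * chaos n E' U' y)
      = (\<Prod>i\<in>{1..n}. LINT t|D. chaos_factor E U i t * chaos_factor E' U' i t)"
proof -
  have eq: "chaos n E U y * chaos n E' U' y = (\<Prod>i\<in>{1..n}. chaos_factor E U i (y i) * chaos_factor E' U' i (y i))" for y
    by (simp add: chaos_def prod.distrib)
  show "integrable (PiM {1..n} (\<lambda>_. D)) (\<lambda>y. chaos n E U y * chaos n E' U' y)"
    unfolding eq by (intro PD.product_integrable_prod chaos_factor_integrable) auto
  show "(LINT y|PiM {1..n} (\<lambda>_. D). chaos n E U y * chaos n E' U' y)
      = (\<Prod>i\<in>{1..n}. LINT t|D. chaos_factor E U i t * chaos_factor E' U' i t)"
    unfolding eq
    by (intro PD.product_integral_prod[of "{1..n}" "\<lambda>i t. chaos_factor E U i t * chaos_factor E' U' i t"] chaos_factor_integrable) auto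
qed

lemma chaos_orthogonal:
  assumes "E \<union> U \<subseteq> {1..n}" "E' \<union> U' \<subseteq> {1..n}" "E \<union> U \<noteq> E' \<union> U'"
  shows "(LINT y|PiM {1..n} (\<lambda>_. D). chaos n E U y * chaos n E' U' y) = 0"
proof -
  from assms obtain i where i: "i \<in> {1..n}" "(i \<in> E \<union> U) \<noteq> (i \<in> E' \<union> U')" by blast
  then have "(LINT t|D. chaos_factor E U i t * chaos_factor E' U' i t) = 0"
    using m1 integral_square_centered
    by (cases "i \<in> E"; cases "i \<in> U"; cases "i \<in> E'"; cases "i \<in> U'") (simp_all add: chaos_factor_def)
  then show ?thesis unfolding chaos_integral using i(1) by (intro prod_zero) auto
qed

lemma chaos_norm:
  assumes "U \<subseteq> {1..n}" "E \<inter> U = {}"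
  shows "(LINT y|PiM {1..n} (\<lambda>_. D). (chaos n E U y)\<^sup>2) = v ^ card U"
proof -
  have "(LINT t|D. chaos_factor E U i t * chaos_factor E U i t) = (if i \<in> U then v else 1)" for i
    using assms m2 integral_square_centered
    by (cases "i \<in> E"; cases "i \<in> U") (auto simp: chaos_factor_def power2_eq_square[symmetric] D.prob_space)
  then have "(LINT y|PiM {1..n} (\<lambda>_. D). (chaos n E U y)\<^sup>2) = (\<Prod>i\<in>{1..n}. if i \<in> U then v else 1)"
    unfolding power2_eq_square chaos_integral by simp
  also have "\<dots> = (\<Prod>i\<in>U. v)"
    using assms finite_subset[OF assms(1)] by (intro prod.mono_neutral_cong_right) auto
  finally show ?thesis by simp
qed

text \<open>Two terms are orthogonal when their supports E \<union> U differ, but different splits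
  of one support interact through the third moment of the law. The arithmetic-geometric mean bounds
  those cross terms, at the cost of the number of splits, at most 2 to the size of the
  support.\<close>

lemma chaos_sum_square:
  fixes a :: "nat set \<times> nat set \<Rightarrow> real"
  assumes "finite F" and F: "\<And>E U. (E, U) \<in> F \<Longrightarrow> E \<union> U \<subseteq> {1..n} \<and> E \<inter> U = {}"
  defines "f \<equiv> \<lambda>y. \<Sum>e\<in>F. a e * chaos n (fst e) (snd e) y"
  shows "integrable (PiM {1..n} (\<lambda>_. D)) (\<lambda>y. (f y)\<^sup>2)"
    and "(LINT y|PiM {1..n} (\<lambda>_. D). (f y)\<^sup>2) \<le> (\<Sum>e\<in>F. 2 ^ card (fst e \<union> snd e) * v ^ card (snd e) * (a e)\<^sup>2)"
proof -
  let ?Y = "PiM {1..n} (\<lambda>_. D)"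
  let ?c = "\<lambda>e y. chaos n (fst e) (snd e) y" and ?V = "\<lambda>e. fst e \<union> snd e"
  have sq: "(f y)\<^sup>2 = (\<Sum>e\<in>F. \<Sum>e'\<in>F. a e * a e' * (?c e y * ?c e' y))" for y
    by (simp add: f_def power2_eq_square sum_product mult_ac)
  have int: "integrable ?Y (\<lambda>y. ?c e y * ?c e' y)" for e e' by (rule chaos_integral)
  show "integrable ?Y (\<lambda>y. (f y)\<^sup>2)"
    unfolding sq using int by (intro Bochner_Integration.integrable_sum integrable_mult_right) auto
  let ?w = "\<lambda>e. (a e)\<^sup>2 * v ^ card (snd e)"
  have w: "(LINT y|?Y. (a e)\<^sup>2 * (?c e y * ?c e y)) = ?w e" if "e \<in> F" for e
    using chaos_norm[of "snd e" n "fst e"] F[of "fst e" "snd e"] that by (simp add: power2_eq_square)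
  have wpos: "0 \<le> ?w e" for e using v_nonneg by simp
  have pair: "(LINT y|?Y. a e * a e' * (?c e y * ?c e' y)) \<le> (if ?V e = ?V e' then (?w e + ?w e') / 2 else 0)"
    if "e \<in> F" "e' \<in> F" for e e'
  proof (cases "?V e = ?V e'")
    case True
    have "(LINT y|?Y. a e * a e' * (?c e y * ?c e' y))
        \<le> (LINT y|?Y. ((a e)\<^sup>2 * (?c e y * ?c e y) + (a e')\<^sup>2 * (?c e' y * ?c e' y)) / 2)"
    proof (intro integral_mono)
      fix y
      have "0 \<le> (a e * ?c e y - a e' * ?c e' y)\<^sup>2" by simp
      then show "a e * a e' * (?c e y * ?c e' y) \<le> ((a e)\<^sup>2 * (?c e y * ?c e y) + (a e')\<^sup>2 * (?c e' y * ?c e' y)) / 2"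
        by (simp add: power2_eq_square algebra_simps)
    qed (use int in auto)
    also have "\<dots> = ((LINT y|?Y. (a e)\<^sup>2 * (?c e y * ?c e y)) + (LINT y|?Y. (a e')\<^sup>2 * (?c e' y * ?c e' y))) / 2"
      using int by (simp del: integral_mult_right_zero)
    also have "\<dots> = (?w e + ?w e') / 2" using that by (simp only: w)
    finally show ?thesis using True by simp
  next
    case False
    then have "(LINT y|?Y. ?c e y * ?c e' y) = 0"
      using F[of "fst e" "snd e"] F[of "fst e'" "snd e'"] that by (intro chaos_orthogonal) auto
    then show ?thesis using False by simp
  qed
  \<comment> \<open>As E and U are disjoint, a label is determined by its union and by E, a subset
    of that union.\<close>
  have card: "real (card {e'\<in>F. ?V e = ?V e'}) \<le> 2 ^ card (?V e)" if "e \<in> F" for e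
  proof -
    have fin: "finite (?V e)" using F[of "fst e" "snd e"] that by (intro finite_subset[of "?V e" "{1..n}"]) auto
    have "card {e'\<in>F. ?V e = ?V e'} \<le> card (Pow (?V e))"
    proof (rule card_inj_on_le[of fst])
      have snd: "snd e = ?V e - fst e" if "e \<in> F" for e
        using F[of "fst e" "snd e"] that by auto
      have "e1 = e2" if "e1 \<in> F" "e2 \<in> F" "?V e1 = ?V e2" "fst e1 = fst e2" for e1 e2
      proof (rule prod_eqI)
        show "snd e1 = snd e2" using snd[OF that(1)] snd[OF that(2)] that(3,4) by argo
      qed (rule that(4))
      then show "inj_on fst {e'\<in>F. ?V e = ?V e'}" by (auto simp: inj_on_def)
    qed (use fin in auto)
    also have "card (Pow (?V e)) = 2 ^ card (?V e)" using fin by (rule card_Pow)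
    finally have "real (card {e'\<in>F. ?V e = ?V e'}) \<le> real (2 ^ card (?V e))" by (rule of_nat_mono)
    then show ?thesis by (simp only: of_nat_power of_nat_numeral)
  qed
  have "(LINT y|?Y. (f y)\<^sup>2) = (\<Sum>e\<in>F. \<Sum>e'\<in>F. LINT y|?Y. a e * a e' * (?c e y * ?c e' y))"
    unfolding sq using int by (simp add: Bochner_Integration.integral_sum Bochner_Integration.integrable_sum)
  also have "\<dots> \<le> (\<Sum>e\<in>F. \<Sum>e'\<in>F. if ?V e = ?V e' then (?w e + ?w e') / 2 else 0)"
    by (intro sum_mono pair)
  also have "\<dots> = (\<Sum>e\<in>F. \<Sum>e'\<in>F. if ?V e = ?V e' then ?w e / 2 else 0) + (\<Sum>e\<in>F. \<Sum>e'\<in>F. if ?V e = ?V e' then ?w e' / 2 else 0)"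
    unfolding sum.distrib[symmetric] by (intro sum.cong) (auto simp: add_divide_distrib)
  also have "(\<Sum>e\<in>F. \<Sum>e'\<in>F. if ?V e = ?V e' then ?w e' / 2 else 0) = (\<Sum>e'\<in>F. \<Sum>e\<in>F. if ?V e = ?V e' then ?w e' / 2 else 0)"
    by (rule sum.swap)
  also have "\<dots> = (\<Sum>e\<in>F. \<Sum>e'\<in>F. if ?V e = ?V e' then ?w e / 2 else 0)"
    by (intro sum.cong refl) auto
  also have "(\<Sum>e\<in>F. \<Sum>e'\<in>F. if ?V e = ?V e' then ?w e / 2 else 0) + (\<Sum>e\<in>F. \<Sum>e'\<in>F. if ?V e = ?V e' then ?w e / 2 else 0)
      = (\<Sum>e\<in>F. real (card {e'\<in>F. ?V e = ?V e'}) * ?w e)"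
  proof -
    have "(\<Sum>e'\<in>F. if ?V e = ?V e' then ?w e / 2 else 0) + (\<Sum>e'\<in>F. if ?V e = ?V e' then ?w e / 2 else 0)
        = real (card {e'\<in>F. ?V e = ?V e'}) * ?w e" for e
    proof -
      have "(\<Sum>e'\<in>F. if ?V e = ?V e' then ?w e / 2 else 0) = (\<Sum>e'\<in>{e'\<in>F. ?V e = ?V e'}. ?w e / 2)"
        using \<open>finite F\<close> by (intro sum.mono_neutral_cong_right) auto
      then show ?thesis by simp
    qed
    then show ?thesis by (subst sum.distrib[symmetric]) (intro sum.cong refl)
  qed
  also have "\<dots> \<le> (\<Sum>e\<in>F. 2 ^ card (?V e) * ?w e)"
    using card wpos by (intro sum_mono mult_right_mono) auto
  finally show "(LINT y|?Y. (f y)\<^sup>2) \<le> (\<Sum>e\<in>F. 2 ^ card (?V e) * v ^ card (snd e) * (a e)\<^sup>2)"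
    by (simp add: mult_ac)
qed

end

section \<open>Counting sets and pairs of sets with prescribed overlaps\<close>

lemma card_supersets:
  assumes "W \<subseteq> {1..n}" "card W \<le> d"
  shows "card {I\<in>dsubsets n d. W \<subseteq> I} = (n - card W) choose (d - card W)"
proof -
  have finW: "finite W" using assms(1) finite_subset by blast
  have "card {I\<in>dsubsets n d. W \<subseteq> I} = card {K. K \<subseteq> {1..n} - W \<and> card K = d - card W}"
  proof (rule bij_betw_same_card[of "\<lambda>I. I - W"], rule bij_betw_byWitness[where f' = "\<lambda>K. K \<union> W"])
    show "(\<lambda>I. I - W) ` {I\<in>dsubsets n d. W \<subseteq> I} \<subseteq> {K. K \<subseteq> {1..n} - W \<and> card K = d - card W}"
      using finW by (auto simp: dsubsets_iff card_Diff_subset)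
    show "(\<lambda>K. K \<union> W) ` {K. K \<subseteq> {1..n} - W \<and> card K = d - card W} \<subseteq> {I\<in>dsubsets n d. W \<subseteq> I}"
    proof (safe)
      fix K assume K: "K \<subseteq> {1..n} - W" "card K = d - card W"
      have "finite K" using K(1) by (rule finite_subset) simp
      then have "card (K \<union> W) = card K + card W" using K(1) finW by (intro card_Un_disjoint) auto
      then show "K \<union> W \<in> dsubsets n d" using K assms by (auto simp: dsubsets_iff)
    qed
  qed auto
  also have "\<dots> = card ({1..n} - W) choose (d - card W)" by (intro n_subsets) simp
  also have "card ({1..n} - W) = n - card W" using assms(1) finW by (simp add: card_Diff_subset)
  finally show ?thesis .
qed

lemma card_supersets_gt:
  assumes "d < card W" shows "{I\<in>dsubsets n d. W \<subseteq> I} = {}"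
proof -
  have False if "I \<in> dsubsets n d" "W \<subseteq> I" for I
    using card_mono[OF dsubsets_finite[OF that(1)] that(2)] that(1) assms by (simp add: dsubsets_iff)
  then show ?thesis by blast
qed

lemma card_supersets_le:
  assumes "W \<subseteq> {1..n}" "d \<le> n" "0 < n"
  shows "real (card {I\<in>dsubsets n d. W \<subseteq> I}) \<le> real (n choose d) * (real d / real n) ^ card W"
proof (cases "card W \<le> d")
  case True
  then show ?thesis using card_supersets[OF assms(1) True] choose_diff_le[OF True assms(2,3)] by simp
next
  case False
  then have "{I\<in>dsubsets n d. W \<subseteq> I} = {}" by (intro card_supersets_gt) simp
  then show ?thesis by (simp only: card.empty) simp
qed

lemma card_sym_diff_halves:
  assumes "card I = card J" "finite I" "finite J"
  shows "card (sym_diff I J) = 2 * card (I - J)"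
proof -
  have "card (I - J) = card (J - I)"
    using assms by (simp add: card_Diff_subset_Int Int_commute)
  moreover have "card (sym_diff I J) = card (I - J) + card (J - I)"
    using assms by (intro card_Un_disjoint) auto
  ultimately show ?thesis by simp
qed

text \<open>A pair with symmetric difference E is determined by its first set I, which contains U
  and the half I - J of E. There are at most 2^|E| halves, and a given half together with U lies in
  at most a fraction (d / n)^(|E| / 2 + |U|) of all d-sets.\<close>

lemma card_pairs_le:
  assumes "E \<subseteq> {1..n}" "U \<subseteq> {1..n}" "E \<inter> U = {}" "d \<le> n" "0 < n"
  shows "real (card {p\<in>dsubsets n d \<times> dsubsets n d. sym_diff (fst p) (snd p) = E \<and> U \<subseteq> fst p \<inter> snd p})
    \<le> real (n choose d) * 2 ^ card E * (real d / real n) ^ (card E div 2 + card U)"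
proof -
  let ?P = "{p\<in>dsubsets n d \<times> dsubsets n d. sym_diff (fst p) (snd p) = E \<and> U \<subseteq> fst p \<inter> snd p}"
  let ?E1 = "{E1\<in>Pow E. card E1 = card E div 2}"
  have fin: "finite E" "finite U" using assms finite_subset by blast+
  have "inj_on fst ?P"
  proof (rule inj_onI)
    fix p q assume "p \<in> ?P" "q \<in> ?P" "fst p = fst q"
    then have "snd p = snd q" by blast
    then show "p = q" using \<open>fst p = fst q\<close> by (rule prod_eqI[rotated])
  qed
  then have "card ?P = card (fst ` ?P)" by (simp add: card_image)
  also have "\<dots> \<le> card (\<Union>E1\<in>?E1. {I\<in>dsubsets n d. E1 \<union> U \<subseteq> I})"
  proof (rule card_mono)
    show "fst ` ?P \<subseteq> (\<Union>E1\<in>?E1. {I\<in>dsubsets n d. E1 \<union> U \<subseteq> I})"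
    proof
      fix I assume "I \<in> fst ` ?P"
      then obtain J where IJ: "I \<in> dsubsets n d" "J \<in> dsubsets n d" "sym_diff I J = E" "U \<subseteq> I \<inter> J" by auto
      have "card E = 2 * card (I - J)"
        using IJ card_sym_diff_halves[of I J] by (auto simp: dsubsets_iff dsubsets_finite)
      then have "I - J \<in> ?E1" using IJ by auto
      moreover have "I \<in> {I\<in>dsubsets n d. (I' - J) \<union> U \<subseteq> I}" if "I' = I" for I' using IJ that by auto
      ultimately show "I \<in> (\<Union>E1\<in>?E1. {I\<in>dsubsets n d. E1 \<union> U \<subseteq> I})" by blast
    qed
  qed (use fin in auto)
  also have "\<dots> \<le> (\<Sum>E1\<in>?E1. card {I\<in>dsubsets n d. E1 \<union> U \<subseteq> I})"
    using fin by (intro card_UN_le) auto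
  finally have "real (card ?P) \<le> (\<Sum>E1\<in>?E1. real (card {I\<in>dsubsets n d. E1 \<union> U \<subseteq> I}))"
    by (simp only: of_nat_sum[symmetric] of_nat_le_iff)
  also have "\<dots> \<le> (\<Sum>E1\<in>?E1. real (n choose d) * (real d / real n) ^ (card E div 2 + card U))"
  proof (intro sum_mono)
    fix E1 assume E1: "E1 \<in> ?E1"
    then have "card (E1 \<union> U) = card E div 2 + card U"
      using fin assms(3) by (subst card_Un_disjoint) (auto intro: finite_subset)
    then show "real (card {I\<in>dsubsets n d. E1 \<union> U \<subseteq> I}) \<le> real (n choose d) * (real d / real n) ^ (card E div 2 + card U)"
      using card_supersets_le[of "E1 \<union> U" n d] E1 assms by auto
  qed
  also have "\<dots> = real (card ?E1) * (real (n choose d) * (real d / real n) ^ (card E div 2 + card U))" by simp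
  also have "\<dots> \<le> 2 ^ card E * (real (n choose d) * (real d / real n) ^ (card E div 2 + card U))"
  proof (intro mult_right_mono)
    have "card ?E1 \<le> card (Pow E)" using fin by (intro card_mono) auto
    also have "\<dots> = 2 ^ card E" using fin by (simp add: card_Pow)
    finally have "real (card ?E1) \<le> real (2 ^ card E)" by (rule of_nat_mono)
    then show "real (card ?E1) \<le> 2 ^ card E" by simp
  qed simp
  finally show ?thesis by (simp add: mult_ac)
qed

lemma sum_Pow_by_card:
  fixes h :: "nat set \<Rightarrow> real"
  shows "(\<Sum>U\<in>Pow {1..n}. h U) = (\<Sum>k\<le>n. \<Sum>U\<in>dsubsets n k. h U)"
proof -
  have "(\<Sum>U\<in>Pow {1..n}. h U) = (\<Sum>k\<le>n. sum h {U\<in>Pow {1..n}. card U = k})"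
  proof (rule sum.group[symmetric])
    show "card ` Pow {1..n} \<subseteq> {..n}" using card_mono[of "{1..n}"] by fastforce
  qed auto
  also have "\<dots> = (\<Sum>k\<le>n. \<Sum>U\<in>dsubsets n k. h U)"
    by (intro sum.cong) (auto simp: dsubsets_def)
  finally show ?thesis .
qed

text \<open>Summing the level bounds, each weighted by k / d, leaves a total of relative size d / n.
  Without the zero sum the empty set alone would already contribute a term of relative order
  one.\<close>

lemma up_sum_energy_total:
  assumes zero: "(\<Sum>I\<in>dsubsets n d. B I) = 0" and d: "1 \<le> d" "d \<le> n" and g: "0 \<le> g"
  shows "(\<Sum>U\<in>Pow {1..n}. g ^ card U * (up_sum n d B U)\<^sup>2)
    \<le> real (n choose d) * (\<Sum>I\<in>dsubsets n d. (B I)\<^sup>2) * (g * d / n * exp (g * (real d)\<^sup>2 / n))"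
proof -
  let ?s = "\<Sum>I\<in>dsubsets n d. (B I)\<^sup>2" and ?p = "real (n choose d)"
  define q where "q = g * d / n"
  have q: "0 \<le> q" using g by (simp add: q_def)
  have s: "0 \<le> ?s" by (simp add: sum_nonneg)
  have "(\<Sum>U\<in>Pow {1..n}. g ^ card U * (up_sum n d B U)\<^sup>2) = (\<Sum>k\<le>n. \<Sum>U\<in>dsubsets n k. g ^ card U * (up_sum n d B U)\<^sup>2)"
    by (rule sum_Pow_by_card)
  also have "\<dots> = (\<Sum>k\<le>n. g ^ k * up_energy n d B k)"
    unfolding up_energy_def sum_distrib_left by (intro sum.cong refl) (simp add: dsubsets_iff)
  also have "\<dots> = (\<Sum>k\<le>d. g ^ k * up_energy n d B k)"
  proof (intro sum.mono_neutral_right)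
    show "\<forall>k\<in>{..n} - {..d}. g ^ k * up_energy n d B k = 0"
    proof
      fix k assume "k \<in> {..n} - {..d}"
      then have "up_sum n d B U = 0" if "U \<in> dsubsets n k" for U
      proof -
        have "{I\<in>dsubsets n d. U \<subseteq> I} = {}"
          using that \<open>k \<in> {..n} - {..d}\<close> by (intro card_supersets_gt) (auto simp: dsubsets_iff)
        then show ?thesis by (simp only: up_sum_def sum.empty)
      qed
      then show "g ^ k * up_energy n d B k = 0" by (simp add: up_energy_def)
    qed
  qed (use d in auto)
  also have "\<dots> \<le> (\<Sum>k\<le>d. ?p * ?s / d * (real k * real (d choose k) * q ^ k))"
  proof (intro sum_mono)
    fix k assume k: "k \<in> {..d}"
    have "up_energy n d B k \<le> real k / real d * real (d choose k) * real ((n - k) choose (d - k)) * ?s"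
      using up_energy_le[OF zero _ d] k by simp
    also have "\<dots> \<le> real k / real d * real (d choose k) * (?p * (real d / real n) ^ k) * ?s"
      using choose_diff_le[of k d n] k d s by (intro mult_right_mono mult_left_mono) auto
    finally have "g ^ k * up_energy n d B k \<le> g ^ k * (real k / real d * real (d choose k) * (?p * (real d / real n) ^ k) * ?s)"
      using g by (intro mult_left_mono) auto
    then show "g ^ k * up_energy n d B k \<le> ?p * ?s / d * (real k * real (d choose k) * q ^ k)"
      by (simp add: q_def power_mult_distrib power_divide mult_ac)
  qed
  also have "\<dots> = ?p * ?s / d * (real d * q * (1 + q) ^ (d - 1))"
    by (simp only: sum_distrib_left[symmetric] sum_times_binomial_power[OF d(1)])
  also have "\<dots> = ?p * ?s * (q * (1 + q) ^ (d - 1))" using d by simp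
  also have "\<dots> \<le> ?p * ?s * (q * exp (q * d))"
  proof (intro mult_left_mono)
    have "(1 + q) ^ (d - 1) \<le> exp (q * real (d - 1))" by (rule one_plus_power_le_exp) (rule q)
    also have "\<dots> \<le> exp (q * d)" using q by (simp add: mult_left_mono)
    finally show "(1 + q) ^ (d - 1) \<le> exp (q * d)" .
  qed (use q s in auto)
  also have "q * d = g * (real d)\<^sup>2 / n" by (simp add: q_def power2_eq_square)
  finally show ?thesis by (simp only: q_def)
qed

context standardized_law
begin

text \<open>Both parts gain a factor d / n, for different reasons. The diagonal part gains it from
  the vanishing trace. In the off-diagonal part E has 2 m points with m >= 1, which leads to a
  factor (16 d / n)^m; as 16 d <= n, one of these factors can be kept and the others
  dropped.\<close>

theorem quad_form_second_moment:
  fixes B :: "nat set \<Rightarrow> nat set \<Rightarrow> real"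
  assumes tr: "(\<Sum>I\<in>dsubsets n d. B I I) = 0" and d: "1 \<le> d" "d \<le> n" "16 * d \<le> n"
  defines "f \<equiv> \<lambda>y. \<Sum>I\<in>dsubsets n d. \<Sum>J\<in>dsubsets n d. B I J * ((\<Prod>i\<in>I. y i) * (\<Prod>i\<in>J. y i))"
  shows "integrable (PiM {1..n} (\<lambda>_. D)) (\<lambda>y. (f y)\<^sup>2)"
    and "(LINT y|PiM {1..n} (\<lambda>_. D). (f y)\<^sup>2) \<le> real (n choose d) * (\<Sum>I\<in>dsubsets n d. \<Sum>J\<in>dsubsets n d. (B I J)\<^sup>2)
      * ((16 + 2 * v) * (d / n) * exp (2 * v * (real d)\<^sup>2 / n))"
proof -
  let ?S = "dsubsets n d" and ?p = "real (n choose d)"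
  let ?BB = "\<Sum>I\<in>?S. \<Sum>J\<in>?S. (B I J)\<^sup>2"
  \<comment> \<open>A triple ((I, J), U) stands for one term in the expansion of one product of
    monomials; \<phi> sends it to its chaos label, and \<open>b\<close> collects the coefficients
    over each fibre.\<close>
  define T where "T = Sigma (?S \<times> ?S) (\<lambda>p. Pow (fst p \<inter> snd p))"
  define \<phi> where "\<phi> t = (sym_diff (fst (fst t)) (snd (fst t)), snd t)" for t :: "(nat set \<times> nat set) \<times> nat set"
  define Bt where "Bt t = B (fst (fst t)) (snd (fst t))" for t :: "(nat set \<times> nat set) \<times> nat set"
  define F where "F = \<phi> ` T"
  define b where "b e = (\<Sum>t\<in>{t\<in>T. \<phi> t = e}. Bt t)" for e
  have finT: "finite T"
    unfolding T_def by (intro finite_SigmaI) (auto simp: dsubsets_finite)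
  have finF: "finite F" unfolding F_def using finT by simp
  have n0: "0 < n" using d by simp
  have F: "E \<union> U \<subseteq> {1..n} \<and> E \<inter> U = {}" if "(E, U) \<in> F" for E U
  proof -
    from that obtain I J where "I \<in> ?S" "J \<in> ?S" "U \<subseteq> I \<inter> J" "E = sym_diff I J"
      by (auto simp: F_def T_def \<phi>_def)
    then show ?thesis by (auto simp: dsubsets_iff)
  qed
  have f: "f y = (\<Sum>e\<in>F. b e * chaos n (fst e) (snd e) y)" for y
  proof -
    have "f y = (\<Sum>p\<in>?S \<times> ?S. \<Sum>U\<in>Pow (fst p \<inter> snd p). B (fst p) (snd p) * chaos n (sym_diff (fst p) (snd p)) U y)"
      unfolding f_def sum.cartesian_product
      by (intro sum.cong refl) (auto simp: monomial_product_chaos dsubsets_iff sum_distrib_left)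
    also have "\<dots> = (\<Sum>t\<in>T. Bt t * chaos n (fst (\<phi> t)) (snd (\<phi> t)) y)"
      unfolding T_def by (subst sum.Sigma) (auto simp: dsubsets_finite Bt_def \<phi>_def split_def)
    also have "\<dots> = (\<Sum>e\<in>F. \<Sum>t\<in>{t\<in>T. \<phi> t = e}. Bt t * chaos n (fst (\<phi> t)) (snd (\<phi> t)) y)"
      unfolding F_def by (rule sum.image_gen) (rule finT)
    also have "\<dots> = (\<Sum>e\<in>F. b e * chaos n (fst e) (snd e) y)"
      unfolding b_def sum_distrib_right by (intro sum.cong refl) auto
    finally show ?thesis .
  qed
  show "integrable (PiM {1..n} (\<lambda>_. D)) (\<lambda>y. (f y)\<^sup>2)"
    unfolding f by (rule chaos_sum_square(1)[OF finF F])
  let ?W = "\<lambda>e::nat set \<times> nat set. 2 ^ card (fst e \<union> snd e) * v ^ card (snd e)"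
  define q where "q = 2 * v * d / n"
  have q: "0 \<le> q" using v_nonneg by (simp add: q_def)
  define C where "C = ?p * (16 * d / n)"
  have C: "0 \<le> C" by (simp add: C_def)
  have eq_exp: "q * d = 2 * v * (real d)\<^sup>2 / n" by (simp add: q_def power2_eq_square)
  have off: "?W e * (b e)\<^sup>2 \<le> (\<Sum>t\<in>{t\<in>T. \<phi> t = e}. C * q ^ card (snd t) * (Bt t)\<^sup>2)"
    if e: "e \<in> F" "fst e \<noteq> {}" for e
  proof -
    obtain E U where eEU: "e = (E, U)" by (cases e)
    have EU: "E \<subseteq> {1..n}" "U \<subseteq> {1..n}" "E \<inter> U = {}" using F[of E U] e eEU by auto
    have fin: "finite E" "finite U" using EU finite_subset by blast+
    from e(1) obtain t where t: "t \<in> T" "(E, U) = \<phi> t" unfolding eEU F_def by (rule imageE)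
    define I J where "I = fst (fst t)" and "J = snd (fst t)"
    have IJ: "I \<in> ?S" "J \<in> ?S" "E = sym_diff I J"
      using t by (auto simp: T_def \<phi>_def I_def J_def)
    have half: "card E = 2 * card (I - J)"
      unfolding IJ(3) using IJ by (intro card_sym_diff_halves) (auto simp: dsubsets_iff dsubsets_finite)
    define m where "m = card (I - J)"
    have m: "1 \<le> m" using half e eEU fin by (cases "card (I - J) = 0") (auto simp: m_def)
    have card: "real (card {t\<in>T. \<phi> t = e}) \<le> ?p * 2 ^ card E * (real d / real n) ^ (m + card U)"
    proof -
      have "card {t\<in>T. \<phi> t = e} \<le> card {p\<in>?S \<times> ?S. sym_diff (fst p) (snd p) = E \<and> U \<subseteq> fst p \<inter> snd p}"
        by (rule card_inj_on_le[of fst]) (auto simp: inj_on_def \<phi>_def T_def eEU)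
      then have "real (card {t\<in>T. \<phi> t = e}) \<le> real (card {p\<in>?S \<times> ?S. sym_diff (fst p) (snd p) = E \<and> U \<subseteq> fst p \<inter> snd p})"
        by (rule of_nat_mono)
      also have "\<dots> \<le> ?p * 2 ^ card E * (real d / real n) ^ (card E div 2 + card U)"
        by (rule card_pairs_le[OF EU d(2) n0])
      finally show ?thesis by (simp add: half m_def)
    qed
    have W: "?W e = 2 ^ card E * (2 * v) ^ card U"
      using fin EU(3) by (simp add: eEU card_Un_disjoint power_add power_mult_distrib)
    have "?W e * real (card {t\<in>T. \<phi> t = e}) \<le> ?W e * (?p * 2 ^ card E * (real d / real n) ^ (m + card U))"
      using card v_nonneg by (intro mult_left_mono) auto
    also have "\<dots> = ?p * (16 * d / n) ^ m * q ^ card U"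
    proof -
      \<comment> \<open>One factor 2^|E| counts the splits of a support, the other the halves of E;
        with |E| = 2 m they multiply to 16^m.\<close>
      have "2 ^ card E * 2 ^ card E = (16 ^ m :: real)"
        unfolding half m_def[symmetric] by (simp add: power_mult power_mult_distrib[symmetric])
      then show ?thesis unfolding W
        by (simp add: q_def power_add power_mult_distrib power_divide mult_ac)
    qed
    also have "\<dots> \<le> C * q ^ card U"
    proof -
      have "(16 * real d / n) ^ m \<le> (16 * real d / n) ^ 1"
        using d m by (intro power_decreasing) auto
      then show ?thesis unfolding C_def using q by (intro mult_right_mono mult_left_mono) auto
    qed
    finally have Wcard: "?W e * real (card {t\<in>T. \<phi> t = e}) \<le> C * q ^ card U" .
    \<comment> \<open>Cauchy-Schwarz over the fibre: its size is absorbed into the constant, and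
      only the squares of the entries remain to be summed.\<close>
    have "(b e)\<^sup>2 \<le> real (card {t\<in>T. \<phi> t = e}) * (\<Sum>t\<in>{t\<in>T. \<phi> t = e}. (Bt t)\<^sup>2)"
      unfolding b_def using sum_squared_le_sum_of_squares[of Bt "{t\<in>T. \<phi> t = e}"] finT by (simp add: mult.commute)
    then have "?W e * (b e)\<^sup>2 \<le> ?W e * (real (card {t\<in>T. \<phi> t = e}) * (\<Sum>t\<in>{t\<in>T. \<phi> t = e}. (Bt t)\<^sup>2))"
      using v_nonneg by (intro mult_left_mono) auto
    also have "\<dots> \<le> C * q ^ card U * (\<Sum>t\<in>{t\<in>T. \<phi> t = e}. (Bt t)\<^sup>2)"
      unfolding mult.assoc[symmetric] by (intro mult_right_mono Wcard[unfolded mult.assoc[symmetric]] sum_nonneg) simp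
    also have "\<dots> = (\<Sum>t\<in>{t\<in>T. \<phi> t = e}. C * q ^ card (snd t) * (Bt t)\<^sup>2)"
      unfolding sum_distrib_left by (intro sum.cong refl) (auto simp: \<phi>_def eEU)
    finally show ?thesis .
  qed
  \<comment> \<open>An empty symmetric difference forces I = J, so these coefficients are the
    up-sums of the diagonal.\<close>
  have b_diag: "b ({}, U) = up_sum n d (\<lambda>I. B I I) U" if "U \<subseteq> {1..n}" for U
  proof -
    have "b ({}, U) = (\<Sum>I\<in>{I\<in>?S. U \<subseteq> I}. B I I)"
      unfolding b_def
      by (rule sum.reindex_bij_witness[where i = "\<lambda>I. ((I, I), U)" and j = "\<lambda>t. fst (fst t)"])
        (auto simp: T_def \<phi>_def Bt_def)
    then show ?thesis by (simp add: up_sum_def)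
  qed
  let ?F0 = "{e\<in>F. fst e = {}}" and ?F1 = "{e\<in>F. fst e \<noteq> {}}"
  have diag: "(\<Sum>e\<in>?F0. ?W e * (b e)\<^sup>2) \<le> ?p * ?BB * (2 * v * d / n * exp (2 * v * (real d)\<^sup>2 / n))"
  proof -
    have "(\<Sum>e\<in>?F0. ?W e * (b e)\<^sup>2) \<le> (\<Sum>e\<in>Pair {} ` Pow {1..n}. ?W e * (b e)\<^sup>2)"
      using F v_nonneg by (intro sum_mono2) force+
    also have "\<dots> = (\<Sum>U\<in>Pow {1..n}. (2 * v) ^ card U * (up_sum n d (\<lambda>I. B I I) U)\<^sup>2)"
      by (subst sum.reindex) (auto simp: inj_on_def b_diag power_mult_distrib intro!: sum.cong)
    also have "\<dots> \<le> ?p * (\<Sum>I\<in>?S. (B I I)\<^sup>2) * (2 * v * d / n * exp (2 * v * (real d)\<^sup>2 / n))"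
      using v_nonneg by (intro up_sum_energy_total[OF tr d(1,2)]) simp
    also have "\<dots> \<le> ?p * ?BB * (2 * v * d / n * exp (2 * v * (real d)\<^sup>2 / n))"
    proof (intro mult_right_mono mult_left_mono sum_mono)
      fix I assume "I \<in> ?S"
      then show "(B I I)\<^sup>2 \<le> (\<Sum>J\<in>?S. (B I J)\<^sup>2)" by (intro member_le_sum) auto
    qed (use v_nonneg in auto)
    finally show ?thesis .
  qed
  have offdiag: "(\<Sum>e\<in>?F1. ?W e * (b e)\<^sup>2) \<le> C * ?BB * exp (q * d)"
  proof -
    have "(\<Sum>e\<in>?F1. ?W e * (b e)\<^sup>2) \<le> (\<Sum>e\<in>?F1. \<Sum>t\<in>{t\<in>T. \<phi> t = e}. C * q ^ card (snd t) * (Bt t)\<^sup>2)"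
      by (intro sum_mono off) auto
    also have "\<dots> \<le> (\<Sum>e\<in>F. \<Sum>t\<in>{t\<in>T. \<phi> t = e}. C * q ^ card (snd t) * (Bt t)\<^sup>2)"
      using C q finF by (intro sum_mono2 sum_nonneg) auto
    also have "\<dots> = (\<Sum>t\<in>T. C * q ^ card (snd t) * (Bt t)\<^sup>2)"
      unfolding F_def by (rule sum.image_gen[symmetric]) (rule finT)
    also have "\<dots> = (\<Sum>p\<in>?S \<times> ?S. \<Sum>U\<in>Pow (fst p \<inter> snd p). C * q ^ card U * (B (fst p) (snd p))\<^sup>2)"
      unfolding T_def by (subst sum.Sigma) (auto simp: dsubsets_finite Bt_def split_def)
    also have "\<dots> = (\<Sum>p\<in>?S \<times> ?S. C * (B (fst p) (snd p))\<^sup>2 * (1 + q) ^ card (fst p \<inter> snd p))"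
    proof (intro sum.cong refl)
      fix p assume "p \<in> ?S \<times> ?S"
      then have "finite (fst p \<inter> snd p)" by (auto simp: dsubsets_finite)
      from sum_Pow_card[OF this, of q]
      show "(\<Sum>U\<in>Pow (fst p \<inter> snd p). C * q ^ card U * (B (fst p) (snd p))\<^sup>2)
        = C * (B (fst p) (snd p))\<^sup>2 * (1 + q) ^ card (fst p \<inter> snd p)"
        by (simp add: sum_distrib_left[symmetric] sum_distrib_right[symmetric] mult_ac)
    qed
    also have "\<dots> \<le> (\<Sum>p\<in>?S \<times> ?S. C * (B (fst p) (snd p))\<^sup>2 * exp (q * d))"
    proof (intro sum_mono mult_left_mono)
      fix p assume p: "p \<in> ?S \<times> ?S"
      have "card (fst p \<inter> snd p) \<le> d"
        using p card_mono[of "fst p" "fst p \<inter> snd p"] by (auto simp: dsubsets_finite dsubsets_iff)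
      then have "(1 + q) ^ card (fst p \<inter> snd p) \<le> (1 + q) ^ d" using q by (intro power_increasing) auto
      also have "\<dots> \<le> exp (q * d)" by (rule one_plus_power_le_exp) (rule q)
      finally show "(1 + q) ^ card (fst p \<inter> snd p) \<le> exp (q * d)" .
    qed (use C in auto)
    also have "\<dots> = C * ?BB * exp (q * d)"
      by (simp add: sum.cartesian_product split_def sum_distrib_left sum_distrib_right)
    finally show ?thesis .
  qed
  have "(LINT y|PiM {1..n} (\<lambda>_. D). (f y)\<^sup>2) \<le> (\<Sum>e\<in>F. ?W e * (b e)\<^sup>2)"
    unfolding f using chaos_sum_square(2)[OF finF F, of b] by simp
  also have "\<dots> = (\<Sum>e\<in>?F0. ?W e * (b e)\<^sup>2) + (\<Sum>e\<in>?F1. ?W e * (b e)\<^sup>2)"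
    using finF by (subst sum.union_disjoint[symmetric]) (auto intro: sum.cong)
  also have "\<dots> \<le> ?p * ?BB * (2 * v * d / n * exp (2 * v * (real d)\<^sup>2 / n)) + C * ?BB * exp (q * d)"
    by (intro add_mono diag offdiag)
  also have "\<dots> = ?p * ?BB * ((16 + 2 * v) * (d / n) * exp (2 * v * (real d)\<^sup>2 / n))"
    unfolding eq_exp C_def by (simp add: algebra_simps add_divide_distrib)
  finally show "(LINT y|PiM {1..n} (\<lambda>_. D). (f y)\<^sup>2) \<le> ?p * ?BB * ((16 + 2 * v) * (d / n) * exp (2 * v * (real d)\<^sup>2 / n))" .
qed

end

section \<open>The limit law of the normalized square norm\<close>

definition mean_square :: "nat \<Rightarrow> nat \<Rightarrow> (nat \<Rightarrow> real) \<Rightarrow> real" where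
  "mean_square n d y = (\<Sum>I\<in>dsubsets n d. (\<Prod>i\<in>I. y i)\<^sup>2) / real (n choose d)"

text \<open>The square norm is a symmetric sum, hard to treat directly; in the orthogonal expansion its coefficient
  at \<open>U\<close> is close to \<open>(d / n)\<^bsup>|U|\<^esup>\<close>, which is the coefficient of a product of independent factors.\<close>

definition square_product :: "nat \<Rightarrow> nat \<Rightarrow> (nat \<Rightarrow> real) \<Rightarrow> real" where
  "square_product n d y = (\<Prod>i\<in>{1..n}. 1 + real d / real n * ((y i)\<^sup>2 - 1))"

lemma mean_square_nonneg: "0 \<le> mean_square n d y"
  by (simp add: mean_square_def sum_nonneg)

lemma mean_square_chaos:
  "mean_square n d y = (\<Sum>U\<in>Pow {1..n}. real (card {I\<in>dsubsets n d. U \<subseteq> I}) / real (n choose d) * chaos n {} U y)"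
proof -
  have "(\<Sum>I\<in>dsubsets n d. (\<Prod>i\<in>I. y i)\<^sup>2) = (\<Sum>I\<in>dsubsets n d. \<Sum>U\<in>Pow I. chaos n {} U y)"
  proof (intro sum.cong refl)
    fix I assume "I \<in> dsubsets n d"
    then show "(\<Prod>i\<in>I. y i)\<^sup>2 = (\<Sum>U\<in>Pow I. chaos n {} U y)"
      using monomial_product_chaos[of I n I y] by (simp add: dsubsets_iff power2_eq_square)
  qed
  also have "\<dots> = (\<Sum>I\<in>dsubsets n d. \<Sum>U\<in>Pow {1..n}. if U \<subseteq> I then chaos n {} U y else 0)"
    by (intro sum.cong refl sum.mono_neutral_cong_left) (auto simp: dsubsets_iff)
  also have "\<dots> = (\<Sum>U\<in>Pow {1..n}. \<Sum>I\<in>dsubsets n d. if U \<subseteq> I then chaos n {} U y else 0)"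
    by (rule sum.swap)
  also have "\<dots> = (\<Sum>U\<in>Pow {1..n}. real (card {I\<in>dsubsets n d. U \<subseteq> I}) * chaos n {} U y)"
  proof (intro sum.cong refl)
    fix U
    have "(\<Sum>I\<in>dsubsets n d. if U \<subseteq> I then chaos n {} U y else 0) = (\<Sum>I\<in>{I\<in>dsubsets n d. U \<subseteq> I}. chaos n {} U y)"
      by (intro sum.mono_neutral_cong_right) auto
    then show "(\<Sum>I\<in>dsubsets n d. if U \<subseteq> I then chaos n {} U y else 0) = real (card {I\<in>dsubsets n d. U \<subseteq> I}) * chaos n {} U y"
      by simp
  qed
  finally show ?thesis by (simp add: mean_square_def sum_divide_distrib)
qed

lemma square_product_chaos:
  "square_product n d y = (\<Sum>U\<in>Pow {1..n}. (real d / real n) ^ card U * chaos n {} U y)"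
proof -
  have "square_product n d y = (\<Prod>i\<in>{1..n}. real d / real n * ((y i)\<^sup>2 - 1) + 1)"
    by (simp add: square_product_def add.commute)
  also have "\<dots> = (\<Sum>U\<in>Pow {1..n}. (\<Prod>i\<in>U. real d / real n * ((y i)\<^sup>2 - 1)))"
    by (subst prod_add) auto
  also have "\<dots> = (\<Sum>U\<in>Pow {1..n}. (real d / real n) ^ card U * chaos n {} U y)"
  proof (intro sum.cong refl)
    fix U assume "U \<in> Pow {1..n}"
    then have "chaos n {} U y = (\<Prod>i\<in>U. (y i)\<^sup>2 - 1)" by (simp add: chaos_eq)
    then show "(\<Prod>i\<in>U. real d / real n * ((y i)\<^sup>2 - 1)) = (real d / real n) ^ card U * chaos n {} U y"
      by (simp only: prod.distrib prod_constant)
  qed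
  finally show ?thesis .
qed

text \<open>The ratio (d - k) / (n - k) is at least (d / n) (1 - k / d), and (1 - k^2 / d) (1 - k /
  d) >= 1 - (k + 1)^2 / d closes the induction. Once k^2 > d the left side of the next step is not
  positive.\<close>

lemma choose_diff_ge:
  assumes "k \<le> d" "1 \<le> d" "d \<le> n"
  shows "real (n choose d) * ((real d / real n)^k * (1 - (real k)\<^sup>2 / d)) \<le> real ((n - k) choose (d - k))"
  using assms(1)
proof (induction k)
  case (Suc k)
  let ?a = "real d / real n" and ?p = "real (n choose d)"
  have pos: "real n - real k > 0" "real n > 0" "real d > 0" using Suc.prems assms by auto
  show ?case
  proof (cases "(real k)\<^sup>2 / d \<le> 1")
    case True
    have kd: "0 \<le> 1 - real k / d" using Suc.prems pos by (simp add: field_simps)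
    have "?a ^ Suc k * (1 - (real (Suc k))\<^sup>2 / d) \<le> ?a ^ Suc k * ((1 - (real k)\<^sup>2 / d) * (1 - real k / d))"
    proof (intro mult_left_mono)
      have "(1 - A) * (1 - B) = 1 - A - B + A * B" for A B :: real
        by (simp add: algebra_simps)
      then have "(1 - (real k)\<^sup>2 / d) * (1 - real k / d) = 1 - (real k)\<^sup>2 / d - real k / d + (real k)\<^sup>2 / d * (real k / d)" .
      moreover have "0 \<le> (real k)\<^sup>2 / d * (real k / d)" by simp
      moreover have "(real (Suc k))\<^sup>2 / d = (real k)\<^sup>2 / d + real k / d + (real k + 1) / d"
        by (simp add: add_divide_distrib[symmetric] power2_eq_square algebra_simps)
      moreover have "0 \<le> (real k + 1) / d" by simp
      ultimately show "1 - (real (Suc k))\<^sup>2 / d \<le> (1 - (real k)\<^sup>2 / d) * (1 - real k / d)" by linarith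
    qed simp
    then have "?p * (?a ^ Suc k * (1 - (real (Suc k))\<^sup>2 / d)) \<le> ?p * (?a ^ Suc k * ((1 - (real k)\<^sup>2 / d) * (1 - real k / d)))"
      by (rule mult_left_mono) simp
    also have "\<dots> = ?p * (?a ^ k * (1 - (real k)\<^sup>2 / d)) * (?a * (1 - real k / d))"
      by (simp only: power_Suc mult_ac)
    also have "\<dots> \<le> real ((n - k) choose (d - k)) * (?a * (1 - real k / d))"
      using Suc kd by (intro mult_right_mono) auto
    also have "?a * (1 - real k / d) = (real d - real k) / n"
      using pos by (simp add: field_simps)
    also have "real ((n - k) choose (d - k)) * ((real d - real k) / n) \<le> real ((n - k) choose (d - k)) * ((real d - real k) / (real n - real k))"
      using pos Suc.prems by (intro mult_left_mono divide_left_mono) auto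
    also have "\<dots> = real ((n - Suc k) choose (d - Suc k))"
      using choose_Suc_times[of k d n] Suc.prems assms pos by (simp add: field_simps)
    finally show ?thesis .
  next
    case False
    have "(real k)\<^sup>2 / d \<le> (real (Suc k))\<^sup>2 / d" by (intro divide_right_mono power_mono) auto
    then have "1 - (real (Suc k))\<^sup>2 / d \<le> 0" using False by linarith
    then have "?p * (?a ^ Suc k * (1 - (real (Suc k))\<^sup>2 / d)) \<le> 0"
      by (intro mult_nonneg_nonpos) auto
    then show ?thesis by (rule order_trans) simp
  qed
qed simp

text \<open>Trades the weight k^2 for k, which has a closed generating sum; the price 2^k only
  enlarges the base of the power.\<close>

lemma square_le_times_power2: "(real k)\<^sup>2 \<le> real k * 2 ^ k"
proof -
  have "k \<le> 2 ^ k" by (rule less_imp_le) (rule less_exp)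
  then have "real k \<le> 2 ^ k" by (metis of_nat_le_iff of_nat_numeral of_nat_power)
  then show ?thesis by (simp add: power2_eq_square mult_left_mono)
qed

context standardized_law
begin

lemma mean_square_integral:
  assumes "d \<le> n"
  shows "integrable (PiM {1..n} (\<lambda>_. D)) (mean_square n d)"
    and "(LINT y|PiM {1..n} (\<lambda>_. D). mean_square n d y) = 1"
proof -
  have one: "chaos n {} {} y = 1" for y by (simp add: chaos_def chaos_factor_def)
  have int: "integrable (PiM {1..n} (\<lambda>_. D)) (\<lambda>y. chaos n {} U y)" for U
    using chaos_integral(1)[of n "{}" U "{}" "{}"] by (simp add: one)
  show "integrable (PiM {1..n} (\<lambda>_. D)) (mean_square n d)"
    unfolding mean_square_chaos[abs_def] using int by (intro Bochner_Integration.integrable_sum integrable_mult_right) auto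
  have "(LINT y|PiM {1..n} (\<lambda>_. D). chaos n {} U y) = (if U = {} then 1 else 0)" if "U \<subseteq> {1..n}" for U
  proof (cases "U = {}")
    case True
    interpret Y: prob_space "PiM {1..n} (\<lambda>_. D)" by (rule prob_space_PiM) (rule prob)
    show ?thesis using Y.prob_space by (simp add: True one)
  next
    case False
    then show ?thesis using chaos_orthogonal[of "{}" U n "{}" "{}"] that by (simp add: one)
  qed
  then have "(LINT y|PiM {1..n} (\<lambda>_. D). mean_square n d y)
      = (\<Sum>U\<in>Pow {1..n}. real (card {I\<in>dsubsets n d. U \<subseteq> I}) / real (n choose d) * (if U = {} then 1 else 0))"
    unfolding mean_square_chaos[abs_def] using int by (subst Bochner_Integration.integral_sum) (auto intro!: sum.cong)
  also have "\<dots> = (\<Sum>U\<in>{{}}. real (card {I\<in>dsubsets n d. U \<subseteq> I}) / real (n choose d))"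
    by (intro sum.mono_neutral_cong_right) auto
  also have "\<dots> = 1" using assms by (simp add: card_dsubsets)
  finally show "(LINT y|PiM {1..n} (\<lambda>_. D). mean_square n d y) = 1" .
qed

text \<open>Passing to independent factors: sampling d indices without replacement and selecting
  each index with probability d / n give coefficients that differ by at most (d / n)^k k^2 / d at
  level k, and the typical levels stay bounded since d^2 / n does.\<close>

lemma mean_square_vs_product:
  assumes d: "1 \<le> d" "d \<le> n"
  shows "integrable (PiM {1..n} (\<lambda>_. D)) (\<lambda>y. (mean_square n d y - square_product n d y)\<^sup>2)"
    and "(LINT y|PiM {1..n} (\<lambda>_. D). (mean_square n d y - square_product n d y)\<^sup>2)
      \<le> 4 * v * (d / n) * exp (4 * v * (real d)\<^sup>2 / n)"
proof -
  let ?a = "real d / real n" and ?p = "real (n choose d)"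
  define r where "r U = real (card {I\<in>dsubsets n d. U \<subseteq> I}) / ?p" for U
  let ?F = "Pair {} ` Pow {1..n}"
  define c where "c e = r (snd e) - ?a ^ card (snd e)" for e :: "nat set \<times> nat set"
  have n0: "0 < n" and p0: "0 < ?p" using d by auto
  have eq: "mean_square n d y - square_product n d y = (\<Sum>e\<in>?F. c e * chaos n (fst e) (snd e) y)" for y
    unfolding mean_square_chaos square_product_chaos sum_subtractf[symmetric]
    by (subst sum.reindex) (auto simp: inj_on_def c_def r_def left_diff_distrib)
  have finF: "finite ?F" by simp
  have F: "E \<union> U \<subseteq> {1..n} \<and> E \<inter> U = {}" if "(E, U) \<in> ?F" for E U using that by auto
  show "integrable (PiM {1..n} (\<lambda>_. D)) (\<lambda>y. (mean_square n d y - square_product n d y)\<^sup>2)"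
    unfolding eq by (rule chaos_sum_square(1)[OF finF F])
  \<comment> \<open>The difference lies between 0 and \<open>?a ^ card U\<close>, and it is also at
    most this times k^2 / d; one factor of the square is bounded each way, so a single 1 / d is
    kept.\<close>
  have coeff: "(r U - ?a ^ card U)\<^sup>2 \<le> ?a ^ card U * (?a ^ card U * ((real (card U))\<^sup>2 / d))" if U: "U \<subseteq> {1..n}" for U
  proof -
    have upper: "r U \<le> ?a ^ card U"
      using card_supersets_le[OF U d(2) n0] p0 by (simp add: r_def field_simps)
    have r0: "0 \<le> r U" by (simp add: r_def)
    have lower: "?a ^ card U * (1 - (real (card U))\<^sup>2 / d) \<le> r U"
    proof (cases "card U \<le> d")
      case True
      show ?thesis
        using choose_diff_ge[OF True d] p0 card_supersets[OF U True] by (simp add: r_def field_simps)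
    next
      case False
      have "1 \<le> (real (card U))\<^sup>2 / d"
      proof -
        have "real d * 1 \<le> real (card U) * real (card U)"
          using False d by (intro mult_mono) auto
        then show ?thesis using d by (simp add: power2_eq_square field_simps)
      qed
      then have "?a ^ card U * (1 - (real (card U))\<^sup>2 / d) \<le> 0" by (intro mult_nonneg_nonpos) auto
      then show ?thesis using r0 by linarith
    qed
    have "(r U - ?a ^ card U)\<^sup>2 = (?a ^ card U - r U) * (?a ^ card U - r U)" by (simp add: power2_eq_square algebra_simps)
    also have "\<dots> \<le> ?a ^ card U * (?a ^ card U * ((real (card U))\<^sup>2 / d))"
      using upper lower r0 by (intro mult_mono) (auto simp: algebra_simps)
    finally show ?thesis .
  qed
  \<comment> \<open>The 4 is a 2 from the number of splits in \<open>chaos_sum_square\<close> times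
    a 2 from bounding k^2 by k 2^k.\<close>
  define z where "z = 4 * v * ?a\<^sup>2"
  have z: "0 \<le> z" using v_nonneg by (simp add: z_def)
  have "(LINT y|PiM {1..n} (\<lambda>_. D). (mean_square n d y - square_product n d y)\<^sup>2)
      \<le> (\<Sum>e\<in>?F. 2 ^ card (fst e \<union> snd e) * v ^ card (snd e) * (c e)\<^sup>2)"
    unfolding eq by (rule chaos_sum_square(2)[OF finF F])
  also have "\<dots> = (\<Sum>U\<in>Pow {1..n}. 2 ^ card U * v ^ card U * (r U - ?a ^ card U)\<^sup>2)"
    by (subst sum.reindex) (auto simp: inj_on_def c_def)
  also have "\<dots> \<le> (\<Sum>U\<in>Pow {1..n}. real (card U) * z ^ card U / d)"
  proof (intro sum_mono)
    fix U assume U: "U \<in> Pow {1..n}"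
    let ?k = "card U"
    have "2 ^ ?k * v ^ ?k * (r U - ?a ^ ?k)\<^sup>2 \<le> 2 ^ ?k * v ^ ?k * (?a ^ ?k * (?a ^ ?k * ((real ?k)\<^sup>2 / d)))"
      using coeff U v_nonneg by (intro mult_left_mono) auto
    also have "\<dots> \<le> 2 ^ ?k * v ^ ?k * (?a ^ ?k * (?a ^ ?k * ((real ?k * 2 ^ ?k) / d)))"
      using v_nonneg square_le_times_power2 by (intro mult_left_mono divide_right_mono) auto
    also have "\<dots> = real ?k * (2 * 2 * v * (?a * ?a)) ^ ?k / d"
      unfolding power_mult_distrib by (simp add: mult_ac)
    finally show "2 ^ ?k * v ^ ?k * (r U - ?a ^ ?k)\<^sup>2 \<le> real ?k * z ^ ?k / d"
      by (simp add: z_def power2_eq_square)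
  qed
  also have "\<dots> = (\<Sum>k\<le>n. real (n choose k) * (real k * z ^ k / d))"
  proof -
    have "(\<Sum>U\<in>dsubsets n k. real (card U) * z ^ card U / d) = (\<Sum>U\<in>dsubsets n k. real k * z ^ k / d)" for k
      by (intro sum.cong refl) (simp add: dsubsets_iff)
    then show ?thesis unfolding sum_Pow_by_card by (simp add: card_dsubsets)
  qed
  also have "\<dots> = (\<Sum>k\<le>n. real k * real (n choose k) * z ^ k) / d"
    by (simp add: sum_divide_distrib mult_ac)
  also have "\<dots> = (real n * z * (1 + z) ^ (n - 1)) / d"
    using n0 by (subst sum_times_binomial_power) auto
  also have "\<dots> \<le> (real n * z * exp (z * n)) / d"
  proof -
    have "(1 + z) ^ (n - 1) \<le> exp (z * real (n - 1))" by (rule one_plus_power_le_exp) (rule z)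
    also have "\<dots> \<le> exp (z * n)" using z by (simp add: mult_left_mono)
    finally show ?thesis using z by (intro divide_right_mono mult_left_mono) auto
  qed
  also have "\<dots> = 4 * v * (d / n) * exp (4 * v * (real d)\<^sup>2 / n)"
  proof -
    have "z * n = 4 * v * (real d)\<^sup>2 / n" using n0 by (simp add: z_def power2_eq_square)
    moreover have "real n * z / d = 4 * v * (d / n)" using n0 d by (simp add: z_def power2_eq_square)
    moreover have "(real n * z * exp (z * n)) / d = real n * z / d * exp (z * n)" by simp
    ultimately show ?thesis by simp
  qed
  finally show "(LINT y|PiM {1..n} (\<lambda>_. D). (mean_square n d y - square_product n d y)\<^sup>2)
      \<le> 4 * v * (d / n) * exp (4 * v * (real d)\<^sup>2 / n)" .
qed

end

text \<open>Taylor's formula along a real ray in the complex plane. As \<beta> is purely imaginary,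
  the modulus of (1 + y) to the power \<beta> - k - 1 is (1 + y)^(- k - 1), at most 2^(k + 1) when y
  >= - 1 / 2.\<close>

lemma one_plus_powr_taylor:
  fixes \<beta> :: complex and x :: real
  assumes x: "- 1 / 2 \<le> x" and \<beta>: "Re \<beta> = 0"
  shows "norm (of_real (1 + x) powr \<beta> - (\<Sum>i\<le>k. (\<Prod>j<i. \<beta> - of_nat j) * of_real x ^ i / fact i))
    \<le> norm (\<Prod>j<Suc k. \<beta> - of_nat j) * 2 ^ Suc k * \<bar>x\<bar> ^ Suc k / fact k"
proof -
  define f where "f i z = (\<Prod>j<i. \<beta> - of_nat j) * (1 + z) powr (\<beta> - of_nat i)" for i :: nat and z :: complex
  define S where "S = complex_of_real ` {- 1 / 2..}"
  have "norm (f 0 (of_real x) - (\<Sum>i\<le>k. f i 0 * (of_real x - 0) ^ i / fact i))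
      \<le> (norm (\<Prod>j<Suc k. \<beta> - of_nat j) * 2 ^ Suc k) * norm (complex_of_real x - 0) ^ Suc k / fact k"
  proof (rule complex_Taylor)
    show "convex S"
      unfolding S_def by (intro convex_linear_image bounded_linear.linear[OF bounded_linear_of_real]) simp
    show "0 \<in> S" unfolding S_def by (rule image_eqI[of _ _ 0]) auto
    show "of_real x \<in> S" using x by (simp add: S_def)
  next
    fix i z assume z: "z \<in> S"
    then have "1 + z \<notin> \<real>\<^sub>\<le>\<^sub>0" by (auto simp: S_def complex_nonpos_Reals_iff)
    then show "(f i has_field_derivative f (Suc i) z) (at z within S)"
      unfolding f_def
      by (auto intro!: derivative_eq_intros simp: algebra_simps)
  next
    fix z assume "z \<in> S"
    then obtain y where y: "z = of_real y" "- 1 / 2 \<le> y" by (auto simp: S_def)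
    have "norm ((1 + z) powr (\<beta> - of_nat (Suc k))) = (1 + y) powr (- real (Suc k))"
      using y \<beta> norm_powr_real_powr[of "1 + z" "\<beta> - of_nat (Suc k)"] by simp
    also have "\<dots> = (1 / (1 + y)) ^ Suc k"
      using y by (simp only: powr_minus powr_realpow power_one_over inverse_eq_divide)
    also have "\<dots> \<le> 2 ^ Suc k"
      using y by (intro power_mono) (auto simp: field_simps)
    finally show "norm (f (Suc k) z) \<le> norm (\<Prod>j<Suc k. \<beta> - of_nat j) * 2 ^ Suc k"
      unfolding f_def norm_mult by (intro mult_left_mono) auto
  qed
  then show ?thesis by (simp add: f_def)
qed

lemma iexp_ln_eq_powr:
  assumes "0 < x" shows "iexp (t * ln x) = of_real x powr (\<i> * of_real t)"
  using assms by (simp add: powr_def Ln_of_real mult_ac)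

context standardized_law
begin

text \<open>The linear term of the expansion has mean zero, so the quadratic one governs. Writing
  iexp (t ln x) as a complex power of x makes both remainders polynomial in y^2 - 1.\<close>

lemma char_increment_limit:
  fixes a :: "nat \<Rightarrow> real"
  assumes a: "\<And>k. 0 < a k" "\<And>k. a k \<le> 1 / 2" and a0: "a \<longlonglongrightarrow> 0"
  shows "(\<lambda>k. ((CLINT y|D. iexp (t * ln (1 + a k * (y\<^sup>2 - 1)))) - 1) / (of_real (a k))\<^sup>2)
    \<longlonglongrightarrow> of_real v * (\<i> * of_real t * (\<i> * of_real t - 1) / 2)"
proof -
  define \<beta> where "\<beta> = \<i> * complex_of_real t"
  have Re\<beta>: "Re \<beta> = 0" by (simp add: \<beta>_def)
  define K2 where "K2 = norm (\<Prod>j<2. \<beta> - of_nat j) * 4"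
  define K3 where "K3 = norm (\<Prod>j<3. \<beta> - of_nat j) * 4"
  have low: "- 1 / 2 \<le> a k * (y\<^sup>2 - 1)" for k y
  proof -
    have "a k * (- 1) \<le> a k * (y\<^sup>2 - 1)" using a(1)[of k] by (intro mult_left_mono) auto
    then show ?thesis using a(2)[of k] by simp
  qed
  have pos: "0 < 1 + a k * (y\<^sup>2 - 1)" for k y using low[of k y] by simp
  have powr: "iexp (t * ln (1 + a k * (y\<^sup>2 - 1))) = of_real (1 + a k * (y\<^sup>2 - 1)) powr \<beta>" for k y
    unfolding \<beta>_def by (rule iexp_ln_eq_powr) (rule pos)
  define h where "h k y = (iexp (t * ln (1 + a k * (y\<^sup>2 - 1))) - 1 - \<beta> * of_real (a k * (y\<^sup>2 - 1))) / (of_real (a k))\<^sup>2" for k y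
  have bound: "norm (h k y) \<le> K2 * (y\<^sup>2 - 1)\<^sup>2" for k y
  proof -
    have "norm (iexp (t * ln (1 + a k * (y\<^sup>2 - 1))) - 1 - \<beta> * of_real (a k * (y\<^sup>2 - 1))) \<le> K2 * (a k * (y\<^sup>2 - 1))\<^sup>2"
      unfolding powr using one_plus_powr_taylor[OF low Re\<beta>, of k y 1]
      by (simp add: K2_def numeral_2_eq_2 algebra_simps)
    moreover have "norm (A / (of_real (a k))\<^sup>2) \<le> K2 * (y\<^sup>2 - 1)\<^sup>2" if "norm A \<le> K2 * (a k * (y\<^sup>2 - 1))\<^sup>2" for A :: complex
    proof -
      have "norm (A / (of_real (a k))\<^sup>2) \<le> K2 * (a k * (y\<^sup>2 - 1))\<^sup>2 / (a k)\<^sup>2"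
        using that by (simp add: norm_divide norm_power divide_right_mono)
      also have "\<dots> = K2 * (y\<^sup>2 - 1)\<^sup>2" using a(1)[of k] by (simp add: power_mult_distrib)
      finally show ?thesis .
    qed
    ultimately show ?thesis unfolding h_def by blast
  qed
  \<comment> \<open>The cubic remainder serves only for the pointwise limit, since the third
    absolute moment of y^2 - 1 may be infinite; the dominating function comes from the quadratic
    remainder above.\<close>
  have lim: "(\<lambda>k. h k y) \<longlonglongrightarrow> \<beta> * (\<beta> - 1) / 2 * of_real ((y\<^sup>2 - 1)\<^sup>2)" for y
  proof (rule Lim_transform_bound[where g = "\<lambda>k. a k * (K3 * \<bar>y\<^sup>2 - 1\<bar>^3)", THEN LIM_zero_cancel])
    show "\<forall>\<^sub>F k in sequentially. norm (h k y - \<beta> * (\<beta> - 1) / 2 * of_real ((y\<^sup>2 - 1)\<^sup>2)) \<le> norm (a k * (K3 * \<bar>y\<^sup>2 - 1\<bar>^3))"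
    proof (rule always_eventually, rule allI)
      fix k
      let ?x = "a k * (y\<^sup>2 - 1)"
      have ak: "a k \<noteq> 0" using a(1)[of k] by simp
      have eq: "h k y - \<beta> * (\<beta> - 1) / 2 * of_real ((y\<^sup>2 - 1)\<^sup>2)
          = (of_real (1 + ?x) powr \<beta> - (1 + \<beta> * of_real ?x + \<beta> * (\<beta> - 1) * (of_real ?x)\<^sup>2 / 2)) / (of_real (a k))\<^sup>2"
        unfolding h_def powr using ak by (simp add: field_simps power2_eq_square)
      have "norm (of_real (1 + ?x) powr \<beta> - (1 + \<beta> * of_real ?x + \<beta> * (\<beta> - 1) * (of_real ?x)\<^sup>2 / 2)) \<le> K3 * \<bar>?x\<bar>^3"
        using one_plus_powr_taylor[OF low Re\<beta>, of k y 2]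
        by (simp add: K3_def numeral_2_eq_2 numeral_3_eq_3 algebra_simps)
      then have "norm (h k y - \<beta> * (\<beta> - 1) / 2 * of_real ((y\<^sup>2 - 1)\<^sup>2)) \<le> K3 * \<bar>?x\<bar>^3 / (a k)\<^sup>2"
        unfolding eq norm_divide norm_power by (simp add: divide_right_mono)
      also have "\<dots> = a k * (K3 * \<bar>y\<^sup>2 - 1\<bar>^3)"
        using a(1)[of k] by (simp add: abs_mult power_mult_distrib power2_eq_square power3_eq_cube)
      finally show "norm (h k y - \<beta> * (\<beta> - 1) / 2 * of_real ((y\<^sup>2 - 1)\<^sup>2)) \<le> norm (a k * (K3 * \<bar>y\<^sup>2 - 1\<bar>^3))"
        by simp
    qed
    show "(\<lambda>k. a k * (K3 * \<bar>y\<^sup>2 - 1\<bar>^3)) \<longlonglongrightarrow> 0"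
      using tendsto_mult_left_zero[OF a0] by simp
  qed
  have L1: "(\<lambda>k. CLINT y|D. h k y) \<longlonglongrightarrow> (CLINT y|D. \<beta> * (\<beta> - 1) / 2 * of_real ((y\<^sup>2 - 1)\<^sup>2))"
  proof (rule integral_dominated_convergence[where w = "\<lambda>y. K2 * (y\<^sup>2 - 1)\<^sup>2"])
    show "integrable D (\<lambda>y. K2 * (y\<^sup>2 - 1)\<^sup>2)" using integrable_square_centered by simp
    show "(\<lambda>y. h k y) \<in> borel_measurable D" for k unfolding h_def by measurable
  qed (use bound lim in auto)
  have L2: "(CLINT y|D. \<beta> * (\<beta> - 1) / 2 * of_real ((y\<^sup>2 - 1)\<^sup>2)) = of_real v * (\<beta> * (\<beta> - 1) / 2)"
  proof -
    have "(CLINT y|D. \<beta> * (\<beta> - 1) / 2 * of_real ((y\<^sup>2 - 1)\<^sup>2)) = \<beta> * (\<beta> - 1) / 2 * (CLINT y|D. of_real ((y\<^sup>2 - 1)\<^sup>2))"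
      by (rule integral_mult_right_zero)
    also have "(CLINT y|D. complex_of_real ((y\<^sup>2 - 1)\<^sup>2)) = of_real v"
      by (simp only: integral_complex_of_real integral_square_centered(2))
    finally show ?thesis by (simp add: mult.commute)
  qed
  have L3: "(CLINT y|D. h k y) = ((CLINT y|D. iexp (t * ln (1 + a k * (y\<^sup>2 - 1)))) - 1) / (of_real (a k))\<^sup>2" for k
  proof -
    have i1: "integrable D (\<lambda>y. iexp (t * ln (1 + a k * (y\<^sup>2 - 1))))"
      by (intro D.integrable_const_bound[where B = 1]) auto
    have i2: "integrable D (\<lambda>y. complex_of_real (a k * (y\<^sup>2 - 1)))"
      using integrable_square_centered(1) by (intro integrable_of_real integrable_mult_right) auto
    have z: "(CLINT y|D. complex_of_real (a k * (y\<^sup>2 - 1))) = 0"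
      by (simp only: integral_complex_of_real integral_mult_right_zero integral_square_centered(1)) simp
    have "(CLINT y|D. iexp (t * ln (1 + a k * (y\<^sup>2 - 1))) - 1 - \<beta> * of_real (a k * (y\<^sup>2 - 1)))
        = (CLINT y|D. iexp (t * ln (1 + a k * (y\<^sup>2 - 1)))) - 1 - \<beta> * (CLINT y|D. complex_of_real (a k * (y\<^sup>2 - 1)))"
      using i1 i2 by (simp only: Bochner_Integration.integral_diff Bochner_Integration.integrable_diff
          integrable_mult_right integral_mult_right_zero D.integrable_const) (simp add: D.prob_space)
    then show ?thesis unfolding h_def z by (simp only: integral_divide_zero) simp
  qed
  show ?thesis using L1[unfolded L2] unfolding L3 by (simp only: \<beta>_def)
qed

lemma char_log_square_product:
  assumes n: "1 \<le> n" and a: "real d / real n \<le> 1 / 2"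
  shows "char (distr (PiM {1..n} (\<lambda>_. D)) borel (\<lambda>y. ln (square_product n d y))) t
    = (CLINT y|D. iexp (t * ln (1 + real d / real n * (y\<^sup>2 - 1)))) ^ n"
proof -
  let ?a = "real d / real n" and ?Y = "PiM {1..n} (\<lambda>_. D)"
  have pos: "0 < 1 + ?a * (y\<^sup>2 - 1)" for y
  proof -
    have "?a * (- 1) \<le> ?a * (y\<^sup>2 - 1)" by (intro mult_left_mono) auto
    then show ?thesis using a by simp
  qed
  have meas: "(\<lambda>y. ln (square_product n d y)) \<in> borel_measurable ?Y"
    unfolding square_product_def by measurable
  have "char (distr ?Y borel (\<lambda>y. ln (square_product n d y))) t = (CLINT y|?Y. iexp (t * ln (square_product n d y)))"
    unfolding char_def using meas by (subst integral_distr) auto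
  also have "\<dots> = (CLINT y|?Y. (\<Prod>i\<in>{1..n}. iexp (t * ln (1 + ?a * ((y i)\<^sup>2 - 1)))))"
  proof (intro Bochner_Integration.integral_cong refl)
    fix y
    have "ln (square_product n d y) = (\<Sum>i\<in>{1..n}. ln (1 + ?a * ((y i)\<^sup>2 - 1)))"
      unfolding square_product_def by (rule ln_prod) (simp, rule less_imp_neq[OF pos, symmetric])
    then show "iexp (t * ln (square_product n d y)) = (\<Prod>i\<in>{1..n}. iexp (t * ln (1 + ?a * ((y i)\<^sup>2 - 1))))"
      by (simp add: exp_sum[symmetric] sum_distrib_left)
  qed
  also have "\<dots> = (\<Prod>i\<in>{1..n}. CLINT y|D. iexp (t * ln (1 + ?a * (y\<^sup>2 - 1))))"
    by (intro PD.product_integral_prod[where f = "\<lambda>i y. iexp (t * ln (1 + ?a * (y\<^sup>2 - 1)))"])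
      (auto intro!: D.integrable_const_bound[where B = 1])
  finally show ?thesis by simp
qed

end

lemma char_scaled_normal:
  assumes Q: "prob_space Q" and Z: "distributed Q lborel Z std_normal_density"
  shows "char (distr Q borel (\<lambda>\<omega>. \<sigma> * Z \<omega> - \<mu>)) t = exp (- \<i> * of_real (t * \<mu>) - of_real ((t * \<sigma>)\<^sup>2 / 2))"
proof -
  interpret prob_space Q by fact
  have mZ[measurable]: "Z \<in> borel_measurable Q" using distributed_measurable[OF Z] by simp
  have dZ: "distr Q borel Z = std_normal_distribution"
    using distributed_distr_eq_density[OF Z] by (simp cong: distr_cong)
  have "char (distr Q borel (\<lambda>\<omega>. \<sigma> * Z \<omega> - \<mu>)) t = (CLINT \<omega>|Q. iexp (t * (\<sigma> * Z \<omega> - \<mu>)))"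
    unfolding char_def by (subst integral_distr) auto
  also have "\<dots> = (CLINT \<omega>|Q. exp (- \<i> * of_real (t * \<mu>)) * iexp ((t * \<sigma>) * Z \<omega>))"
    by (intro Bochner_Integration.integral_cong refl) (simp add: exp_add[symmetric] algebra_simps)
  also have "\<dots> = exp (- \<i> * of_real (t * \<mu>)) * (CLINT \<omega>|Q. iexp ((t * \<sigma>) * Z \<omega>))"
    by (rule integral_mult_right_zero)
  also have "(CLINT \<omega>|Q. iexp ((t * \<sigma>) * Z \<omega>)) = char (distr Q borel Z) (t * \<sigma>)"
    unfolding char_def by (subst integral_distr) auto
  also have "\<dots> = of_real (exp (- (t * \<sigma>)\<^sup>2 / 2))"
    unfolding dZ by (simp add: char_std_normal_distribution)
  finally show ?thesis by (simp add: exp_of_real[symmetric] exp_add[symmetric] del: exp_of_real)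
qed

lemma tendsto_ratio_zero:
  fixes d :: "nat \<Rightarrow> nat"
  assumes "(\<lambda>n. (real (d n))\<^sup>2 / real n) \<longlonglongrightarrow> lam"
  shows "(\<lambda>n. real (d n) / real n) \<longlonglongrightarrow> 0"
proof -
  have "(\<lambda>n. sqrt ((real (d n))\<^sup>2 / real n * (1 / real n))) \<longlonglongrightarrow> sqrt (lam * 0)"
    by (intro tendsto_real_sqrt tendsto_mult assms lim_1_over_n)
  moreover have "sqrt ((real (d n))\<^sup>2 / real n * (1 / real n)) = real (d n) / real n" for n
    by (simp add: real_sqrt_divide real_sqrt_mult)
  ultimately show ?thesis by simp
qed

context standardized_law
begin

text \<open>A central limit theorem done directly with characteristic functions. With a = d / n one
  has n a^2 = d^2 / n, so n (\<phi>_n - 1) tends to \<zeta> = \<lambda> v (i t) (i t - 1) / 2, the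
  logarithm of the characteristic function of a normal variable with variance \<lambda> v and mean -
  \<lambda> v / 2.\<close>

lemma log_square_product_weak_conv:
  fixes d :: "nat \<Rightarrow> nat"
  assumes d: "\<And>n. 1 \<le> n \<Longrightarrow> 1 \<le> d n" and lam: "(\<lambda>n. (real (d n))\<^sup>2 / real n) \<longlonglongrightarrow> lam" "0 \<le> lam"
    and Q: "prob_space Q" and Z: "distributed Q lborel Z std_normal_density"
  shows "weak_conv_m (\<lambda>n. distr (PiM {1..n} (\<lambda>_. D)) borel (\<lambda>y. ln (square_product n (d n) y)))
    (distr Q borel (\<lambda>\<omega>. sqrt (lam * v) * Z \<omega> - lam * v / 2))"
proof (rule levy_continuity)
  have mZ[measurable]: "Z \<in> borel_measurable Q" using distributed_measurable[OF Z] by simp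
  show "real_distribution (distr Q borel (\<lambda>\<omega>. sqrt (lam * v) * Z \<omega> - lam * v / 2))"
    by (intro prob_space.real_distribution_distr Q) measurable
  show "real_distribution (distr (PiM {1..n} (\<lambda>_. D)) borel (\<lambda>y. ln (square_product n (d n) y)))" for n
    by (intro prob_space.real_distribution_distr prob_space_PiM prob) (simp add: square_product_def)
  fix t :: real
  define \<zeta> where "\<zeta> = complex_of_real (lam * v) * (\<i> * of_real t * (\<i> * of_real t - 1) / 2)"
  have Re\<zeta>: "Re \<zeta> \<le> 0" using lam(2) v_nonneg by (simp add: \<zeta>_def power2_eq_square[symmetric])
  have char_lim: "char (distr Q borel (\<lambda>\<omega>. sqrt (lam * v) * Z \<omega> - lam * v / 2)) t = exp \<zeta>"
  proof -
    have "(t * sqrt (lam * v))\<^sup>2 = t\<^sup>2 * (lam * v)" using lam(2) v_nonneg by (simp add: power_mult_distrib)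
    then show ?thesis
      unfolding char_scaled_normal[OF Q Z] \<zeta>_def
      by (intro arg_cong[where f = exp]) (simp add: complex_eq_iff power2_eq_square)
  qed
  let ?a = "\<lambda>n. real (d n) / real n"
  have "\<forall>\<^sub>F n in sequentially. ?a n < 1 / 2"
    by (rule order_tendstoD(2)[OF tendsto_ratio_zero[OF lam(1)]]) simp
  then obtain n0 where n0: "\<And>n. n0 \<le> n \<Longrightarrow> ?a n < 1 / 2" by (auto simp: eventually_sequentially)
  \<comment> \<open>Starting past \<open>n0\<close> and past 0 makes the ratio at most 1 / 2 and the
    index positive for every k; the shift is undone at the end.\<close>
  define m where "m k = k + Suc n0" for k
  have mk: "1 \<le> m k" "n0 \<le> m k" for k by (auto simp: m_def)
  let ?\<phi> = "\<lambda>n. CLINT y|D. iexp (t * ln (1 + ?a n * (y\<^sup>2 - 1)))"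
  have a_pos: "0 < ?a (m k)" for k using d[OF mk(1)[of k]] mk(1)[of k] by simp
  have a_le: "?a (m k) \<le> 1 / 2" for k using n0[OF mk(2)[of k]] by simp
  have shift: "(\<lambda>k. f (m k)) \<longlonglongrightarrow> L" if "f \<longlonglongrightarrow> L" for f :: "nat \<Rightarrow> 'z::topological_space" and L
    unfolding m_def by (rule LIMSEQ_ignore_initial_segment) (rule that)
  have "(\<lambda>k. of_real ((real (d (m k)))\<^sup>2 / real (m k)) * ((?\<phi> (m k) - 1) / (of_real (?a (m k)))\<^sup>2))
      \<longlonglongrightarrow> of_real lam * (of_real v * (\<i> * of_real t * (\<i> * of_real t - 1) / 2))"
    by (intro tendsto_mult tendsto_of_real shift[OF lam(1)] char_increment_limit a_pos a_le shift[OF tendsto_ratio_zero[OF lam(1)]])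
  moreover have "complex_of_real ((real (d (m k)))\<^sup>2 / real (m k)) * ((?\<phi> (m k) - 1) / (of_real (?a (m k)))\<^sup>2) = of_nat (m k) * (?\<phi> (m k) - 1)" for k
  proof -
    have "complex_of_real ((real (d (m k)))\<^sup>2 / real (m k)) = of_nat (m k) * (of_real (?a (m k)))\<^sup>2"
      using mk(1)[of k] by (simp add: power2_eq_square)
    moreover have "complex_of_real (?a (m k)) \<noteq> 0"
      using a_pos[of k] by (metis less_irrefl of_real_eq_0_iff)
    moreover have "(M * A\<^sup>2) * (w / A\<^sup>2) = M * w" if "A \<noteq> 0" for M A w :: complex using that by simp
    ultimately show ?thesis by metis
  qed
  ultimately have lim1: "(\<lambda>k. of_nat (m k) * (?\<phi> (m k) - 1)) \<longlonglongrightarrow> \<zeta>" by (simp add: \<zeta>_def mult_ac)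
  have lim2: "(\<lambda>k. of_nat (m k) * (exp (\<zeta> / of_nat (m k)) - 1)) \<longlonglongrightarrow> \<zeta>"
  proof -
    have "((\<lambda>z::complex. exp (\<zeta> * z)) has_field_derivative \<zeta>) (at 0)"
      by (auto intro!: derivative_eq_intros)
    then have "((\<lambda>z. (exp (\<zeta> * z) - 1) / z) \<longlongrightarrow> \<zeta>) (at 0)"
      by (simp add: has_field_derivative_def has_derivative_at2 DERIV_def flip: has_field_derivative_def)
    moreover have "filterlim (\<lambda>k. 1 / of_nat (m k) :: complex) (at 0) sequentially"
    proof (rule filterlim_atI)
      show "(\<lambda>k. 1 / of_nat (m k) :: complex) \<longlonglongrightarrow> 0" by (rule shift[OF lim_1_over_n])
      show "\<forall>\<^sub>F k in sequentially. 1 / of_nat (m k) \<noteq> (0::complex)"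
      proof (intro always_eventually allI)
        fix k show "1 / of_nat (m k) \<noteq> (0::complex)" using mk(1)[of k] by simp
      qed
    qed
    ultimately have "(\<lambda>k. (exp (\<zeta> * (1 / of_nat (m k))) - 1) / (1 / of_nat (m k))) \<longlonglongrightarrow> \<zeta>"
      by (rule filterlim_compose)
    then show ?thesis by (simp add: mult.commute)
  qed
  \<comment> \<open>Powers of two numbers of modulus at most 1 differ by at most the exponent times
    the difference of the bases; the bases here are \<phi>_n and exp (\<zeta> / n), which agree up
    to o(1 / n).\<close>
  have close: "(\<lambda>k. ?\<phi> (m k) ^ m k - exp \<zeta>) \<longlonglongrightarrow> 0"
  proof (rule Lim_null_comparison)
    show "\<forall>\<^sub>F k in sequentially. norm (?\<phi> (m k) ^ m k - exp \<zeta>)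
      \<le> norm (of_nat (m k) * (?\<phi> (m k) - 1) - of_nat (m k) * (exp (\<zeta> / of_nat (m k)) - 1))"
    proof (rule always_eventually, rule allI)
      fix k
      have "norm (?\<phi> (m k)) \<le> 1"
      proof -
        have "norm (?\<phi> (m k)) \<le> (LINT y|D. norm (iexp (t * ln (1 + ?a (m k) * (y\<^sup>2 - 1)))))"
          by (rule integral_norm_bound)
        then show ?thesis by (simp add: D.prob_space)
      qed
      moreover have "norm (exp (\<zeta> / of_nat (m k))) \<le> 1"
        using Re\<zeta> by (simp add: Re_divide_of_nat divide_nonpos_nonneg)
      ultimately have "norm (?\<phi> (m k) ^ m k - exp (\<zeta> / of_nat (m k)) ^ m k) \<le> m k * norm (?\<phi> (m k) - exp (\<zeta> / of_nat (m k)))"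
        by (intro norm_power_diff) auto
      also have "exp (\<zeta> / of_nat (m k)) ^ m k = exp \<zeta>"
        using mk(1)[of k] by (simp add: exp_of_nat_mult[symmetric])
      also have "m k * norm (?\<phi> (m k) - exp (\<zeta> / of_nat (m k)))
          = norm (of_nat (m k) * (?\<phi> (m k) - 1) - of_nat (m k) * (exp (\<zeta> / of_nat (m k)) - 1))"
        unfolding right_diff_distrib[symmetric] norm_mult by simp
      finally show "norm (?\<phi> (m k) ^ m k - exp \<zeta>)
        \<le> norm (of_nat (m k) * (?\<phi> (m k) - 1) - of_nat (m k) * (exp (\<zeta> / of_nat (m k)) - 1))" .
    qed
    show "(\<lambda>k. norm (of_nat (m k) * (?\<phi> (m k) - 1) - of_nat (m k) * (exp (\<zeta> / of_nat (m k)) - 1))) \<longlonglongrightarrow> 0"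
      using tendsto_norm_zero[OF tendsto_diff[OF lim1 lim2, simplified]] by simp
  qed
  have "(\<lambda>k. ?\<phi> (m k) ^ m k) \<longlonglongrightarrow> exp \<zeta>"
    using close by (rule LIM_zero_cancel)
  moreover have "char (distr (PiM {1..m k} (\<lambda>_. D)) borel (\<lambda>y. ln (square_product (m k) (d (m k)) y))) t = ?\<phi> (m k) ^ m k" for k
    by (rule char_log_square_product[OF mk(1) a_le])
  ultimately have "(\<lambda>k. char (distr (PiM {1..k + Suc n0} (\<lambda>_. D)) borel (\<lambda>y. ln (square_product (k + Suc n0) (d (k + Suc n0)) y))) t) \<longlonglongrightarrow> exp \<zeta>"
    by (simp add: m_def)
  from LIMSEQ_offset[OF this]
  show "(\<lambda>n. char (distr (PiM {1..n} (\<lambda>_. D)) borel (\<lambda>y. ln (square_product n (d n) y))) t)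
    \<longlonglongrightarrow> char (distr Q borel (\<lambda>\<omega>. sqrt (lam * v) * Z \<omega> - lam * v / 2)) t"
    unfolding char_lim .
qed

end

section \<open>The self-consistent equation\<close>

lemma (in prob_space) expectation_abs_le_sqrt:
  fixes X :: "'a \<Rightarrow> real"
  assumes X: "X \<in> borel_measurable M" and X2: "integrable M (\<lambda>x. (X x)\<^sup>2)" and b: "expectation (\<lambda>x. (X x)\<^sup>2) \<le> b"
  shows "integrable M X" and "expectation (\<lambda>x. \<bar>X x\<bar>) \<le> sqrt b"
proof -
  show int: "integrable M X"
  proof (rule Bochner_Integration.integrable_bound[of M "\<lambda>x. 1 + (X x)\<^sup>2"])
    show "AE x in M. norm (X x) \<le> norm (1 + (X x)\<^sup>2)"
    proof (intro AE_I2)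
      fix x
      have "0 \<le> (\<bar>X x\<bar> - 1)\<^sup>2" by simp
      then have "2 * \<bar>X x\<bar> \<le> 1 + (X x)\<^sup>2" by (simp add: power2_eq_square algebra_simps)
      then show "norm (X x) \<le> norm (1 + (X x)\<^sup>2)" by simp
    qed
  qed (use X X2 in auto)
  define m where "m = expectation (\<lambda>x. \<bar>X x\<bar>)"
  have "0 \<le> expectation (\<lambda>x. (\<bar>X x\<bar> - m)\<^sup>2)" by simp
  also have "\<dots> = expectation (\<lambda>x. (X x)\<^sup>2 - 2 * m * \<bar>X x\<bar> + m\<^sup>2)"
    by (intro Bochner_Integration.integral_cong refl) (simp add: power2_eq_square algebra_simps)
  also have "\<dots> = expectation (\<lambda>x. (X x)\<^sup>2) - 2 * m * m + m\<^sup>2"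
    using int X2 by (simp add: prob_space m_def)
  finally have "m\<^sup>2 \<le> b" using b by (simp add: power2_eq_square)
  then show "expectation (\<lambda>x. \<bar>X x\<bar>) \<le> sqrt b" unfolding m_def[symmetric] by (rule real_le_rsqrt)
qed

lemma saturate_one_plus_lipschitz:
  fixes x y \<tau> :: real
  assumes "0 \<le> x" "0 \<le> y" "0 \<le> \<tau>"
  shows "\<bar>x / (1 + \<tau> * x) - y / (1 + \<tau> * y)\<bar> \<le> \<bar>x - y\<bar>"
proof -
  have p: "1 \<le> 1 + \<tau> * x" "1 \<le> 1 + \<tau> * y" using assms by auto
  have "x / (1 + \<tau> * x) - y / (1 + \<tau> * y) = (x - y) / ((1 + \<tau> * x) * (1 + \<tau> * y))"
    using p by (simp add: field_simps)
  moreover have "1 \<le> (1 + \<tau> * x) * (1 + \<tau> * y)" using mult_mono[OF p] p by simp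
  ultimately have "\<bar>x / (1 + \<tau> * x) - y / (1 + \<tau> * y)\<bar> = \<bar>x - y\<bar> / ((1 + \<tau> * x) * (1 + \<tau> * y))"
    by simp
  also have "\<dots> \<le> \<bar>x - y\<bar> / 1"
    using \<open>1 \<le> (1 + \<tau> * x) * (1 + \<tau> * y)\<close> by (intro divide_left_mono) auto
  finally show ?thesis by simp
qed

text \<open>The properties of the tensor that the resolvent argument consumes: trace-free forms are
  small in mean at rate \<kappa>, while the square norm is prescribed only in mean, so that its
  fluctuations may survive in the limit.\<close>

locale isotropic_sample =
  fixes L :: "('i \<Rightarrow> real) measure" and A :: "'i set" and J :: "nat set" and \<kappa> :: real and N :: nat and u :: real
  assumes finA: "finite A" and neA: "A \<noteq> {}" and probL: "prob_space L"
    and setsL: "sets L = sets (PiM A (\<lambda>_. borel))"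
    and finJ [simp]: "finite J" and cardJ: "card J = N" and N: "1 \<le> N" and u: "0 < u" and \<kappa>: "0 \<le> \<kappa>"
    and int_sq: "integrable L (\<lambda>y. \<Sum>i\<in>A. (y i)\<^sup>2)" and norm_sq: "(LINT y|L. (\<Sum>i\<in>A. (y i)\<^sup>2)) = real (card A)"
    and quad_int: "\<And>B. ktrace A B = 0 \<Longrightarrow> integrable L (\<lambda>y. \<Sum>i\<in>A. \<Sum>j\<in>A. B i j * (y i * y j))"
    and quad: "\<And>B. ktrace A B = 0 \<Longrightarrow> (LINT y|L. \<bar>\<Sum>i\<in>A. \<Sum>j\<in>A. B i j * (y i * y j)\<bar>)
        \<le> \<kappa> * sqrt (real (card A) * (\<Sum>i\<in>A. \<Sum>j\<in>A. (B i j)\<^sup>2))"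
begin

sublocale L: prob_space L by (rule probL)

sublocale PL: product_prob_space "\<lambda>_::nat. L" by unfold_locales

definition trace_mean :: "nat set \<Rightarrow> (nat \<Rightarrow> 'i \<Rightarrow> real) \<Rightarrow> real" where
  "trace_mean B x = ktrace A (resolvent u N A B x) / card A"

definition mean_trace :: real where
  "mean_trace = (LINT x|PiM J (\<lambda>_. L). trace_mean J x)"

lemma cardA: "0 < real (card A)" using finA neA by (simp add: card_gt_0_iff)

lemma Npos: "0 < real N" using N by simp

lemma comp_measurable [measurable]: "i \<in> A \<Longrightarrow> (\<lambda>y. y i) \<in> borel_measurable L"
  by (subst measurable_cong_sets[OF setsL refl]) (rule measurable_component_singleton)

lemma sample_measurable:
  assumes "\<alpha> \<in> B" "i \<in> A" shows "(\<lambda>x. x \<alpha> i) \<in> borel_measurable (PiM B (\<lambda>_. L))"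
proof (rule measurable_compose[of "\<lambda>x. x \<alpha>" _ L])
  show "(\<lambda>x. x \<alpha>) \<in> PiM B (\<lambda>_. L) \<rightarrow>\<^sub>M L" using assms by simp
qed (use assms in measurable)

lemma resolvent_meas:
  assumes "finite B" "B \<subseteq> C" "i \<in> A" "j \<in> A"
  shows "(\<lambda>x. resolvent u N A B x i j) \<in> borel_measurable (PiM C (\<lambda>_. L))"
  using assms by (intro resolvent_measurable[OF finA u Npos] sample_measurable) auto

lemma trace_mean_measurable:
  assumes "finite B" "B \<subseteq> C"
  shows "trace_mean B \<in> borel_measurable (PiM C (\<lambda>_. L))"
  unfolding trace_mean_def[abs_def] ktrace_def
  using resolvent_meas[OF assms] by (intro borel_measurable_divide borel_measurable_sum) auto

lemma trace_mean_bounds: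
  assumes "finite B" shows "0 \<le> trace_mean B x" "trace_mean B x \<le> 1 / u"
  using resolvent_trace_bounds[OF finA u Npos assms, of x] cardA u
  by (auto simp: trace_mean_def field_simps)

lemma prob_sample: "prob_space (PiM B (\<lambda>_. L))"
  by (rule prob_space_PiM) (rule probL)

lemma trace_mean_integrable:
  assumes "finite B" "B \<subseteq> C" shows "integrable (PiM C (\<lambda>_. L)) (trace_mean B)"
  using trace_mean_bounds[OF assms(1)] trace_mean_measurable[OF assms]
  by (intro finite_measure.integrable_const_bound[where B = "1 / u"] prob_space.finite_measure prob_sample) auto

lemma mean_trace_bounds: "0 \<le> mean_trace" "mean_trace \<le> 1 / u"
proof -
  interpret P: prob_space "PiM J (\<lambda>_. L)" by (rule prob_sample)
  show "0 \<le> mean_trace" unfolding mean_trace_def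
    by (intro integral_nonneg_AE AE_I2 trace_mean_bounds) simp
  have "mean_trace \<le> (LINT x|PiM J (\<lambda>_. L). 1 / u)"
    unfolding mean_trace_def
    by (intro integral_mono trace_mean_integrable trace_mean_bounds P.integrable_const) auto
  then show "mean_trace \<le> 1 / u" by (simp add: P.prob_space)
qed

lemma trace_mean_remove:
  assumes "finite B" "\<alpha> \<in> B"
  shows "\<bar>trace_mean (B - {\<alpha>}) x - trace_mean B x\<bar> \<le> 1 / (card A * u)"
proof -
  have B: "insert \<alpha> (B - {\<alpha>}) = B" using assms by auto
  have "ktrace A (resolvent u N A B x) \<le> ktrace A (resolvent u N A (B - {\<alpha>}) x)"
    and "ktrace A (resolvent u N A (B - {\<alpha>}) x) \<le> ktrace A (resolvent u N A B x) + 1 / u"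
    using resolvent_trace_insert[OF finA u Npos, of "B - {\<alpha>}" \<alpha> x] assms unfolding B by auto
  then have "\<bar>ktrace A (resolvent u N A (B - {\<alpha>}) x) - ktrace A (resolvent u N A B x)\<bar> \<le> 1 / u" by simp
  then have "\<bar>ktrace A (resolvent u N A (B - {\<alpha>}) x) - ktrace A (resolvent u N A B x)\<bar> / card A \<le> 1 / u / card A"
    using cardA by (intro divide_right_mono) auto
  then show ?thesis using cardA by (simp add: trace_mean_def diff_divide_distrib[symmetric] mult.commute)
qed

lemma trace_mean_update:
  assumes "finite B" "\<alpha> \<in> B"
  shows "\<bar>trace_mean B (x(\<alpha> := y)) - trace_mean B x\<bar> \<le> 1 / (card A * u)"
proof -
  have B: "insert \<alpha> (B - {\<alpha>}) = B" using assms by auto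
  have eq: "resolvent u N A (B - {\<alpha>}) (x(\<alpha> := y)) = resolvent u N A (B - {\<alpha>}) x"
    by (rule resolvent_cong) auto
  let ?t = "\<lambda>B x. ktrace A (resolvent u N A B x)"
  have "?t B (x(\<alpha> := y)) \<le> ?t (B - {\<alpha>}) x" "?t (B - {\<alpha>}) x \<le> ?t B (x(\<alpha> := y)) + 1 / u"
    using resolvent_trace_insert[OF finA u Npos, of "B - {\<alpha>}" \<alpha> "x(\<alpha> := y)"] assms unfolding B eq by auto
  moreover have "?t B x \<le> ?t (B - {\<alpha>}) x" "?t (B - {\<alpha>}) x \<le> ?t B x + 1 / u"
    using resolvent_trace_insert[OF finA u Npos, of "B - {\<alpha>}" \<alpha> x] assms unfolding B by auto
  ultimately have "\<bar>?t B (x(\<alpha> := y)) - ?t B x\<bar> \<le> 1 / u" by simp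
  then have "\<bar>?t B (x(\<alpha> := y)) - ?t B x\<bar> / card A \<le> 1 / u / card A"
    using cardA by (intro divide_right_mono) auto
  then show ?thesis using cardA by (simp add: trace_mean_def diff_divide_distrib[symmetric] mult.commute)
qed

text \<open>Differences of size 1 / (p u) over N samples put u^2 p^2 / N into the exponent, which
  grows like p when p / N converges.\<close>

lemma trace_mean_tail:
  assumes "0 < \<epsilon>"
  shows "Sigma_Algebra.measure (PiM J (\<lambda>_. L))
      {x \<in> space (PiM J (\<lambda>_. L)). \<epsilon> \<le> \<bar>trace_mean J x - mean_trace\<bar>}
    \<le> 2 * exp (- (\<epsilon>\<^sup>2 * u\<^sup>2 / 2 * (real (card A))\<^sup>2 / N))"
proof -
  have "Sigma_Algebra.measure (PiM J (\<lambda>_. L))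
      {x \<in> space (PiM J (\<lambda>_. L)). \<epsilon> \<le> \<bar>trace_mean J x - (LINT x|PiM J (\<lambda>_. L). trace_mean J x)\<bar>}
    \<le> 2 * exp (- (\<epsilon>\<^sup>2 / (2 * (1 / (card A * u))\<^sup>2 * card J)))"
  proof (rule bounded_differences_tail[OF probL _ _ assms, where C = "1 / u"])
    show "\<bar>trace_mean J x\<bar> \<le> 1 / u" for x using trace_mean_bounds[of "J" x] by simp
    show "trace_mean J \<in> borel_measurable (PiM J (\<lambda>_. L))" by (rule trace_mean_measurable) auto
    show "\<bar>trace_mean J (x(i := y)) - trace_mean J x\<bar> \<le> 1 / (card A * u)" if "i \<in> J" for x i y
      using that by (intro trace_mean_update) auto
  qed (use N u cardA cardJ in auto)
  also have "\<epsilon>\<^sup>2 / (2 * (1 / (card A * u))\<^sup>2 * card J) = \<epsilon>\<^sup>2 * u\<^sup>2 / 2 * (real (card A))\<^sup>2 / N"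
    using u cardA Npos by (simp add: field_simps cardJ)
  finally show ?thesis by (simp add: mean_trace_def)
qed

lemma trace_mean_L1:
  assumes "0 < \<epsilon>"
  shows "(LINT x|PiM J (\<lambda>_. L). \<bar>trace_mean J x - mean_trace\<bar>)
    \<le> \<epsilon> + 1 / u * (2 * exp (- (\<epsilon>\<^sup>2 * u\<^sup>2 / 2 * (real (card A))\<^sup>2 / N)))"
proof -
  let ?P = "PiM J (\<lambda>_. L)" and ?Y = "\<lambda>x. \<bar>trace_mean J x - mean_trace\<bar>"
  interpret P: prob_space ?P by (rule prob_sample)
  let ?E = "{x \<in> space ?P. \<epsilon> \<le> ?Y x}"
  have m[measurable]: "trace_mean J \<in> borel_measurable ?P" by (rule trace_mean_measurable) auto
  have bd: "?Y x \<le> 1 / u" for x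
    using trace_mean_bounds[of "J" x] mean_trace_bounds by (simp add: abs_le_iff)
  have iE: "integrable ?P (\<lambda>x. 1 / u * indicator ?E x)"
    by (intro integrable_mult_right integrable_real_indicator)
      (measurable, simp only: P.emeasure_eq_measure ennreal_less_top infinity_ennreal_def)
  have "(LINT x|?P. ?Y x) \<le> (LINT x|?P. \<epsilon> + 1 / u * indicator ?E x)"
  proof (intro integral_mono)
    show "integrable ?P ?Y" using trace_mean_integrable[of J J] by auto
    show "integrable ?P (\<lambda>x. \<epsilon> + 1 / u * indicator ?E x)" using iE by simp
    fix x assume "x \<in> space ?P"
    then show "?Y x \<le> \<epsilon> + 1 / u * indicator ?E x"
      using bd[of x] assms u by (cases "x \<in> ?E") auto
  qed
  also have "\<dots> = \<epsilon> + 1 / u * measure ?P ?E"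
    using iE by (subst Bochner_Integration.integral_add) (simp_all add: P.prob_space)
  also have "\<dots> \<le> \<epsilon> + 1 / u * (2 * exp (- (\<epsilon>\<^sup>2 * u\<^sup>2 / 2 * (real (card A))\<^sup>2 / N)))"
    using u by (intro add_left_mono mult_left_mono trace_mean_tail assms) auto
  finally show ?thesis .
qed

text \<open>Removing the mean of the diagonal projects orthogonally onto the trace-free matrices, so
  the Frobenius norm does not grow; the removed multiple of the identity contributes exactly a
  multiple of the square norm.\<close>

lemma quad_form_split:
  fixes G y
  defines "m \<equiv> ktrace A G / card A"
  defines "B \<equiv> \<lambda>i j. G i j - (if i = j then m else 0)"
  shows "ktrace A B = 0" and "quad_form A G y = (\<Sum>i\<in>A. \<Sum>j\<in>A. B i j * (y i * y j)) + m * (\<Sum>i\<in>A. (y i)\<^sup>2)"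
    and "(\<Sum>i\<in>A. \<Sum>j\<in>A. (B i j)\<^sup>2) \<le> (\<Sum>i\<in>A. \<Sum>j\<in>A. (G i j)\<^sup>2)"
proof -
  show "ktrace A B = 0"
    using cardA by (simp add: ktrace_def B_def sum_subtractf m_def)
  have row: "(\<Sum>j\<in>A. (if i = j then m else 0) * z j) = m * z i" if "i \<in> A" for i z
    by (rule sum_delta_times(1)[OF finA that])
  have "(\<Sum>i\<in>A. \<Sum>j\<in>A. B i j * (y i * y j)) = (\<Sum>i\<in>A. \<Sum>j\<in>A. G i j * (y i * y j)) - (\<Sum>i\<in>A. \<Sum>j\<in>A. (if i = j then m else 0) * (y i * y j))"
    by (simp add: B_def left_diff_distrib sum_subtractf)
  also have "(\<Sum>i\<in>A. \<Sum>j\<in>A. (if i = j then m else 0) * (y i * y j)) = (\<Sum>i\<in>A. m * (y i * y i))"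
    by (intro sum.cong refl row)
  finally show "quad_form A G y = (\<Sum>i\<in>A. \<Sum>j\<in>A. B i j * (y i * y j)) + m * (\<Sum>i\<in>A. (y i)\<^sup>2)"
    by (simp add: quad_form_def mat_app_def sum_distrib_left power2_eq_square mult_ac)
  have sq: "(B i j)\<^sup>2 = (G i j)\<^sup>2 - (if i = j then m else 0) * (2 * G i j - m)" for i j
    by (simp add: B_def power2_eq_square algebra_simps)
  have "(\<Sum>i\<in>A. \<Sum>j\<in>A. (B i j)\<^sup>2) = (\<Sum>i\<in>A. \<Sum>j\<in>A. (G i j)\<^sup>2) - (\<Sum>i\<in>A. \<Sum>j\<in>A. (if i = j then m else 0) * (2 * G i j - m))"
    by (simp add: sq sum_subtractf)
  also have "(\<Sum>i\<in>A. \<Sum>j\<in>A. (if i = j then m else 0) * (2 * G i j - m)) = (\<Sum>i\<in>A. m * (2 * G i i - m))"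
    by (intro sum.cong refl row)
  also have "\<dots> = m * (2 * ktrace A G - card A * m)"
    by (simp add: ktrace_def sum_distrib_left sum_subtractf right_diff_distrib mult_ac)
  also have "\<dots> = card A * m\<^sup>2"
  proof -
    have "ktrace A G = card A * m" using cardA by (simp add: m_def)
    then show ?thesis by (simp add: power2_eq_square algebra_simps)
  qed
  finally show "(\<Sum>i\<in>A. \<Sum>j\<in>A. (B i j)\<^sup>2) \<le> (\<Sum>i\<in>A. \<Sum>j\<in>A. (G i j)\<^sup>2)" by simp
qed

abbreviation saturate :: "real \<Rightarrow> real" where "saturate q \<equiv> q / (1 + q)"

lemma saturate_bounds: "0 \<le> q \<Longrightarrow> 0 \<le> saturate q" "0 \<le> q \<Longrightarrow> saturate q \<le> 1"
  by (auto simp: field_simps)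

lemma saturate_norm: "0 \<le> q \<Longrightarrow> norm (saturate q) \<le> 1"
  using saturate_bounds[of q] by (simp del: divide_le_eq_1)

text \<open>The function q / (1 + q) is 1-Lipschitz on the half-line, so closeness of the forms in
  mean is enough. One error is the trace-free part of the form, the other the replacement of the
  random trace by its expectation.\<close>

lemma leave_one_out_estimate:
  assumes "finite B"
  shows "\<bar>(LINT y|L. saturate (quad_form A (resolvent u N A B x) y / N)) - (LINT y|L. saturate (mean_trace * (\<Sum>i\<in>A. (y i)\<^sup>2) / N))\<bar>
    \<le> card A / N * (\<kappa> / u + \<bar>trace_mean B x - mean_trace\<bar>)"
proof -
  let ?G = "resolvent u N A B x"
  let ?m = "trace_mean B x" and ?s = "mean_trace" and ?T = "\<lambda>y::'i \<Rightarrow> real. \<Sum>i\<in>A. (y i)\<^sup>2"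
  define Bm where "Bm i j = ?G i j - (if i = j then ktrace A ?G / card A else 0)" for i j
  let ?q = "\<lambda>y. \<Sum>i\<in>A. \<Sum>j\<in>A. Bm i j * (y i * y j)"
  have tr: "ktrace A Bm = 0"
    and split: "\<And>y. quad_form A ?G y = ?q y + ?m * ?T y"
    and frob: "(\<Sum>i\<in>A. \<Sum>j\<in>A. (Bm i j)\<^sup>2) \<le> (\<Sum>i\<in>A. \<Sum>j\<in>A. (?G i j)\<^sup>2)"
    using quad_form_split[of ?G] unfolding Bm_def[abs_def] trace_mean_def by auto
  have Q0: "0 \<le> quad_form A ?G y" for y
    using resolvent_quad_form_nonneg[OF finA u Npos assms] .
  have T0: "0 \<le> ?T y" for y by (simp add: sum_nonneg)
  have mq[measurable]: "(\<lambda>y. quad_form A ?G y) \<in> borel_measurable L"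
    unfolding quad_form_def mat_app_def by measurable
  have mT[measurable]: "?T \<in> borel_measurable L" by measurable
  have i1: "integrable L (\<lambda>y. saturate (quad_form A ?G y / N))"
    using Q0 by (intro L.integrable_const_bound[where B = 1] AE_I2 saturate_norm) (simp, measurable)
  have i2: "integrable L (\<lambda>y. saturate (?s * ?T y / N))"
    using T0 mean_trace_bounds(1) by (intro L.integrable_const_bound[where B = 1] AE_I2 saturate_norm) (simp, measurable)
  have iq: "integrable L ?q" by (rule quad_int) (rule tr)
  have pt: "\<bar>saturate (quad_form A ?G y / N) - saturate (?s * ?T y / N)\<bar> \<le> \<bar>?q y\<bar> / N + \<bar>?m - ?s\<bar> * ?T y / N" for y
  proof -
    have "\<bar>saturate (quad_form A ?G y / N) - saturate (?s * ?T y / N)\<bar> \<le> \<bar>quad_form A ?G y / N - ?s * ?T y / N\<bar>"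
      using saturate_one_plus_lipschitz[of "quad_form A ?G y / N" "?s * ?T y / N" 1] Q0 T0 mean_trace_bounds Npos by simp
    also have "quad_form A ?G y / N - ?s * ?T y / N = (?q y + (?m - ?s) * ?T y) / N"
      by (simp only: split diff_divide_distrib[symmetric] left_diff_distrib add_diff_eq[symmetric])
    also have "\<bar>\<dots>\<bar> \<le> (\<bar>?q y\<bar> + \<bar>(?m - ?s) * ?T y\<bar>) / N"
      using Npos by (simp add: abs_triangle_ineq divide_right_mono)
    also have "\<dots> = \<bar>?q y\<bar> / N + \<bar>?m - ?s\<bar> * ?T y / N"
      using T0[of y] by (simp add: abs_mult add_divide_distrib)
    finally show ?thesis .
  qed
  have "\<bar>(LINT y|L. saturate (quad_form A ?G y / N)) - (LINT y|L. saturate (?s * ?T y / N))\<bar>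
      = \<bar>LINT y|L. saturate (quad_form A ?G y / N) - saturate (?s * ?T y / N)\<bar>"
    using i1 i2 by simp
  also have "\<dots> \<le> (LINT y|L. \<bar>saturate (quad_form A ?G y / N) - saturate (?s * ?T y / N)\<bar>)"
    by (rule integral_abs_bound)
  also have "\<dots> \<le> (LINT y|L. \<bar>?q y\<bar> / N + \<bar>?m - ?s\<bar> * ?T y / N)"
    using i1 i2 iq int_sq by (intro integral_mono pt) auto
  also have "\<dots> = (LINT y|L. \<bar>?q y\<bar>) / N + \<bar>?m - ?s\<bar> * card A / N"
    using iq int_sq norm_sq by simp
  also have "\<dots> \<le> (\<kappa> * (card A / u)) / N + \<bar>?m - ?s\<bar> * card A / N"
  proof (intro add_right_mono divide_right_mono)
    have "(LINT y|L. \<bar>?q y\<bar>) \<le> \<kappa> * sqrt (real (card A) * (\<Sum>i\<in>A. \<Sum>j\<in>A. (Bm i j)\<^sup>2))"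
      by (rule quad) (rule tr)
    also have "\<dots> \<le> \<kappa> * sqrt (real (card A) * (real (card A) / u\<^sup>2))"
      using frob resolvent_frobenius[OF finA u Npos assms, of x] \<kappa>
      by (intro mult_left_mono real_sqrt_le_mono) auto
    also have "real (card A) * (real (card A) / u\<^sup>2) = (card A / u)\<^sup>2" by (simp add: power2_eq_square)
    also have "sqrt ((card A / u)\<^sup>2) = card A / u" using u by simp
    finally show "(LINT y|L. \<bar>?q y\<bar>) \<le> \<kappa> * (card A / u)" .
  qed (use Npos in simp)
  also have "\<dots> = card A / N * (\<kappa> / u + \<bar>?m - ?s\<bar>)"
    by (simp add: distrib_left divide_inverse mult_ac)
  finally show ?thesis .
qed

text \<open>The expectation of the trace identity. A sample is independent of its leave-one-out
  resolvent, so the estimate for a fixed matrix applies conditionally on the other samples; the term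
  1 / (p u) pays for the omitted sample.\<close>

theorem self_consistent_estimate:
  "\<bar>1 - u * mean_trace - (LINT y|L. mean_trace * ((\<Sum>i\<in>A. (y i)\<^sup>2) / card A) / (1 + card A / N * (mean_trace * ((\<Sum>i\<in>A. (y i)\<^sup>2) / card A))))\<bar>
    \<le> \<kappa> / u + 1 / (card A * u) + (LINT x|PiM J (\<lambda>_. L). \<bar>trace_mean J x - mean_trace\<bar>)"
proof -
  let ?P = "PiM J (\<lambda>_. L)" and ?p = "real (card A)" and ?s = mean_trace
  interpret P: prob_space ?P by (rule prob_sample)
  define q where "q \<alpha> x = quad_form A (resolvent u N A (J - {\<alpha>}) x) (x \<alpha>) / N" for \<alpha> and x :: "nat \<Rightarrow> 'i \<Rightarrow> real"
  define c0 where "c0 = (LINT y|L. saturate (?s * (\<Sum>i\<in>A. (y i)\<^sup>2) / N))"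
  define dev where "dev = (LINT x|?P. \<bar>trace_mean J x - ?s\<bar>)"
  have q0: "0 \<le> q \<alpha> x" for \<alpha> x
    using resolvent_quad_form_nonneg[OF finA u Npos, of "J - {\<alpha>}" x "x \<alpha>"] Npos by (simp add: q_def)
  have qm: "q \<alpha> \<in> borel_measurable ?P" if "\<alpha> \<in> J" for \<alpha>
  proof -
    have [measurable]: "(\<lambda>x. resolvent u N A (J - {\<alpha>}) x i j) \<in> borel_measurable ?P" if "i \<in> A" "j \<in> A" for i j
      using that by (intro resolvent_meas) auto
    have [measurable]: "(\<lambda>x. x \<alpha> i) \<in> borel_measurable ?P" if "i \<in> A" for i
      using \<open>\<alpha> \<in> J\<close> that by (intro sample_measurable)
    show ?thesis unfolding q_def[abs_def] quad_form_def mat_app_def by measurable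
  qed
  have fi: "integrable ?P (\<lambda>x. saturate (q \<alpha> x))" if "\<alpha> \<in> J" for \<alpha>
    by (intro P.integrable_const_bound[where B = 1] AE_I2 saturate_norm q0
        borel_measurable_divide borel_measurable_add borel_measurable_const qm[OF that])
  have gen: "1 = u * (K / c) + S / c" if "c = u * K + S" "0 < c" for K S c :: real
  proof -
    have "u * (K / c) + S / c = (u * K + S) / c" by (simp add: add_divide_distrib)
    also have "\<dots> = 1" using that by simp
    finally show ?thesis by simp
  qed
  have iden: "1 = u * trace_mean J x + (\<Sum>\<alpha>\<in>J. saturate (q \<alpha> x)) / ?p" for x
    unfolding trace_mean_def q_def by (rule gen[OF resolvent_trace_identity[OF finA u Npos finJ] cardA])
  have "1 = (LINT x|?P. u * trace_mean J x + (\<Sum>\<alpha>\<in>J. saturate (q \<alpha> x)) / ?p)"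
    unfolding iden[symmetric] by (simp add: P.prob_space)
  also have "\<dots> = u * ?s + (\<Sum>\<alpha>\<in>J. LINT x|?P. saturate (q \<alpha> x)) / ?p"
    using fi trace_mean_integrable[of J J]
    by (simp add: mean_trace_def Bochner_Integration.integral_sum Bochner_Integration.integrable_sum)
  finally have int_iden: "1 - u * ?s = (\<Sum>\<alpha>\<in>J. LINT x|?P. saturate (q \<alpha> x)) / ?p" by simp
  have each: "\<bar>(LINT x|?P. saturate (q \<alpha> x)) - c0\<bar> \<le> ?p / N * (\<kappa> / u + (1 / (?p * u) + dev))" if \<alpha>: "\<alpha> \<in> J" for \<alpha>
  proof -
    let ?I = "J - {\<alpha>}"
    have ins: "insert \<alpha> ?I = J" using \<alpha> by auto
    interpret PI: prob_space "PiM ?I (\<lambda>_. L)" by (rule prob_sample)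
    have mI: "trace_mean ?I \<in> borel_measurable (PiM ?I (\<lambda>_. L))" "integrable (PiM ?I (\<lambda>_. L)) (trace_mean ?I)"
      by (intro trace_mean_measurable trace_mean_integrable; simp)+
    have upd: "resolvent u N A ?I (x(\<alpha> := y)) = resolvent u N A ?I x" for x y
      by (rule resolvent_cong) auto
    define \<Phi> where "\<Phi> x = (LINT y|L. saturate (quad_form A (resolvent u N A ?I x) y / N))" for x
    \<comment> \<open>Fubini: the sample \<alpha> is integrated first, the leave-one-out resolvent
      being a function of the remaining coordinates.\<close>
    have 1: "(LINT x|?P. saturate (q \<alpha> x)) = (LINT x|PiM ?I (\<lambda>_. L). \<Phi> x)"
      using PL.product_integral_insert[of ?I \<alpha> "\<lambda>x. saturate (q \<alpha> x)"] fi[OF \<alpha>] unfolding ins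
      by (simp add: q_def upd \<Phi>_def)
    have \<Phi>: "\<bar>\<Phi> x - c0\<bar> \<le> ?p / N * (\<kappa> / u + \<bar>trace_mean ?I x - ?s\<bar>)" for x
      unfolding \<Phi>_def c0_def by (rule leave_one_out_estimate) simp
    have \<Phi>m: "\<Phi> \<in> borel_measurable (PiM ?I (\<lambda>_. L))"
    proof -
      have m1: "(\<lambda>z. resolvent u N A ?I (fst z) i j) \<in> borel_measurable (PiM ?I (\<lambda>_. L) \<Otimes>\<^sub>M L)" if "i \<in> A" "j \<in> A" for i j
        by (rule measurable_compose[OF measurable_fst resolvent_meas]) (use that in auto)
      have m2: "(\<lambda>z. snd z i) \<in> borel_measurable (PiM ?I (\<lambda>_. L) \<Otimes>\<^sub>M L)" if "i \<in> A" for i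
        by (rule measurable_compose[OF measurable_snd comp_measurable]) (rule that)
      have "(\<lambda>z. saturate (quad_form A (resolvent u N A ?I (fst z)) (snd z) / N)) \<in> borel_measurable (PiM ?I (\<lambda>_. L) \<Otimes>\<^sub>M L)"
        unfolding quad_form_def mat_app_def using m1 m2
        by (intro borel_measurable_divide borel_measurable_add borel_measurable_const borel_measurable_sum borel_measurable_times) auto
      then show ?thesis unfolding \<Phi>_def[abs_def]
        by (intro L.borel_measurable_lebesgue_integral) (simp add: split_beta')
    qed
    have \<Phi>i: "integrable (PiM ?I (\<lambda>_. L)) \<Phi>"
    proof (rule PI.integrable_const_bound[where B = 1])
      have Q0: "0 \<le> quad_form A (resolvent u N A ?I x) y" for x y
        using resolvent_quad_form_nonneg[OF finA u Npos, of ?I] by simp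
      have mQ: "(\<lambda>y. saturate (quad_form A (resolvent u N A ?I x) y / N)) \<in> borel_measurable L" for x
        unfolding quad_form_def mat_app_def by measurable
      have "\<bar>\<Phi> x\<bar> \<le> 1" for x
      proof -
        have "\<bar>\<Phi> x\<bar> \<le> (LINT y|L. \<bar>saturate (quad_form A (resolvent u N A ?I x) y / N)\<bar>)"
          unfolding \<Phi>_def by (rule integral_abs_bound)
        also have "\<dots> \<le> (LINT y|L. 1)"
        proof (intro integral_mono)
          have "integrable L (\<lambda>y. saturate (quad_form A (resolvent u N A ?I x) y / N))"
            using Q0 by (intro L.integrable_const_bound[where B = 1] AE_I2 saturate_norm mQ) simp
          then show "integrable L (\<lambda>y. \<bar>saturate (quad_form A (resolvent u N A ?I x) y / N)\<bar>)" by (rule integrable_abs)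
          show "\<bar>saturate (quad_form A (resolvent u N A ?I x) y / N)\<bar> \<le> 1" for y
            using saturate_norm[of "quad_form A (resolvent u N A ?I x) y / N"] Q0[of x y] by simp
        qed simp
        finally show ?thesis by (simp add: L.prob_space)
      qed
      then show "AE x in PiM ?I (\<lambda>_. L). norm (\<Phi> x) \<le> 1" by simp
    qed (rule \<Phi>m)
    have 2: "(LINT x|PiM ?I (\<lambda>_. L). \<bar>trace_mean ?I x - ?s\<bar>) \<le> 1 / (?p * u) + dev"
    proof -
      have updt: "trace_mean ?I (x(\<alpha> := y)) = trace_mean ?I x" for x y by (simp add: trace_mean_def upd)
      have i: "integrable ?P (\<lambda>x. \<bar>trace_mean ?I x - ?s\<bar>)"
        using trace_mean_integrable[of ?I "J"] by auto
      have "(LINT x|?P. \<bar>trace_mean ?I x - ?s\<bar>) = (LINT x|PiM ?I (\<lambda>_. L). \<bar>trace_mean ?I x - ?s\<bar>)"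
        using PL.product_integral_insert[of ?I \<alpha> "\<lambda>x. \<bar>trace_mean ?I x - ?s\<bar>"] i unfolding ins
        by (simp add: updt L.prob_space)
      moreover have "(LINT x|?P. \<bar>trace_mean ?I x - ?s\<bar>) \<le> (LINT x|?P. 1 / (?p * u) + \<bar>trace_mean J x - ?s\<bar>)"
      proof (intro integral_mono i)
        show "integrable ?P (\<lambda>x. 1 / (?p * u) + \<bar>trace_mean J x - ?s\<bar>)"
          using trace_mean_integrable[of J J] by auto
        show "\<bar>trace_mean ?I x - ?s\<bar> \<le> 1 / (?p * u) + \<bar>trace_mean J x - ?s\<bar>" for x
          using trace_mean_remove[OF finJ \<alpha>, of x] by linarith
      qed
      moreover have "(LINT x|?P. 1 / (?p * u) + \<bar>trace_mean J x - ?s\<bar>) = 1 / (?p * u) + dev"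
        unfolding dev_def using trace_mean_integrable[of J J]
        by (subst Bochner_Integration.integral_add) (auto simp: P.prob_space)
      ultimately show ?thesis by simp
    qed
    have "\<bar>(LINT x|?P. saturate (q \<alpha> x)) - c0\<bar> = \<bar>LINT x|PiM ?I (\<lambda>_. L). \<Phi> x - c0\<bar>"
      unfolding 1 using \<Phi>i by (simp add: PI.prob_space)
    also have "\<dots> \<le> (LINT x|PiM ?I (\<lambda>_. L). \<bar>\<Phi> x - c0\<bar>)" by (rule integral_abs_bound)
    also have "\<dots> \<le> (LINT x|PiM ?I (\<lambda>_. L). ?p / N * (\<kappa> / u + \<bar>trace_mean ?I x - ?s\<bar>))"
      using \<Phi>i mI(2) by (intro integral_mono \<Phi>) auto
    also have "\<dots> = ?p / N * (\<kappa> / u + (LINT x|PiM ?I (\<lambda>_. L). \<bar>trace_mean ?I x - ?s\<bar>))"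
      using mI(2) by (subst integral_mult_right_zero, subst Bochner_Integration.integral_add) (auto simp: PI.prob_space)
    also have "\<dots> \<le> ?p / N * (\<kappa> / u + (1 / (?p * u) + dev))"
      using 2 by (intro mult_left_mono add_left_mono) auto
    finally show ?thesis .
  qed
  \<comment> \<open>Rescaling by N / p exposes the ratio p / N and the normalized square norm, the
    two quantities that have limits.\<close>
  have c0: "real N * c0 / ?p = (LINT y|L. ?s * ((\<Sum>i\<in>A. (y i)\<^sup>2) / ?p) / (1 + ?p / N * (?s * ((\<Sum>i\<in>A. (y i)\<^sup>2) / ?p))))"
  proof -
    have "?s * (t / ?p) / (1 + ?p / N * (?s * (t / ?p))) = (N / ?p) * saturate (?s * t / N)" for t
    proof -
      have "?p / N * (?s * (t / ?p)) = ?s * t / N" using cardA by simp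
      moreover have "(N / ?p) * ((?s * t / N) / c) = ?s * (t / ?p) / c" for c using Npos by simp
      ultimately show ?thesis by (simp only:)
    qed
    then have "(LINT y|L. ?s * ((\<Sum>i\<in>A. (y i)\<^sup>2) / ?p) / (1 + ?p / N * (?s * ((\<Sum>i\<in>A. (y i)\<^sup>2) / ?p))))
        = (LINT y|L. (N / ?p) * saturate (?s * (\<Sum>i\<in>A. (y i)\<^sup>2) / N))" by (simp only:)
    also have "\<dots> = (N / ?p) * c0" unfolding c0_def by (rule integral_mult_right_zero)
    finally show ?thesis by simp
  qed
  have "1 - u * ?s - real N * c0 / ?p = (\<Sum>\<alpha>\<in>J. (LINT x|?P. saturate (q \<alpha> x)) - c0) / ?p"
    unfolding int_iden by (simp add: sum_subtractf diff_divide_distrib cardJ)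
  also have "\<bar>\<dots>\<bar> \<le> (\<Sum>\<alpha>\<in>J. \<bar>(LINT x|?P. saturate (q \<alpha> x)) - c0\<bar>) / ?p"
    using cardA by (simp add: divide_right_mono sum_abs)
  also have "\<dots> \<le> (\<Sum>\<alpha>\<in>J. ?p / N * (\<kappa> / u + (1 / (?p * u) + dev))) / ?p"
    using cardA by (intro divide_right_mono sum_mono each) auto
  also have "\<dots> = \<kappa> / u + 1 / (?p * u) + dev"
    using cardA Npos by (simp add: cardJ)
  finally show ?thesis unfolding c0 dev_def .
qed

end

lemma saturate_mono:
  fixes x y \<tau> :: real
  assumes "0 \<le> x" "x \<le> y" "0 \<le> \<tau>"
  shows "x / (1 + \<tau> * x) \<le> y / (1 + \<tau> * y)"
proof -
  have "0 < 1 + \<tau> * x" "0 < 1 + \<tau> * y" using assms by (auto intro!: add_pos_nonneg)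
  then show ?thesis using assms by (simp add: divide_simps algebra_simps)
qed

lemma saturate_le_inverse:
  fixes x \<tau> :: real
  assumes "0 \<le> x" "0 < \<tau>"
  shows "0 \<le> x / (1 + \<tau> * x)" "x / (1 + \<tau> * x) \<le> 1 / \<tau>"
proof -
  have "0 < 1 + \<tau> * x" using assms by (auto intro!: add_pos_nonneg)
  then show "0 \<le> x / (1 + \<tau> * x)" "x / (1 + \<tau> * x) \<le> 1 / \<tau>"
    using assms by (auto simp: divide_simps)
qed

text \<open>The difference is c - \<tau> times a product of two saturated values, bounded by 1 /
  \<tau> and 1 / c. Replacing p / N by its limit therefore costs the same at every x.\<close>

lemma saturate_tau_diff:
  fixes x \<tau> c :: real
  assumes "0 \<le> x" "0 < \<tau>" "0 < c"
  shows "\<bar>x / (1 + \<tau> * x) - x / (1 + c * x)\<bar> \<le> \<bar>\<tau> - c\<bar> / (\<tau> * c)"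
proof -
  have p: "0 < 1 + \<tau> * x" "0 < 1 + c * x" using assms by (auto intro!: add_pos_nonneg)
  have "x / (1 + \<tau> * x) - x / (1 + c * x) = (c - \<tau>) * (x / (1 + \<tau> * x)) * (x / (1 + c * x))"
    using p by (simp add: divide_simps) (simp add: algebra_simps)
  then have "\<bar>x / (1 + \<tau> * x) - x / (1 + c * x)\<bar> = \<bar>\<tau> - c\<bar> * ((x / (1 + \<tau> * x)) * (x / (1 + c * x)))"
    using saturate_le_inverse(1)[of x \<tau>] saturate_le_inverse(1)[of x c] assms by (simp only: abs_mult abs_minus_commute) (simp add: mult.assoc)
  also have "\<dots> \<le> \<bar>\<tau> - c\<bar> * ((1 / \<tau>) * (1 / c))"
    using saturate_le_inverse[of x \<tau>] saturate_le_inverse[of x c] assms by (intro mult_left_mono mult_mono) auto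
  finally show ?thesis by simp
qed

lemma saturate_measurable [measurable]:
  "(\<lambda>x::real. x / (1 + \<tau> * x)) \<in> borel_measurable borel"
  by measurable

section \<open>The square-free tensor as an isotropic sample\<close>

context standardized_law
begin

definition Y :: "nat \<Rightarrow> (nat \<Rightarrow> real) measure" where "Y n = PiM {1..n} (\<lambda>_. D)"

lemmas mean_square_integral_Y = mean_square_integral[folded Y_def]
lemmas mean_square_vs_product_Y = mean_square_vs_product[folded Y_def]
lemmas quad_form_second_moment_Y = quad_form_second_moment[folded Y_def]
lemmas log_square_product_weak_conv_Y = log_square_product_weak_conv[folded Y_def]

lemma prob_Y: "prob_space (Y n)"
  unfolding Y_def by (rule prob_space_PiM) (rule prob)

lemma monomial_measurable: "I \<subseteq> {1..n} \<Longrightarrow> (\<lambda>y. \<Prod>i\<in>I. y i) \<in> borel_measurable (Y n)"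
  unfolding Y_def
  by (intro borel_measurable_prod measurable_compose[OF measurable_component_singleton]) (auto simp: measurable_ident_sets[OF sets_D])

lemma mean_square_measurable: "mean_square n d \<in> borel_measurable (Y n)"
  unfolding mean_square_def[abs_def]
  by (intro borel_measurable_divide borel_measurable_sum borel_measurable_power borel_measurable_const monomial_measurable)
    (auto simp: dsubsets_iff)

lemma square_product_measurable: "square_product n d \<in> borel_measurable (Y n)"
  unfolding square_product_def[abs_def] Y_def by measurable

text \<open>As a function of the logarithm the integrand is bounded and continuous, so weak
  convergence of the log-product handles the main term. The true square norm is compared with the
  product in mean, and \<open>\<tau> n\<close> with c uniformly.\<close>

lemma mean_square_functional_limit:
  fixes d :: "nat \<Rightarrow> nat" and s c lam :: real
  assumes d: "\<And>n. 1 \<le> n \<Longrightarrow> 1 \<le> d n \<and> d n \<le> n" and lam: "(\<lambda>n. (real (d n))\<^sup>2 / real n) \<longlonglongrightarrow> lam" "0 \<le> lam"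
    and Q: "prob_space Q" and Z: "distributed Q lborel Z std_normal_density"
    and \<tau>: "\<tau> \<longlonglongrightarrow> c" and c: "0 < c" and s: "0 < s"
  defines "R \<equiv> \<lambda>\<omega>. exp (sqrt (lam * v) * Z \<omega> - lam * v / 2)"
  shows "(\<lambda>n. LINT y|Y n. s * mean_square n (d n) y / (1 + \<tau> n * (s * mean_square n (d n) y)))
    \<longlonglongrightarrow> (LINT \<omega>|Q. s * R \<omega> / (1 + c * (s * R \<omega>)))"
proof -
  let ?T = "\<lambda>n. mean_square n (d n)" and ?W = "\<lambda>n. square_product n (d n)"
  have mZ[measurable]: "Z \<in> borel_measurable Q" using distributed_measurable[OF Z] by simp
  define g where "g t = s * exp t / (1 + c * (s * exp t))" for t :: real
  have g_bd: "norm (g t) \<le> 1 / c" for t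
    using saturate_le_inverse[of "s * exp t" c] c s by (simp add: g_def)
  have lim_g: "(\<lambda>n. LINT t|distr (Y n) borel (\<lambda>y. ln (?W n y)). g t)
      \<longlonglongrightarrow> (LINT t|distr Q borel (\<lambda>\<omega>. sqrt (lam * v) * Z \<omega> - lam * v / 2). g t)"
  proof (rule weak_conv_imp_integral_bdd_continuous_conv[OF _ _ log_square_product_weak_conv_Y[OF _ lam Q Z] _ g_bd])
    show "real_distribution (distr Q borel (\<lambda>\<omega>. sqrt (lam * v) * Z \<omega> - lam * v / 2))"
      by (intro prob_space.real_distribution_distr Q) measurable
    show "real_distribution (distr (Y n) borel (\<lambda>y. ln (?W n y)))" for n
      by (intro prob_space.real_distribution_distr prob_Y borel_measurable_ln square_product_measurable)
    show "1 \<le> d n" if "1 \<le> n" for n using d that by blast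
    show "isCont g x" for x
    proof -
      have "1 + c * (s * exp x) \<noteq> 0" using c s by (smt (verit) exp_gt_zero mult_pos_pos)
      then show ?thesis unfolding g_def by (intro continuous_intros) auto
    qed
  qed
  have gm: "g \<in> borel_measurable borel" unfolding g_def by measurable
  have lim_R: "(LINT t|distr Q borel (\<lambda>\<omega>. sqrt (lam * v) * Z \<omega> - lam * v / 2). g t) = (LINT \<omega>|Q. s * R \<omega> / (1 + c * (s * R \<omega>)))"
    using gm by (subst integral_distr) (auto simp: g_def R_def)
  have ev1: "\<forall>\<^sub>F n in sequentially. real (d n) / real n < 1 / 2"
    by (rule order_tendstoD(2)[OF tendsto_ratio_zero[OF lam(1)]]) simp
  have ev2: "\<forall>\<^sub>F n in sequentially. c / 2 < \<tau> n"
    by (rule order_tendstoD(1)[OF \<tau>]) (use c in simp)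
  define bd where "bd n = s * sqrt (4 * v * (real (d n) / real n) * exp (4 * v * ((real (d n))\<^sup>2 / real n))) + \<bar>\<tau> n - c\<bar> / (\<tau> n * c)" for n
  have close: "\<forall>\<^sub>F n in sequentially. norm ((LINT y|Y n. s * ?T n y / (1 + \<tau> n * (s * ?T n y)))
      - (LINT t|distr (Y n) borel (\<lambda>y. ln (?W n y)). g t)) \<le> bd n"
    using ev1 ev2 eventually_ge_at_top[of 1]
  proof eventually_elim
    case (elim n)
    interpret Yn: prob_space "Y n" by (rule prob_Y)
    have dn: "1 \<le> d n" "d n \<le> n" using d elim(3) by auto
    have \<tau>n: "0 < \<tau> n" using elim(2) c by simp
    have W: "0 < ?W n y" for y
      unfolding square_product_def
    proof (rule prod_pos)
      fix i
      have "real (d n) / real n * (- 1) \<le> real (d n) / real n * ((y i)\<^sup>2 - 1)" by (intro mult_left_mono) auto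
      then show "0 < 1 + real (d n) / real n * ((y i)\<^sup>2 - 1)" using elim(1) by linarith
    qed
    have T: "0 \<le> ?T n y" for y by (rule mean_square_nonneg)
    have mT[measurable]: "?T n \<in> borel_measurable (Y n)" and mW[measurable]: "?W n \<in> borel_measurable (Y n)"
      by (rule mean_square_measurable square_product_measurable)+
    let ?f1 = "\<lambda>y. s * ?T n y / (1 + \<tau> n * (s * ?T n y))"
    let ?f3 = "\<lambda>y. s * ?W n y / (1 + c * (s * ?W n y))"
    have i1: "integrable (Y n) ?f1"
      using saturate_le_inverse[of "s * ?T n y" "\<tau> n" for y] T s \<tau>n
      by (intro Yn.integrable_const_bound[where B = "1 / \<tau> n"]) auto
    have i3: "integrable (Y n) ?f3"
      using saturate_le_inverse[of "s * ?W n y" c for y] less_imp_le[OF W] s c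
      by (intro Yn.integrable_const_bound[where B = "1 / c"]) auto
    have "(LINT t|distr (Y n) borel (\<lambda>y. ln (?W n y)). g t) = (LINT y|Y n. ?f3 y)"
      using gm W by (subst integral_distr) (auto simp: g_def)
    then have "norm ((LINT y|Y n. ?f1 y) - (LINT t|distr (Y n) borel (\<lambda>y. ln (?W n y)). g t)) = \<bar>LINT y|Y n. ?f1 y - ?f3 y\<bar>"
      using i1 i3 by simp
    also have "\<dots> \<le> (LINT y|Y n. \<bar>?f1 y - ?f3 y\<bar>)" by (rule integral_abs_bound)
    also have "\<dots> \<le> (LINT y|Y n. s * \<bar>?T n y - ?W n y\<bar> + \<bar>\<tau> n - c\<bar> / (\<tau> n * c))"
    proof (intro integral_mono)
      have "integrable (Y n) (\<lambda>y. ?T n y - ?W n y)"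
        by (rule Yn.expectation_abs_le_sqrt(1)[OF _ mean_square_vs_product_Y[OF dn]]) measurable
      then show "integrable (Y n) (\<lambda>y. s * \<bar>?T n y - ?W n y\<bar> + \<bar>\<tau> n - c\<bar> / (\<tau> n * c))" by simp
      show "integrable (Y n) (\<lambda>y. \<bar>?f1 y - ?f3 y\<bar>)" using i1 i3 by simp
      fix y
      have "\<bar>?f1 y - ?f3 y\<bar> \<le> \<bar>?f1 y - s * ?W n y / (1 + \<tau> n * (s * ?W n y))\<bar> + \<bar>s * ?W n y / (1 + \<tau> n * (s * ?W n y)) - ?f3 y\<bar>"
        by (rule order_trans[OF _ abs_triangle_ineq]) simp
      also have "\<dots> \<le> \<bar>s * ?T n y - s * ?W n y\<bar> + \<bar>\<tau> n - c\<bar> / (\<tau> n * c)"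
        using T[of y] W[of y] s c \<tau>n
        by (intro add_mono saturate_one_plus_lipschitz saturate_tau_diff) auto
      also have "\<bar>s * ?T n y - s * ?W n y\<bar> = s * \<bar>?T n y - ?W n y\<bar>"
        using s by (simp add: right_diff_distrib[symmetric] abs_mult)
      finally show "\<bar>?f1 y - ?f3 y\<bar> \<le> s * \<bar>?T n y - ?W n y\<bar> + \<bar>\<tau> n - c\<bar> / (\<tau> n * c)" .
    qed
    also have "\<dots> = s * (LINT y|Y n. \<bar>?T n y - ?W n y\<bar>) + \<bar>\<tau> n - c\<bar> / (\<tau> n * c)"
    proof -
      have "integrable (Y n) (\<lambda>y. ?T n y - ?W n y)"
        by (rule Yn.expectation_abs_le_sqrt(1)[OF _ mean_square_vs_product_Y[OF dn]]) measurable
      then have "integrable (Y n) (\<lambda>y. s * \<bar>?T n y - ?W n y\<bar>)" by simp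
      then show ?thesis by (subst Bochner_Integration.integral_add) (auto simp: Yn.prob_space)
    qed
    also have "\<dots> \<le> bd n"
      unfolding bd_def
    proof (intro add_right_mono mult_left_mono)
      have "(LINT y|Y n. \<bar>?T n y - ?W n y\<bar>) \<le> sqrt (4 * v * (d n / n) * exp (4 * v * (real (d n))\<^sup>2 / n))"
        by (rule Yn.expectation_abs_le_sqrt(2)[OF _ mean_square_vs_product_Y[OF dn]]) measurable
      then show "(LINT y|Y n. \<bar>?T n y - ?W n y\<bar>) \<le> sqrt (4 * v * (real (d n) / real n) * exp (4 * v * ((real (d n))\<^sup>2 / real n)))"
        by simp
    qed (use s in simp)
    finally show ?case .
  qed
  have L1: "(\<lambda>n. sqrt (4 * v * (real (d n) / real n) * exp (4 * v * ((real (d n))\<^sup>2 / real n)))) \<longlonglongrightarrow> sqrt (4 * v * 0 * exp (4 * v * lam))"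
    by (intro tendsto_intros tendsto_ratio_zero[OF lam(1)] lam(1))
  have L2: "(\<lambda>n. \<bar>\<tau> n - c\<bar> / (\<tau> n * c)) \<longlonglongrightarrow> \<bar>c - c\<bar> / (c * c)"
    using c by (intro tendsto_intros \<tau>) auto
  have "bd \<longlonglongrightarrow> s * sqrt (4 * v * 0 * exp (4 * v * lam)) + \<bar>c - c\<bar> / (c * c)"
    unfolding bd_def[abs_def] by (rule tendsto_add[OF tendsto_mult[OF tendsto_const L1] L2])
  then have "bd \<longlonglongrightarrow> 0" by simp
  then have "(\<lambda>n. (LINT y|Y n. s * ?T n y / (1 + \<tau> n * (s * ?T n y))) - (LINT t|distr (Y n) borel (\<lambda>y. ln (?W n y)). g t)) \<longlonglongrightarrow> 0"
    by (rule Lim_null_comparison[OF close])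
  from tendsto_add[OF this lim_g] show ?thesis unfolding lim_R by simp
qed

lemma sqfree_tensor_measurable: "sqfree_tensor n d \<in> Y n \<rightarrow>\<^sub>M tensor_space n d"
  unfolding sqfree_tensor_def[abs_def]
proof (rule measurable_restrict)
  fix I assume "I \<in> dsubsets n d"
  then show "(\<lambda>y. \<Prod>i\<in>I. y i) \<in> borel_measurable (Y n)"
    by (intro monomial_measurable) (simp add: dsubsets_iff)
qed

lemma prob_tensor_law: "prob_space (sqfree_tensor_law n d D)"
  unfolding sqfree_tensor_law_def Y_def[symmetric] by (intro prob_space.prob_space_distr prob_Y sqfree_tensor_measurable)

lemma tensor_law_integral:
  fixes h :: "(nat set \<Rightarrow> real) \<Rightarrow> real"
  assumes "h \<in> borel_measurable (tensor_space n d)"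
  shows "(LINT x|sqfree_tensor_law n d D. h x) = (LINT y|Y n. h (sqfree_tensor n d y))"
    and "integrable (sqfree_tensor_law n d D) h \<longleftrightarrow> integrable (Y n) (\<lambda>y. h (sqfree_tensor n d y))"
  unfolding sqfree_tensor_law_def Y_def[symmetric]
  by (rule integral_distr[OF sqfree_tensor_measurable assms])
    (rule integrable_distr_eq[OF sqfree_tensor_measurable assms])

definition quad_rate :: "nat \<Rightarrow> nat \<Rightarrow> real" where
  "quad_rate n d = sqrt ((16 + 2 * v) * (real d / real n) * exp (2 * v * ((real d)\<^sup>2 / real n)))"

lemma tensor_isotropic_sample:
  assumes d: "1 \<le> d" "d \<le> n" "16 * d \<le> n" and "1 \<le> N" "0 < u"
  shows "isotropic_sample (sqfree_tensor_law n d D) (dsubsets n d) {1..N} (quad_rate n d) N u"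
proof -
  let ?L = "sqfree_tensor_law n d D" and ?A = "dsubsets n d"
  interpret Yn: prob_space "Y n" by (rule prob_Y)
  have comp[measurable]: "(\<lambda>x. x I) \<in> borel_measurable (tensor_space n d)" if "I \<in> ?A" for I
    using that by (rule measurable_component_singleton)
  have ev: "sqfree_tensor n d y I = (\<Prod>i\<in>I. y i)" if "I \<in> ?A" for I y
    using that by (simp add: sqfree_tensor_def)
  have p0: "0 < n choose d" using d by simp
  have sq: "(\<Sum>I\<in>?A. (sqfree_tensor n d y I)\<^sup>2) = real (n choose d) * mean_square n d y" for y
    using p0 by (simp add: ev mean_square_def)
  have sq_meas: "(\<lambda>x. \<Sum>I\<in>?A. (x I)\<^sup>2) \<in> borel_measurable (tensor_space n d)" by measurable
  have q_meas: "(\<lambda>x. \<Sum>I\<in>?A. \<Sum>J\<in>?A. B I J * (x I * x J)) \<in> borel_measurable (tensor_space n d)" for B by measurable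
  have q_ev: "(\<Sum>I\<in>?A. \<Sum>J\<in>?A. B I J * (sqfree_tensor n d y I * sqfree_tensor n d y J))
      = (\<Sum>I\<in>?A. \<Sum>J\<in>?A. B I J * ((\<Prod>i\<in>I. y i) * (\<Prod>i\<in>J. y i)))" for B y
    by (intro sum.cong refl) (simp add: ev)
  have q_Y: "(\<lambda>y. \<Sum>I\<in>?A. \<Sum>J\<in>?A. B I J * ((\<Prod>i\<in>I. y i) * (\<Prod>i\<in>J. y i))) \<in> borel_measurable (Y n)" for B
    by (intro borel_measurable_sum borel_measurable_times borel_measurable_const monomial_measurable) (auto simp: dsubsets_iff)
  show ?thesis
  proof (rule isotropic_sample.intro)
    show "?A \<noteq> {}" using p0 card_dsubsets[of n d] by (metis card.empty less_irrefl)
    show "sets ?L = sets (PiM ?A (\<lambda>_. borel))" by (simp add: sqfree_tensor_law_def)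
    show "prob_space ?L" by (rule prob_tensor_law)
    show "integrable ?L (\<lambda>x. \<Sum>I\<in>?A. (x I)\<^sup>2)"
      unfolding tensor_law_integral(2)[OF sq_meas] sq using mean_square_integral_Y(1)[OF d(2)] by simp
    show "(LINT x|?L. (\<Sum>I\<in>?A. (x I)\<^sup>2)) = real (card ?A)"
      unfolding tensor_law_integral(1)[OF sq_meas] sq using mean_square_integral_Y(2)[OF d(2)] by (simp add: card_dsubsets)
    fix B :: "nat set \<Rightarrow> nat set \<Rightarrow> real"
    assume tr: "ktrace ?A B = 0"
    let ?q = "\<lambda>y. \<Sum>I\<in>?A. \<Sum>J\<in>?A. B I J * ((\<Prod>i\<in>I. y i) * (\<Prod>i\<in>J. y i))"
    have tr': "(\<Sum>I\<in>?A. B I I) = 0" using tr by (simp add: ktrace_def)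
    note qm2 = quad_form_second_moment_Y[where B = B, OF tr' d]
    show "integrable ?L (\<lambda>x. \<Sum>I\<in>?A. \<Sum>J\<in>?A. B I J * (x I * x J))"
      unfolding tensor_law_integral(2)[OF q_meas] q_ev
      by (rule Yn.expectation_abs_le_sqrt(1)[OF q_Y qm2])
    have abs_meas: "(\<lambda>x. \<bar>\<Sum>I\<in>?A. \<Sum>J\<in>?A. B I J * (x I * x J)\<bar>) \<in> borel_measurable (tensor_space n d)"
      using q_meas by (rule borel_measurable_abs)
    have "(LINT x|?L. \<bar>\<Sum>I\<in>?A. \<Sum>J\<in>?A. B I J * (x I * x J)\<bar>) = (LINT y|Y n. \<bar>?q y\<bar>)"
      unfolding tensor_law_integral(1)[OF abs_meas] q_ev ..
    also have "\<dots> \<le> sqrt (real (n choose d) * (\<Sum>I\<in>?A. \<Sum>J\<in>?A. (B I J)\<^sup>2) * ((16 + 2 * v) * (d / n) * exp (2 * v * (real d)\<^sup>2 / n)))"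
      by (rule Yn.expectation_abs_le_sqrt(2)[OF q_Y qm2])
    also have "\<dots> = quad_rate n d * sqrt (real (card ?A) * (\<Sum>I\<in>?A. \<Sum>J\<in>?A. (B I J)\<^sup>2))"
      unfolding quad_rate_def real_sqrt_mult[symmetric] by (simp add: card_dsubsets mult_ac)
    finally show "(LINT x|?L. \<bar>\<Sum>I\<in>?A. \<Sum>J\<in>?A. B I J * (x I * x J)\<bar>) \<le> quad_rate n d * sqrt (real (card ?A) * (\<Sum>I\<in>?A. \<Sum>J\<in>?A. (B I J)\<^sup>2))" .
  qed (use assms v_nonneg in \<open>auto simp: quad_rate_def\<close>)
qed

end

text \<open>Intermediate values on [0, 1 / u]: at the right end the linear term alone equals 1 and
  the integral is nonnegative. Continuity is dominated convergence with the bound 1 / c.\<close>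

lemma fixed_point_exists:
  fixes R :: "'q \<Rightarrow> real"
  assumes Q: "prob_space Q" and Rm: "R \<in> borel_measurable Q" and R: "\<And>\<omega>. 0 < R \<omega>" and c: "0 < c" and u: "0 < u"
  shows "\<exists>s>0. u * s + (LINT \<omega>|Q. s * R \<omega> / (1 + c * (s * R \<omega>))) = 1"
proof -
  interpret prob_space Q by fact
  define G where "G s = (LINT \<omega>|Q. s * R \<omega> / (1 + c * (s * R \<omega>)))" for s
  have bd: "0 \<le> s * R \<omega> / (1 + c * (s * R \<omega>))" "s * R \<omega> / (1 + c * (s * R \<omega>)) \<le> 1 / c" if "0 \<le> s" for s \<omega>
    using saturate_le_inverse[of "s * R \<omega>" c] that R[of \<omega>] c by auto
  have cont: "continuous_on {0..} G"
    unfolding continuous_on_sequentially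
  proof (intro ballI allI impI)
    fix x :: "nat \<Rightarrow> real" and s assume s: "s \<in> {0..}" and x: "(\<forall>n. x n \<in> {0..}) \<and> x \<longlonglongrightarrow> s"
    show "(G \<circ> x) \<longlonglongrightarrow> G s"
      unfolding G_def comp_def
    proof (rule integral_dominated_convergence[where w = "\<lambda>_. 1 / c"])
      show "AE \<omega> in Q. (\<lambda>n. x n * R \<omega> / (1 + c * (x n * R \<omega>))) \<longlonglongrightarrow> s * R \<omega> / (1 + c * (s * R \<omega>))"
      proof (rule AE_I2)
        fix \<omega>
        have "0 \<le> c * (s * R \<omega>)" using s c less_imp_le[OF R[of \<omega>]] by simp
        then have "1 + c * (s * R \<omega>) \<noteq> 0" by linarith
        then show "(\<lambda>n. x n * R \<omega> / (1 + c * (x n * R \<omega>))) \<longlonglongrightarrow> s * R \<omega> / (1 + c * (s * R \<omega>))"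
          using x by (intro tendsto_intros) auto
      qed
      show "AE \<omega> in Q. norm (x n * R \<omega> / (1 + c * (x n * R \<omega>))) \<le> 1 / c" for n
      proof (rule AE_I2)
        fix \<omega>
        have "0 \<le> x n" using x by simp
        from bd[OF this, of \<omega>] show "norm (x n * R \<omega> / (1 + c * (x n * R \<omega>))) \<le> 1 / c"
          by (simp only: real_norm_def abs_of_nonneg)
      qed
    qed (use Rm in auto)
  qed
  have G0: "0 \<le> G s" if "0 \<le> s" for s
    unfolding G_def by (intro integral_nonneg_AE AE_I2 bd that)
  have "\<exists>s\<ge>0. s \<le> 1 / u \<and> u * s + G s = 1"
  proof (rule IVT')
    show "u * 0 + G 0 \<le> 1" by (simp add: G_def)
    show "1 \<le> u * (1 / u) + G (1 / u)" using G0[of "1 / u"] u by simp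
    show "continuous_on {0..1 / u} (\<lambda>s. u * s + G s)"
      by (intro continuous_intros continuous_on_subset[OF cont]) auto
  qed (use u in simp)
  then obtain s where s: "0 \<le> s" "u * s + G s = 1" by blast
  moreover have "s \<noteq> 0" using s by (auto simp: G_def)
  ultimately show ?thesis unfolding G_def by (intro exI[of _ s]) auto
qed

section \<open>Convergence of the expected transforms\<close>

context standardized_law
begin

abbreviation sample_law :: "nat \<Rightarrow> nat \<Rightarrow> nat \<Rightarrow> (nat \<Rightarrow> nat set \<Rightarrow> real) measure" where
  "sample_law n d N \<equiv> PiM {1..N} (\<lambda>_. sqfree_tensor_law n d D)"

definition tmean :: "nat \<Rightarrow> nat \<Rightarrow> nat \<Rightarrow> real \<Rightarrow> (nat \<Rightarrow> nat set \<Rightarrow> real) \<Rightarrow> real" where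
  "tmean n d N u x = ktrace (dsubsets n d) (resolvent u N (dsubsets n d) {1..N} x) / card (dsubsets n d)"

definition tmean_exp :: "nat \<Rightarrow> nat \<Rightarrow> nat \<Rightarrow> real \<Rightarrow> real" where
  "tmean_exp n d N u = (LINT x|sample_law n d N. tmean n d N u x)"

lemma tmean_facts:
  fixes n d N :: nat and u \<epsilon> :: real
  assumes d: "1 \<le> d" "d \<le> n" "16 * d \<le> n" and N: "1 \<le> N" and u: "0 < u"
  defines "p \<equiv> real (n choose d)"
  shows "tmean n d N u \<in> borel_measurable (sample_law n d N)"
    and "0 \<le> tmean_exp n d N u"
    and "0 < \<epsilon> \<Longrightarrow> Sigma_Algebra.measure (sample_law n d N)
      {x \<in> space (sample_law n d N). \<epsilon> \<le> \<bar>tmean n d N u x - tmean_exp n d N u\<bar>} \<le> 2 * exp (- (\<epsilon>\<^sup>2 * u\<^sup>2 / 2 * (p * (p / N))))"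
    and "0 < \<epsilon> \<Longrightarrow> \<bar>1 - u * tmean_exp n d N u
      - (LINT y|Y n. tmean_exp n d N u * mean_square n d y / (1 + p / N * (tmean_exp n d N u * mean_square n d y)))\<bar>
      \<le> quad_rate n d / u + 1 / (p * u) + (\<epsilon> + 1 / u * (2 * exp (- (\<epsilon>\<^sup>2 * u\<^sup>2 / 2 * (p * (p / N))))))"
proof -
  interpret isotropic_sample "sqfree_tensor_law n d D" "dsubsets n d" "{1..N}" "quad_rate n d" N u
    by (rule tensor_isotropic_sample[OF d N u])
  have t: "trace_mean {1..N} = tmean n d N u" by (intro ext) (simp add: trace_mean_def tmean_def)
  have e: "mean_trace = tmean_exp n d N u" unfolding mean_trace_def tmean_exp_def t ..
  have p: "real (card (dsubsets n d)) = p" by (simp add: card_dsubsets p_def)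
  have pp: "(real (card (dsubsets n d)))\<^sup>2 / N = p * (p / N)" by (simp add: p power2_eq_square)
  have ex: "\<epsilon>\<^sup>2 * u\<^sup>2 / 2 * (real (card (dsubsets n d)))\<^sup>2 / N = \<epsilon>\<^sup>2 * u\<^sup>2 / 2 * (p * (p / N))" for \<epsilon>
    unfolding pp[symmetric] by simp
  show "tmean n d N u \<in> borel_measurable (sample_law n d N)"
    using trace_mean_measurable[of "{1..N}" "{1..N}"] unfolding t by blast
  show "0 \<le> tmean_exp n d N u" using mean_trace_bounds unfolding e by blast
  show "0 < \<epsilon> \<Longrightarrow> Sigma_Algebra.measure (sample_law n d N)
      {x \<in> space (sample_law n d N). \<epsilon> \<le> \<bar>tmean n d N u x - tmean_exp n d N u\<bar>} \<le> 2 * exp (- (\<epsilon>\<^sup>2 * u\<^sup>2 / 2 * (p * (p / N))))"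
    using trace_mean_tail[of \<epsilon>] unfolding t e ex .
  assume "0 < \<epsilon>"
  from trace_mean_L1[OF this]
  have dev: "(LINT x|sample_law n d N. \<bar>tmean n d N u x - tmean_exp n d N u\<bar>)
    \<le> \<epsilon> + 1 / u * (2 * exp (- (\<epsilon>\<^sup>2 * u\<^sup>2 / 2 * (p * (p / N)))))"
    unfolding t e ex .
  let ?h = "\<lambda>m. tmean_exp n d N u * m / (1 + p / N * (tmean_exp n d N u * m))"
  have comp: "(\<lambda>x. x I) \<in> borel_measurable (tensor_space n d)" if "I \<in> dsubsets n d" for I
    using that by (rule measurable_component_singleton)
  have hm: "(\<lambda>x. ?h ((\<Sum>I\<in>dsubsets n d. (x I)\<^sup>2) / p)) \<in> borel_measurable (tensor_space n d)"
    by (intro borel_measurable_divide borel_measurable_times borel_measurable_add borel_measurable_const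
        borel_measurable_sum borel_measurable_power comp)
  have "(LINT x|sqfree_tensor_law n d D. ?h ((\<Sum>I\<in>dsubsets n d. (x I)\<^sup>2) / p))
      = (LINT y|Y n. ?h ((\<Sum>I\<in>dsubsets n d. (sqfree_tensor n d y I)\<^sup>2) / p))"
    by (rule tensor_law_integral(1)[OF hm])
  also have "\<dots> = (LINT y|Y n. ?h (mean_square n d y))"
    by (simp add: mean_square_def sqfree_tensor_def p_def)
  finally have L: "(LINT x|sqfree_tensor_law n d D. ?h ((\<Sum>I\<in>dsubsets n d. (x I)\<^sup>2) / p)) = (LINT y|Y n. ?h (mean_square n d y))" .
  have "\<bar>1 - u * tmean_exp n d N u - (LINT x|sqfree_tensor_law n d D. ?h ((\<Sum>I\<in>dsubsets n d. (x I)\<^sup>2) / p))\<bar>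
    \<le> quad_rate n d / u + 1 / (p * u) + (LINT x|sample_law n d N. \<bar>tmean n d N u x - tmean_exp n d N u\<bar>)"
    using self_consistent_estimate unfolding t e p .
  then show "\<bar>1 - u * tmean_exp n d N u - (LINT y|Y n. ?h (mean_square n d y))\<bar>
      \<le> quad_rate n d / u + 1 / (p * u) + (\<epsilon> + 1 / u * (2 * exp (- (\<epsilon>\<^sup>2 * u\<^sup>2 / 2 * (p * (p / N))))))"
    unfolding L using dev by linarith
qed

text \<open>Monotonicity in \<open>s\<close> of \<open>u s + E (s T / (1 + \<tau> s T))\<close> with slope at least \<open>u\<close> turns an
  approximate solution into a quantitative error bound, without any compactness argument.\<close>

lemma approximate_root:
  fixes n d :: nat and \<tau> u s t :: real
  assumes \<tau>: "0 < \<tau>" and u: "0 < u" and s: "0 \<le> s" and t: "0 \<le> t"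
  defines "h \<equiv> \<lambda>s. u * s + (LINT y|Y n. s * mean_square n d y / (1 + \<tau> * (s * mean_square n d y)))"
  shows "u * \<bar>s - t\<bar> \<le> \<bar>h s - h t\<bar>"
proof -
  interpret Yn: prob_space "Y n" by (rule prob_Y)
  have mT[measurable]: "mean_square n d \<in> borel_measurable (Y n)" by (rule mean_square_measurable)
  have T: "0 \<le> mean_square n d y" for y by (rule mean_square_nonneg)
  have int: "integrable (Y n) (\<lambda>y. s * mean_square n d y / (1 + \<tau> * (s * mean_square n d y)))" if "0 \<le> s" for s
    using saturate_le_inverse[of "s * mean_square n d y" \<tau> for y] T that \<tau>
    by (intro Yn.integrable_const_bound[where B = "1 / \<tau>"]) auto
  have mono: "u * (t - s) \<le> h t - h s" if "0 \<le> s" "s \<le> t" for s t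
  proof -
    have "(LINT y|Y n. s * mean_square n d y / (1 + \<tau> * (s * mean_square n d y)))
        \<le> (LINT y|Y n. t * mean_square n d y / (1 + \<tau> * (t * mean_square n d y)))"
      using that T \<tau> by (intro integral_mono int saturate_mono mult_right_mono mult_nonneg_nonneg) auto
    then show ?thesis by (simp add: h_def algebra_simps)
  qed
  show ?thesis
  proof (cases "s \<le> t")
    case True
    then have "u * \<bar>s - t\<bar> = u * (t - s)" by simp
    then show ?thesis using mono[OF s True] by linarith
  next
    case False
    then have "u * \<bar>s - t\<bar> = u * (s - t)" by simp
    then show ?thesis using mono[OF t, of s] False by linarith
  qed
qed

text \<open>Linear growth of p makes the exponential tails summable in n and sends the leave-one-out
  error to 0.\<close>

lemma choose_ge_self:
  assumes "1 \<le> d" "2 * d \<le> n" shows "n \<le> n choose d"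
  using binomial_mono[of 1 d n] assms by simp

context
  fixes d N :: "nat \<Rightarrow> nat" and c lam :: real
  assumes d: "\<And>n. 1 \<le> n \<Longrightarrow> 1 \<le> d n \<and> d n \<le> n" and N: "\<And>n. 1 \<le> n \<Longrightarrow> 1 \<le> N n"
    and lam: "(\<lambda>n. (real (d n))\<^sup>2 / real n) \<longlonglongrightarrow> lam" "0 \<le> lam"
    and c: "0 < c" "(\<lambda>n. real (n choose d n) / real (N n)) \<longlonglongrightarrow> c"
begin

lemma eventually_regime:
  "\<forall>\<^sub>F n in sequentially. 1 \<le> n \<and> 1 \<le> d n \<and> d n \<le> n \<and> 16 * d n \<le> n \<and> 1 \<le> N n
    \<and> c / 2 < real (n choose d n) / real (N n) \<and> n \<le> n choose d n"
proof -
  have "\<forall>\<^sub>F n in sequentially. real (d n) / real n < 1 / 16"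
    by (rule order_tendstoD(2)[OF tendsto_ratio_zero[OF lam(1)]]) simp
  moreover have "\<forall>\<^sub>F n in sequentially. c / 2 < real (n choose d n) / real (N n)"
    by (rule order_tendstoD(1)[OF c(2)]) (use c(1) in simp)
  ultimately show ?thesis
    using eventually_ge_at_top[of 1]
  proof eventually_elim
    case (elim n)
    then have 16: "16 * d n \<le> n" by (simp add: field_simps)
    show ?case using elim 16 d[of n] N[of n] choose_ge_self[of "d n" n] by auto
  qed
qed

lemma choose_sq_at_top:
  "filterlim (\<lambda>n. real (n choose d n) * (real (n choose d n) / real (N n))) at_top sequentially"
proof (rule filterlim_at_top_mult_tendsto_pos[OF c(2) c(1)])
  show "filterlim (\<lambda>n. real (n choose d n)) at_top sequentially"
    by (rule filterlim_at_top_mono[OF filterlim_real_sequentially eventually_mono[OF eventually_regime]]) auto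
qed

text \<open>Both the limiting root s and the expected transform nearly solve the equation at stage
  n: the first because its left side converges to the limiting one, the second by the
  self-consistent estimate. The slope bound then compares the two.\<close>

lemma tmean_exp_tendsto:
  assumes u: "0 < u" and s: "0 < s" and Q: "prob_space Q" and Z: "distributed Q lborel Z std_normal_density"
    and root: "u * s + (LINT \<omega>|Q. s * exp (sqrt (lam * v) * Z \<omega> - lam * v / 2) / (1 + c * (s * exp (sqrt (lam * v) * Z \<omega> - lam * v / 2)))) = 1"
  shows "(\<lambda>n. tmean_exp n (d n) (N n) u) \<longlonglongrightarrow> s"
proof -
  let ?p = "\<lambda>n. real (n choose d n)"
  define \<tau> where "\<tau> n = ?p n / real (N n)" for n
  define h where "h n t = u * t + (LINT y|Y n. t * mean_square n (d n) y / (1 + \<tau> n * (t * mean_square n (d n) y)))" for n t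
  let ?t = "\<lambda>n. tmean_exp n (d n) (N n) u"
  have \<tau>c: "\<tau> \<longlonglongrightarrow> c" unfolding \<tau>_def by (rule c(2))
  have "(\<lambda>n. h n s) \<longlonglongrightarrow> u * s + (LINT \<omega>|Q. s * exp (sqrt (lam * v) * Z \<omega> - lam * v / 2) / (1 + c * (s * exp (sqrt (lam * v) * Z \<omega> - lam * v / 2))))"
    unfolding h_def
    by (intro tendsto_add tendsto_const mean_square_functional_limit[OF d lam Q Z \<tau>c c(1) s])
  then have hs: "(\<lambda>n. h n s) \<longlonglongrightarrow> 1" by (simp only: root)
  have p_top: "filterlim ?p at_top sequentially"
    by (rule filterlim_at_top_mono[OF filterlim_real_sequentially eventually_mono[OF eventually_regime]]) auto
  have rate: "(\<lambda>n. quad_rate n (d n) / u + 1 / (?p n * u)) \<longlonglongrightarrow> 0"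
  proof -
    have "(\<lambda>n. quad_rate n (d n)) \<longlonglongrightarrow> sqrt ((16 + 2 * v) * 0 * exp (2 * v * lam))"
      unfolding quad_rate_def by (intro tendsto_intros tendsto_ratio_zero[OF lam(1)] lam(1))
    then have 1: "(\<lambda>n. quad_rate n (d n) / u) \<longlonglongrightarrow> 0 / u" using u by (intro tendsto_divide) auto
    have "(\<lambda>n. 1 / ?p n * (1 / u)) \<longlonglongrightarrow> 0 * (1 / u)"
      by (intro tendsto_mult tendsto_const tendsto_divide_0[OF tendsto_const] filterlim_at_top_imp_at_infinity p_top)
    then have 2: "(\<lambda>n. 1 / (?p n * u)) \<longlonglongrightarrow> 0" by simp
    show ?thesis using tendsto_add[OF 1 2] by simp
  qed
  have ht: "(\<lambda>n. h n (?t n)) \<longlonglongrightarrow> 1"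
  proof (rule LIMSEQ_I)
    fix r :: real assume r: "0 < r"
    \<comment> \<open>One third each for the form and leave-one-out errors, the deviation threshold
      and the tail beyond it.\<close>
    define \<epsilon> where "\<epsilon> = r / 3"
    have e: "0 < \<epsilon>" using r by (simp add: \<epsilon>_def)
    have "filterlim (\<lambda>n. \<epsilon>\<^sup>2 * u\<^sup>2 / 2 * (?p n * (?p n / N n))) at_top sequentially"
      using e u by (intro filterlim_tendsto_pos_mult_at_top[OF tendsto_const _ choose_sq_at_top]) simp
    then have "(\<lambda>n. exp (- (\<epsilon>\<^sup>2 * u\<^sup>2 / 2 * (?p n * (?p n / N n))))) \<longlonglongrightarrow> 0"
      by (intro filterlim_compose[OF exp_at_bot] filterlim_uminus_at_bot_at_top[THEN filterlim_compose])
    then have "(\<lambda>n. 1 / u * (2 * exp (- (\<epsilon>\<^sup>2 * u\<^sup>2 / 2 * (?p n * (?p n / N n)))))) \<longlonglongrightarrow> 1 / u * (2 * 0)"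
      by (intro tendsto_intros)
    then have "\<forall>\<^sub>F n in sequentially. 1 / u * (2 * exp (- (\<epsilon>\<^sup>2 * u\<^sup>2 / 2 * (?p n * (?p n / N n))))) < \<epsilon>"
      by (rule order_tendstoD(2)) (use e in simp)
    moreover have "\<forall>\<^sub>F n in sequentially. quad_rate n (d n) / u + 1 / (?p n * u) < \<epsilon>"
      by (rule order_tendstoD(2)[OF rate e])
    ultimately have "\<forall>\<^sub>F n in sequentially. norm (h n (?t n) - 1) < r"
      using eventually_regime
    proof eventually_elim
      case (elim n)
      have "\<bar>1 - u * ?t n - (LINT y|Y n. ?t n * mean_square n (d n) y / (1 + \<tau> n * (?t n * mean_square n (d n) y)))\<bar>
        \<le> quad_rate n (d n) / u + 1 / (?p n * u) + (\<epsilon> + 1 / u * (2 * exp (- (\<epsilon>\<^sup>2 * u\<^sup>2 / 2 * (?p n * (?p n / N n))))))"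
        unfolding \<tau>_def using elim(3) by (intro tmean_facts(4) u e) auto
      also have "\<dots> < 3 * \<epsilon>" using elim(1,2) by linarith
      finally show ?case unfolding h_def \<epsilon>_def real_norm_def by linarith
    qed
    then show "\<exists>no. \<forall>n\<ge>no. norm (h n (?t n) - 1) < r" by (simp add: eventually_sequentially)
  qed
  have "(\<lambda>n. ?t n - s) \<longlonglongrightarrow> 0"
  proof (rule Lim_null_comparison)
    show "\<forall>\<^sub>F n in sequentially. norm (?t n - s) \<le> \<bar>h n (?t n) - h n s\<bar> / u"
      using eventually_regime
    proof eventually_elim
      case (elim n)
      then have "0 < \<tau> n" using c(1) by (simp add: \<tau>_def)
      moreover have "0 \<le> ?t n" using elim by (intro tmean_facts(2) u) auto
      ultimately have "u * \<bar>?t n - s\<bar> \<le> \<bar>h n (?t n) - h n s\<bar>"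
        unfolding h_def using s u by (intro approximate_root) auto
      then show ?case using u by (simp add: field_simps)
    qed
    have "(\<lambda>n. \<bar>h n (?t n) - h n s\<bar> / u) \<longlonglongrightarrow> \<bar>1 - 1\<bar> / u"
      using u by (intro tendsto_intros ht hs) auto
    then show "(\<lambda>n. \<bar>h n (?t n) - h n s\<bar> / u) \<longlonglongrightarrow> 0" by simp
  qed
  then show ?thesis by (rule LIM_zero_cancel)
qed

end

end

section \<open>Stieltjes transforms on the slit plane\<close>

text \<open>The plane without the closed negative half-line. In the variable w = - z it contains the
  positive half-line, where the equation is known first.\<close>

definition slit :: "complex set" where
  "slit = {w. 0 < Re w \<or> Im w \<noteq> 0}"

text \<open>A lower bound for the distance of \<open>w\<close> to the negative half-line, not the
  distance itself: on the right half-plane the exact value would be |w|.\<close>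

definition slit_dist :: "complex \<Rightarrow> real" where
  "slit_dist w = (if 0 < Re w then Re w else \<bar>Im w\<bar>)"

lemma slit_dist_pos: "w \<in> slit \<Longrightarrow> 0 < slit_dist w"
  by (auto simp: slit_def slit_dist_def)

lemma slit_dist_le: "0 \<le> t \<Longrightarrow> slit_dist w \<le> norm (of_real t + w)"
  using abs_Re_le_cmod[of "of_real t + w"] abs_Im_le_cmod[of "of_real t + w"] by (auto simp: slit_dist_def)

lemma slit_nonzero: "w \<in> slit \<Longrightarrow> 0 \<le> t \<Longrightarrow> of_real t + w \<noteq> 0"
  using slit_dist_pos[of w] slit_dist_le[of t w] by auto

lemma open_slit: "open slit"
proof -
  have eq: "slit = {w. 0 < Re w} \<union> {w. 0 < Im w} \<union> {w. Im w < 0}" by (auto simp: slit_def)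
  show ?thesis unfolding eq by (intro open_Un open_halfspace_Re_gt open_halfspace_Im_gt open_halfspace_Im_lt)
qed

lemma connected_slit: "connected slit"
proof -
  have eq: "slit = ({w. 0 < Re w} \<union> {w. 0 < Im w}) \<union> ({w. 0 < Re w} \<union> {w. Im w < 0})" by (auto simp: slit_def)
  have c: "connected {w. 0 < Re w}" "connected {w. 0 < Im w}" "connected {w. Im w < 0}"
    by (auto intro!: convex_connected convex_halfspace_Re_gt convex_halfspace_Im_gt convex_halfspace_Im_lt)
  have "connected ({w. 0 < Re w} \<union> {w. 0 < Im w})" "connected ({w. 0 < Re w} \<union> {w. Im w < 0})"
  proof -
    have "1 + \<i> \<in> {w. 0 < Re w} \<inter> {w. 0 < Im w}" "1 - \<i> \<in> {w. 0 < Re w} \<inter> {w. Im w < 0}" by auto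
    then show "connected ({w. 0 < Re w} \<union> {w. 0 < Im w})" "connected ({w. 0 < Re w} \<union> {w. Im w < 0})"
      using c by (blast intro: connected_Un)+
  qed
  moreover have "1 \<in> ({w. 0 < Re w} \<union> {w. 0 < Im w}) \<inter> ({w. 0 < Re w} \<union> {w. Im w < 0})" by simp
  ultimately show ?thesis unfolding eq by (blast intro: connected_Un)
qed

lemma of_real_slit: "0 < u \<Longrightarrow> complex_of_real u \<in> slit"
  by (simp add: slit_def)

text \<open>The positive rationals have 1 as an accumulation point inside the connected open set,
  which is all that the identity theorem asks for.\<close>

lemma zero_on_slit:
  assumes "f holomorphic_on slit" and "\<And>u. u \<in> \<rat> \<Longrightarrow> 0 < u \<Longrightarrow> f (complex_of_real u) = 0" and "w \<in> slit"
  shows "f w = 0"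
proof (rule analytic_continuation[OF assms(1) open_slit connected_slit])
  let ?U = "complex_of_real ` {u. u \<in> \<rat> \<and> 0 < u}"
  show "?U \<subseteq> slit" by (auto intro: of_real_slit)
  show "complex_of_real 1 \<in> slit" by (rule of_real_slit) simp
  show "complex_of_real 1 islimpt ?U"
    unfolding islimpt_sequential
  proof (intro exI[of _ "\<lambda>n. complex_of_real (1 + 1 / real (Suc n))"] conjI allI)
    show "complex_of_real (1 + 1 / real (Suc n)) \<in> ?U - {complex_of_real 1}" for n
    proof -
      have "1 + 1 / real (Suc n) \<in> \<rat>" by (intro Rats_add Rats_divide Rats_1 Rats_of_nat)
      moreover have "complex_of_real (1 + 1 / real (Suc n)) \<noteq> complex_of_real 1"
        by (simp only: of_real_eq_iff) simp
      moreover have "0 < 1 + 1 / real (Suc n)" by (simp add: add_pos_pos)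
      ultimately show ?thesis by blast
    qed
    have "(\<lambda>n. complex_of_real (1 + 1 / real (Suc n))) \<longlonglongrightarrow> complex_of_real (1 + 0)"
      by (intro tendsto_of_real tendsto_add tendsto_const LIMSEQ_Suc[OF lim_1_over_n])
    then show "(\<lambda>n. complex_of_real (1 + 1 / real (Suc n))) \<longlonglongrightarrow> complex_of_real 1" by simp
  qed
  show "f z = 0" if "z \<in> ?U" for z using that assms(2) by auto
qed (rule assms(3))

section \<open>Transforms of laws on the half-line\<close>

locale positive_law = real_distribution \<mu> for \<mu> :: "real measure" +
  assumes nonneg: "AE t in \<mu>. 0 \<le> t"
begin

text \<open>Powers are included because differentiation takes k to k + 1. At w = 1 the values are
  the moments of the bounded variable 1 / (1 + t), from which the law is recovered.\<close>

definition shifted_moment :: "nat \<Rightarrow> complex \<Rightarrow> complex" where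
  "shifted_moment k w = (CLINT t|\<mu>. (1 / (of_real t + w)) ^ k)"

lemma resolvent_power_measurable [measurable]:
  "(\<lambda>t. (1 / (complex_of_real t + w)) ^ k) \<in> borel_measurable \<mu>"
  by measurable

lemma resolvent_power_bound:
  assumes "w \<in> slit"
  shows "AE t in \<mu>. norm ((1 / (of_real t + w)) ^ k) \<le> (1 / slit_dist w) ^ k"
  using nonneg
proof eventually_elim
  case (elim t)
  have "norm (1 / (of_real t + w)) \<le> 1 / slit_dist w"
    using slit_dist_le[OF elim, of w] slit_dist_pos[OF assms] by (simp add: norm_divide frac_le)
  then show ?case unfolding norm_power by (intro power_mono) auto
qed

lemma resolvent_power_integrable:
  assumes "w \<in> slit" shows "integrable \<mu> (\<lambda>t. (1 / (complex_of_real t + w)) ^ k)"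
  using resolvent_power_bound[OF assms] by (intro integrable_const_bound) auto

text \<open>Dominated convergence for difference quotients. In a ball of radius m / 2 around w,
  where m bounds |t + w| from below, all denominators stay at least m / 2 in modulus, uniformly in t
  >= 0.\<close>

lemma shifted_moment_derivative:
  assumes w: "w \<in> slit"
  shows "(shifted_moment k has_field_derivative - of_nat k * shifted_moment (Suc k) w) (at w)"
proof -
  define m where "m = slit_dist w"
  have m: "0 < m" unfolding m_def by (rule slit_dist_pos) fact
  obtain r where r: "0 < r" "ball w r \<subseteq> slit" using open_slit w by (auto simp: open_contains_ball)
  define S where "S = ball w (min r (m / 2))"
  have S: "open S" "w \<in> S" "S \<subseteq> slit" using r m by (auto simp: S_def)
  have far: "m / 2 \<le> norm (of_real t + z)" if "z \<in> S" "0 \<le> t" for z t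
  proof -
    have "m \<le> norm (of_real t + w)" unfolding m_def by (rule slit_dist_le) fact
    moreover have "norm (w - z) \<le> m / 2" using that(1) by (simp add: S_def dist_norm)
    moreover have "norm (of_real t + w) \<le> norm (of_real t + z) + norm (w - z)"
      using norm_triangle_ineq[of "of_real t + z" "w - z"] by simp
    ultimately show ?thesis by linarith
  qed
  let ?B = "\<lambda>z t. 1 / (complex_of_real t + z)"
  \<comment> \<open>The difference quotient with z - w already cancelled, so that it is bounded and
    its limit is found by substitution.\<close>
  define q where "q z t = - (?B z t * ?B w t) * (\<Sum>i<k. ?B w t ^ (k - Suc i) * ?B z t ^ i)" for z t
  have quot: "(?B z t ^ k - ?B w t ^ k) / (z - w) = q z t" if "z \<in> S" "z \<noteq> w" "0 \<le> t" for z t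
  proof -
    have nz: "of_real t + z \<noteq> 0" "of_real t + w \<noteq> 0"
      using slit_nonzero[OF _ that(3)] that(1) S by auto
    have diff: "?B z t - ?B w t = - (z - w) * (?B z t * ?B w t)" using nz by (simp add: field_simps)
    have gen: "(X * \<Sigma>) / e = - Y * \<Sigma>" if "X = - e * Y" "e \<noteq> 0" for X Y \<Sigma> e :: complex
      using that by (simp add: field_simps)
    have "z - w \<noteq> 0" using that(2) by simp
    then show ?thesis
      unfolding power_diff_sumr2 q_def by (rule gen[OF diff])
  qed
  have "((\<lambda>z. (shifted_moment k z - shifted_moment k w) / (z - w)) \<longlongrightarrow> - of_nat k * shifted_moment (Suc k) w) (at w within S)"
    unfolding tendsto_at_iff_sequentially
  proof (intro allI impI)
    fix X assume X: "\<forall>i. X i \<in> S - {w}" and lim: "X \<longlonglongrightarrow> w"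
    \<comment> \<open>At k = 0 the truncated \<open>k - 1\<close> does no harm, both sides being
      0.\<close>
    have collect: "- (b * b) * (of_nat k * b ^ (k - 1)) = - of_nat k * b ^ Suc k" for b :: complex
      by (cases k) (simp_all del: of_nat_Suc add: mult_ac)
    have "(\<lambda>i. CLINT t|\<mu>. q (X i) t) \<longlonglongrightarrow> (CLINT t|\<mu>. - of_nat k * (?B w t) ^ Suc k)"
    proof (rule integral_dominated_convergence[where w = "\<lambda>_. (2 / m)^2 * (real k * (2 / m) ^ (k - 1))"])
      show "AE t in \<mu>. (\<lambda>i. q (X i) t) \<longlonglongrightarrow> - of_nat k * (?B w t) ^ Suc k"
        using nonneg
      proof eventually_elim
        case (elim t)
        have "(\<lambda>i. q (X i) t) \<longlonglongrightarrow> - (?B w t * ?B w t) * (\<Sum>i<k. ?B w t ^ (k - Suc i) * ?B w t ^ i)"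
          unfolding q_def using slit_nonzero[OF w elim] by (intro tendsto_intros lim) auto
        also have "(\<Sum>i<k. ?B w t ^ (k - Suc i) * ?B w t ^ i) = of_nat k * ?B w t ^ (k - 1)"
          by (simp add: power_add[symmetric])
        also have "- (?B w t * ?B w t) * (of_nat k * ?B w t ^ (k - 1)) = - of_nat k * (?B w t) ^ Suc k"
          using collect .
        finally show ?case .
      qed
      show "AE t in \<mu>. norm (q (X i) t) \<le> (2 / m)^2 * (real k * (2 / m) ^ (k - 1))" for i
        using nonneg
      proof eventually_elim
        case (elim t)
        have inverse: "norm (1 / y) \<le> 2 / m" if "m / 2 \<le> norm y" for y :: complex
          using frac_le[of 1 1 "m / 2" "norm y"] that m by (simp add: norm_divide)
        have b: "norm (?B (X i) t) \<le> 2 / m" "norm (?B w t) \<le> 2 / m"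
          using far[of "X i" t] far[of w t] X S(2) elim by (auto intro!: inverse simp del: norm_divide)
        have "norm (\<Sum>j<k. ?B w t ^ (k - Suc j) * ?B (X i) t ^ j) \<le> (\<Sum>j<k. (2 / m) ^ (k - 1))"
        proof (rule sum_norm_le)
          fix j assume j: "j \<in> {..<k}"
          have "norm (?B w t ^ (k - Suc j) * ?B (X i) t ^ j) \<le> (2 / m) ^ (k - Suc j) * (2 / m) ^ j"
            unfolding norm_mult norm_power using b m by (intro mult_mono power_mono) auto
          also have "\<dots> = (2 / m) ^ (k - 1)" using j by (simp add: power_add[symmetric])
          finally show "norm (?B w t ^ (k - Suc j) * ?B (X i) t ^ j) \<le> (2 / m) ^ (k - 1)" .
        qed
        then have sum: "norm (\<Sum>j<k. ?B w t ^ (k - Suc j) * ?B (X i) t ^ j) \<le> real k * (2 / m) ^ (k - 1)"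
          by simp
        have "norm (?B (X i) t) * norm (?B w t) \<le> 2 / m * (2 / m)"
          using b m by (intro mult_mono) auto
        then have "norm (- (?B (X i) t * ?B w t)) \<le> (2 / m)^2"
          unfolding norm_mult norm_minus_cancel power2_eq_square .
        from mult_mono[OF this sum] show ?case
          unfolding q_def norm_mult[of "- (?B (X i) t * ?B w t)"] by simp
      qed
      show "(\<lambda>t. q (X i) t) \<in> borel_measurable \<mu>" for i unfolding q_def by measurable
    qed auto
    moreover have "(CLINT t|\<mu>. - of_nat k * (?B w t) ^ Suc k) = - of_nat k * shifted_moment (Suc k) w"
      unfolding shifted_moment_def by (rule integral_mult_right_zero)
    moreover have "(CLINT t|\<mu>. q (X i) t) = (shifted_moment k (X i) - shifted_moment k w) / (X i - w)" for i
    proof -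
      have Xi: "X i \<in> S" "X i \<noteq> w" "X i \<in> slit" using X S(3) by auto
      have "(CLINT t|\<mu>. q (X i) t) = (CLINT t|\<mu>. (?B (X i) t ^ k - ?B w t ^ k) / (X i - w))"
      proof (intro integral_cong_AE)
        show "AE t in \<mu>. q (X i) t = (?B (X i) t ^ k - ?B w t ^ k) / (X i - w)"
          using nonneg by eventually_elim (rule quot[OF Xi(1,2), symmetric])
      qed (unfold q_def, measurable)
      also have "\<dots> = ((CLINT t|\<mu>. ?B (X i) t ^ k) - (CLINT t|\<mu>. ?B w t ^ k)) / (X i - w)"
        using resolvent_power_integrable[OF w, of k] resolvent_power_integrable[OF Xi(3), of k]
        by (simp only: integral_divide_zero Bochner_Integration.integral_diff)
      finally show ?thesis by (simp only: shifted_moment_def)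
    qed
    ultimately show "((\<lambda>z. (shifted_moment k z - shifted_moment k w) / (z - w)) \<circ> X) \<longlonglongrightarrow> - of_nat k * shifted_moment (Suc k) w"
      by (simp add: comp_def)
  qed
  then have "(shifted_moment k has_field_derivative - of_nat k * shifted_moment (Suc k) w) (at w within S)"
    by (simp add: has_field_derivative_iff)
  then show ?thesis unfolding at_within_open[OF S(2,1)] .
qed

abbreviation transform :: "complex \<Rightarrow> complex" where "transform \<equiv> shifted_moment 1"

lemma transform_eq: "transform w = (CLINT t|\<mu>. 1 / (of_real t + w))"
  by (simp add: shifted_moment_def)

lemma transform_holomorphic: "transform holomorphic_on slit"
  unfolding holomorphic_on_def field_differentiable_def
  using shifted_moment_derivative has_field_derivative_at_within by blast

lemma transform_integrable: "w \<in> slit \<Longrightarrow> integrable \<mu> (\<lambda>t. 1 / (complex_of_real t + w))"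
  using resolvent_power_integrable[of w 1] by simp

lemma transform_of_real: "transform (of_real u) = of_real (LINT t|\<mu>. 1 / (t + u))"
proof -
  have "transform (of_real u) = (CLINT t|\<mu>. of_real (1 / (t + u)))"
    unfolding transform_eq by (intro Bochner_Integration.integral_cong) auto
  then show ?thesis by (simp only: integral_complex_of_real)
qed

lemma integrable_inverse_shift: "0 < u \<Longrightarrow> integrable \<mu> (\<lambda>t. 1 / (t + u))"
proof (rule integrable_const_bound[where B = "1 / u"])
  assume "0 < u"
  then show "AE t in \<mu>. norm (1 / (t + u)) \<le> 1 / u"
    using nonneg by (auto simp: frac_le)
qed auto

lemma integral_positive:
  assumes "integrable \<mu> f" "AE t in \<mu>. 0 < (f t :: real)"
  shows "0 < (LINT t|\<mu>. f t)"
proof (rule ccontr)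
  assume "\<not> 0 < (LINT t|\<mu>. f t)"
  moreover have nn: "AE t in \<mu>. 0 \<le> f t" using assms(2) by auto
  then have "0 \<le> (LINT t|\<mu>. f t)" by (rule integral_nonneg_AE)
  ultimately have "(LINT t|\<mu>. f t) = 0" by simp
  then have "AE t in \<mu>. f t = 0" using integral_nonneg_eq_0_iff_AE[OF assms(1) nn] by simp
  then have "AE t in \<mu>. False" using assms(2) by eventually_elim simp
  then show False by simp
qed

lemma inverse_shift_positive: "0 < u \<Longrightarrow> 0 < (LINT t|\<mu>. 1 / (t + u))"
  using nonneg by (intro integral_positive integrable_inverse_shift) auto

lemma norm_sq_integrable: "w \<in> slit \<Longrightarrow> integrable \<mu> (\<lambda>t. (norm (1 / (complex_of_real t + w)))\<^sup>2)"
  using resolvent_power_integrable[of w 2, THEN integrable_norm] by (simp add: norm_power)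

lemma norm_sq_positive: "w \<in> slit \<Longrightarrow> 0 < (LINT t|\<mu>. (norm (1 / (complex_of_real t + w)))\<^sup>2)"
proof (rule integral_positive[OF norm_sq_integrable])
  assume w: "w \<in> slit"
  show "AE t in \<mu>. 0 < (norm (1 / (complex_of_real t + w)))\<^sup>2"
    using nonneg
  proof eventually_elim
    case (elim t)
    have "1 / (complex_of_real t + w) \<noteq> 0" using slit_nonzero[OF w elim] by simp
    then show ?case by (simp only: zero_less_power2 norm_eq_zero) simp
  qed
qed

lemma Im_transform:
  assumes "w \<in> slit"
  shows "Im (transform w) = - Im w * (LINT t|\<mu>. (norm (1 / (complex_of_real t + w)))\<^sup>2)"
proof -
  have "Im (transform w) = (LINT t|\<mu>. Im (1 / (complex_of_real t + w)))"
    unfolding transform_eq using transform_integrable[OF assms] by (rule integral_Im[symmetric])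
  also have "\<dots> = (LINT t|\<mu>. - Im w * (norm (1 / (complex_of_real t + w)))\<^sup>2)"
    by (intro Bochner_Integration.integral_cong refl)
      (simp add: Im_divide norm_divide cmod_power2 power_divide)
  finally show ?thesis by simp
qed

text \<open>Positive numbers go to positive numbers, and otherwise the imaginary part changes sign
  without vanishing. Hence one transform may be composed with another on the whole slit
  plane.\<close>

lemma transform_in_slit:
  assumes "w \<in> slit" shows "transform w \<in> slit"
proof (cases "Im w = 0")
  case True
  with assms have "0 < Re w" "w = of_real (Re w)" by (auto simp: slit_def complex_eq_iff)
  then have "transform w = of_real (LINT t|\<mu>. 1 / (t + Re w))" "0 < (LINT t|\<mu>. 1 / (t + Re w))"
    using transform_of_real[of "Re w"] inverse_shift_positive[of "Re w"] by simp_all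
  then show ?thesis by (simp only: of_real_slit)
next
  case False
  then have "Im (transform w) \<noteq> 0"
    unfolding Im_transform[OF assms] using norm_sq_positive[OF assms] by simp
  then show ?thesis by (simp add: slit_def)
qed

end

section \<open>The fixed-point equation in the upper half-plane\<close>

lemma scaled_slit: "0 < c \<Longrightarrow> w \<in> slit \<Longrightarrow> of_real c * w \<in> slit"
  by (auto simp: slit_def)

text \<open>Comparing imaginary parts gives \<open>c |s|\<^sup>2 E |T + c s|\<^sup>-\<^sup>2 < 1\<close> for every solution, so by
  Cauchy--Schwarz the map has no two fixed points.\<close>

lemma upper_half_plane_unique:
  assumes \<kappa>: "positive_law \<kappa>" and c: "0 < c" and z: "0 < Im z"
    and s1: "0 < Im s1" "1 + z * s1 = s1 * positive_law.shifted_moment \<kappa> 1 (of_real c * s1)"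
    and s2: "0 < Im s2" "1 + z * s2 = s2 * positive_law.shifted_moment \<kappa> 1 (of_real c * s2)"
  shows "s1 = s2"
proof -
  interpret positive_law \<kappa> by fact
  have in_slit: "of_real c * s \<in> slit" if "0 < Im s" for s using that c by (auto simp: slit_def)
  define I where "I s = (LINT t|\<kappa>. (norm (1 / (complex_of_real t + of_real c * s)))\<^sup>2)" for s
  have small: "c * (norm s)\<^sup>2 * I s < 1"
    if s: "0 < Im s" "1 + z * s = s * transform (of_real c * s)" for s
  proof -
    have s0: "s \<noteq> 0" using s(1) by auto
    have "1 / s + z = transform (of_real c * s)" using s(2) s0 by (simp add: field_simps)
    then have "Im (1 / s) + Im z = - (c * Im s) * I s"
      using Im_transform[OF in_slit[OF s(1)]] by (simp add: I_def flip: plus_complex.sel)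
    moreover have "Im (1 / s) = - Im s / (norm s)\<^sup>2" by (simp add: Im_divide cmod_power2)
    ultimately have "Im s / (norm s)\<^sup>2 = Im z + c * Im s * I s" by simp
    then have "c * Im s * I s < Im s / (norm s)\<^sup>2" using z by simp
    then have "Im s * (c * (norm s)\<^sup>2 * I s) < Im s * 1" using s0 by (simp add: field_simps)
    then show ?thesis using s(1) by (simp only: mult_less_cancel_left_pos)
  qed
  show ?thesis
  proof (rule ccontr)
    assume ne: "s1 \<noteq> s2"
    have nz: "s1 \<noteq> 0" "s2 \<noteq> 0" using s1 s2 by auto
    let ?A = "\<lambda>t. 1 / (complex_of_real t + of_real c * s1)" and ?B = "\<lambda>t. 1 / (complex_of_real t + of_real c * s2)"
    define K where "K = (CLINT t|\<kappa>. ?A t * ?B t)"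
    have iA: "integrable \<kappa> ?A" and iB: "integrable \<kappa> ?B"
      by (rule transform_integrable, rule in_slit, rule s1 s2)+
    have "transform (of_real c * s1) - transform (of_real c * s2) = (CLINT t|\<kappa>. ?A t - ?B t)"
      unfolding transform_eq using iA iB by simp
    also have "\<dots> = (CLINT t|\<kappa>. of_real c * (s2 - s1) * (?A t * ?B t))"
    proof (rule integral_cong_AE)
      show "AE t in \<kappa>. ?A t - ?B t = of_real c * (s2 - s1) * (?A t * ?B t)"
        using nonneg
      proof eventually_elim
        case (elim t)
        then show ?case
          using slit_nonzero[OF in_slit[OF s1(1)] elim] slit_nonzero[OF in_slit[OF s2(1)] elim]
          by (simp add: field_simps)
      qed
    qed auto
    also have "\<dots> = of_real c * (s2 - s1) * K" unfolding K_def by (rule integral_mult_right_zero)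
    finally have diff: "transform (of_real c * s1) - transform (of_real c * s2) = of_real c * (s2 - s1) * K" .
    have "transform (of_real c * s1) = 1 / s1 + z" "transform (of_real c * s2) = 1 / s2 + z"
      using s1(2) s2(2) nz by (simp_all add: field_simps)
    with diff have "1 / s1 - 1 / s2 = of_real c * (s2 - s1) * K" by (simp only: add_diff_cancel_right)
    then have "(s2 - s1) * (1 - of_real c * (s1 * s2 * K)) = 0" using nz by (simp add: field_simps)
    then have one: "of_real c * (s1 * s2 * K) = 1" using ne by simp
    have "norm (s1 * s2 * K) = norm (CLINT t|\<kappa>. s1 * s2 * (?A t * ?B t))"
      unfolding K_def by (simp only: integral_mult_right_zero)
    also have "\<dots> \<le> (LINT t|\<kappa>. norm (s1 * s2 * (?A t * ?B t)))" by (rule integral_norm_bound)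
    also have "\<dots> \<le> (LINT t|\<kappa>. ((norm s1)\<^sup>2 * (norm (?A t))\<^sup>2 + (norm s2)\<^sup>2 * (norm (?B t))\<^sup>2) / 2)"
    proof (rule integral_mono')
      show "integrable \<kappa> (\<lambda>t. ((norm s1)\<^sup>2 * (norm (?A t))\<^sup>2 + (norm s2)\<^sup>2 * (norm (?B t))\<^sup>2) / 2)"
        using norm_sq_integrable[OF in_slit[OF s1(1)]] norm_sq_integrable[OF in_slit[OF s2(1)]] by simp
      fix t
      have "0 \<le> (norm s1 * norm (?A t) - norm s2 * norm (?B t))\<^sup>2" by simp
      then show "norm (s1 * s2 * (?A t * ?B t)) \<le> ((norm s1)\<^sup>2 * (norm (?A t))\<^sup>2 + (norm s2)\<^sup>2 * (norm (?B t))\<^sup>2) / 2"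
        unfolding norm_mult by (simp add: power2_eq_square algebra_simps)
    qed simp
    also have "\<dots> = ((norm s1)\<^sup>2 * I s1 + (norm s2)\<^sup>2 * I s2) / 2"
      unfolding I_def using norm_sq_integrable[OF in_slit[OF s1(1)]] norm_sq_integrable[OF in_slit[OF s2(1)]] by simp
    finally have "c * norm (s1 * s2 * K) \<le> c * (((norm s1)\<^sup>2 * I s1 + (norm s2)\<^sup>2 * I s2) / 2)"
      using c by (intro mult_left_mono) auto
    also have "\<dots> < 1" using small[OF s1] small[OF s2] by (simp add: algebra_simps)
    finally have "norm (of_real c * (s1 * s2 * K)) < 1" using c by (simp add: norm_mult)
    then show False unfolding one by simp
  qed
qed

text \<open>The equation composes the transform of \<mu> with that of \<kappa>, which is holomorphic
  on the slit plane. Vanishing at the positive rationals propagates to w = - z, where the transform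
  of \<mu> is the Stieltjes transform at z; uniqueness then leaves no other solution.\<close>

theorem stieltjes_characterization:
  assumes \<mu>: "positive_law \<mu>" and \<kappa>: "positive_law \<kappa>" and c: "0 < c"
    and real: "\<And>u. u \<in> \<rat> \<Longrightarrow> 0 < u \<Longrightarrow>
      1 - u * (LINT t|\<mu>. 1 / (t + u)) = (LINT t|\<mu>. 1 / (t + u)) * (LINT t|\<kappa>. 1 / (t + c * (LINT t|\<mu>. 1 / (t + u))))"
    and z: "0 < Im z"
  shows "{s. 0 < Im s \<and> 1 + z * s = s * positive_law.shifted_moment \<kappa> 1 (of_real c * s)} = {stieltjes \<mu> z}"
proof -
  interpret M: positive_law \<mu> by fact
  interpret K: positive_law \<kappa> by fact
  define \<Phi> where "\<Phi> w = 1 - w * M.transform w - M.transform w * K.transform (of_real c * M.transform w)" for w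
  have "\<Phi> w = 0" if "w \<in> slit" for w
  proof (rule zero_on_slit[OF _ _ that])
    have "(\<lambda>w. of_real c * M.transform w) holomorphic_on slit"
      by (intro holomorphic_intros M.transform_holomorphic)
    then have "(K.transform \<circ> (\<lambda>w. of_real c * M.transform w)) holomorphic_on slit"
      by (rule holomorphic_on_compose_gen[OF _ K.transform_holomorphic])
        (intro image_subsetI scaled_slit[OF c] M.transform_in_slit)
    then show "\<Phi> holomorphic_on slit"
      unfolding \<Phi>_def comp_def by (intro holomorphic_intros M.transform_holomorphic)
    fix u :: real assume u: "u \<in> \<rat>" "0 < u"
    let ?m = "LINT t|\<mu>. 1 / (t + u)"
    have "\<Phi> (of_real u) = of_real (1 - u * ?m - ?m * (LINT t|\<kappa>. 1 / (t + c * ?m)))"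
      unfolding \<Phi>_def M.transform_of_real of_real_mult[symmetric] K.transform_of_real by simp
    then show "\<Phi> (of_real u) = 0" using real[OF u] by simp
  qed
  moreover have mz: "- z \<in> slit" using z by (simp add: slit_def)
  moreover have st: "M.transform (- z) = stieltjes \<mu> z" unfolding M.transform_eq stieltjes_def by simp
  ultimately have "1 - (- z) * stieltjes \<mu> z - stieltjes \<mu> z * K.transform (of_real c * stieltjes \<mu> z) = 0"
    unfolding \<Phi>_def by fastforce
  then have "1 + z * stieltjes \<mu> z = stieltjes \<mu> z * K.transform (of_real c * stieltjes \<mu> z)" by simp
  moreover have "0 < Im (stieltjes \<mu> z)"
    using M.Im_transform[OF mz] M.norm_sq_positive[OF mz] z unfolding st by simp
  ultimately show ?thesis
    using upper_half_plane_unique[OF \<kappa> c z] by blast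
qed

section \<open>Weak convergence from transforms\<close>

text \<open>Equal transforms have equal derivatives of every order, so the variables 1 / (1 + t),
  with values in [0, 1], have equal moments and therefore equal characteristic functions; t is
  recovered as 1 / y - 1.\<close>

lemma positive_law_eqI:
  assumes \<mu>: "positive_law \<mu>" and \<nu>: "positive_law \<nu>"
    and eq: "\<And>u. u \<in> \<rat> \<Longrightarrow> 0 < u \<Longrightarrow> (LINT t|\<mu>. 1 / (t + u)) = (LINT t|\<nu>. 1 / (t + u))"
  shows "\<mu> = \<nu>"
proof -
  interpret M: positive_law \<mu> by fact
  interpret N: positive_law \<nu> by fact
  have base: "M.shifted_moment 1 w = N.shifted_moment 1 w" if "w \<in> slit" for w
  proof -
    have "M.shifted_moment 1 w - N.shifted_moment 1 w = 0"
    proof (rule zero_on_slit[OF _ _ that])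
      show "(\<lambda>w. M.shifted_moment 1 w - N.shifted_moment 1 w) holomorphic_on slit"
        by (intro holomorphic_intros M.transform_holomorphic N.transform_holomorphic)
      show "M.shifted_moment 1 (of_real u) - N.shifted_moment 1 (of_real u) = 0" if "u \<in> \<rat>" "0 < u" for u
        unfolding M.transform_of_real N.transform_of_real by (simp only: eq[OF that]) simp
    qed
    then show ?thesis by (simp only: right_minus_eq)
  qed
  have all: "\<forall>w\<in>slit. M.shifted_moment (Suc k) w = N.shifted_moment (Suc k) w" for k
  proof (induction k)
    case 0
    then show ?case using base by (simp only: One_nat_def) blast
  next
    case (Suc k)
    show ?case
    proof
      fix w assume w: "w \<in> slit"
      have "(N.shifted_moment (Suc k) has_field_derivative - of_nat (Suc k) * M.shifted_moment (Suc (Suc k)) w) (at w)"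
        using M.shifted_moment_derivative[OF w, of "Suc k"]
        by (rule has_field_derivative_transform_within_open[OF _ open_slit w]) (use Suc in blast)
      from DERIV_unique[OF this N.shifted_moment_derivative[OF w, of "Suc k"]]
      show "M.shifted_moment (Suc (Suc k)) w = N.shifted_moment (Suc (Suc k)) w"
        by (simp only: mult_cancel_left neg_equal_0_iff_equal of_nat_eq_0_iff) simp
    qed
  qed
  \<comment> \<open>The absolute value keeps y in [0, 1] on the whole line, also on the null set of
    negative t.\<close>
  define y where "y t = 1 / (\<bar>t\<bar> + 1)" for t :: real
  have ym[measurable]: "y \<in> borel_measurable borel" unfolding y_def by measurable
  have y01: "0 \<le> y t" "y t \<le> 1" for t by (simp_all add: y_def)
  have moments: "(LINT t|\<mu>. y t ^ k) = (LINT t|\<nu>. y t ^ k)" for k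
  proof (cases k)
    case 0
    then show ?thesis using M.prob_space N.prob_space by simp
  next
    case (Suc l)
    have re: "positive_law.shifted_moment P k 1 = of_real (LINT t|P. y t ^ k)" if P: "positive_law P" for P
    proof -
      interpret P: positive_law P by fact
      have "P.shifted_moment k 1 = (CLINT t|P. of_real (y t ^ k))"
        unfolding P.shifted_moment_def using P.nonneg
        by (intro integral_cong_AE) (auto simp: y_def)
      then show ?thesis by (simp only: integral_complex_of_real)
    qed
    have "(1::complex) \<in> slit" by (simp add: slit_def)
    then have "M.shifted_moment k 1 = N.shifted_moment k 1" using all[of l] Suc by blast
    then show ?thesis unfolding re[OF \<mu>] re[OF \<nu>] by (simp only: of_real_eq_iff)
  qed
  let ?P = "distr \<mu> borel y" and ?Q = "distr \<nu> borel y"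
  have rP: "real_distribution ?P" and rQ: "real_distribution ?Q"
    by (auto intro!: M.real_distribution_distr N.real_distribution_distr)
  interpret P: real_distribution ?P by (rule rP)
  interpret Q: real_distribution ?Q by (rule rQ)
  have mP: "(LINT x|?P. x ^ k) = (LINT t|\<mu>. y t ^ k)" for k by (subst integral_distr) auto
  have mQ: "(LINT x|?Q. x ^ k) = (LINT t|\<nu>. y t ^ k)" for k by (subst integral_distr) auto
  have bd: "AE x in distr R borel y. norm (x ^ k) \<le> 1" if "sets R = sets borel" for R k
  proof -
    have ymR: "y \<in> borel_measurable R" by (subst measurable_cong_sets[OF that refl]) (rule ym)
    have meas: "{x \<in> space borel. norm ((x::real) ^ k) \<le> 1} \<in> sets borel" by measurable
    have AE: "AE t in R. norm (y t ^ k) \<le> 1"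
      by (intro AE_I2) (simp add: norm_power power_le_one y01)
    show ?thesis by (rule iffD2[OF AE_distr_iff[OF ymR meas] AE])
  qed
  have iP: "integrable ?P (\<lambda>x. x ^ k)" for k using bd[of \<mu> k, OF M.events_eq_borel] by (intro P.integrable_const_bound[where B = 1]) auto
  have iQ: "integrable ?Q (\<lambda>x. x ^ k)" for k using bd[of \<nu> k, OF N.events_eq_borel] by (intro Q.integrable_const_bound[where B = 1]) auto
  have aP: "(LINT x|?P. \<bar>x\<bar> ^ k) \<le> 1" for k
  proof -
    have "(LINT x|?P. \<bar>x\<bar> ^ k) \<le> (LINT x|?P. 1)"
    proof (rule integral_mono_AE)
      show "integrable ?P (\<lambda>x. \<bar>x\<bar> ^ k)" using integrable_abs[OF iP[of k]] by (simp only: power_abs)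
      show "AE x in ?P. \<bar>x\<bar> ^ k \<le> 1" using bd[of \<mu> k] by (simp only: real_norm_def power_abs M.events_eq_borel N.events_eq_borel)
    qed simp
    then show ?thesis using P.prob_space by simp
  qed
  have aQ: "(LINT x|?Q. \<bar>x\<bar> ^ k) \<le> 1" for k
  proof -
    have "(LINT x|?Q. \<bar>x\<bar> ^ k) \<le> (LINT x|?Q. 1)"
    proof (rule integral_mono_AE)
      show "integrable ?Q (\<lambda>x. \<bar>x\<bar> ^ k)" using integrable_abs[OF iQ[of k]] by (simp only: power_abs)
      show "AE x in ?Q. \<bar>x\<bar> ^ k \<le> 1" using bd[of \<nu> k] by (simp only: real_norm_def power_abs M.events_eq_borel N.events_eq_borel)
    qed simp
    then show ?thesis using Q.prob_space by simp
  qed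
  have "char ?P = char ?Q"
  proof
    fix t
    \<comment> \<open>Both characteristic functions share the Taylor polynomial \<open>T\<close>;
      each is off by at most 2 |t|^n / n!, since absolute moments on [0, 1] are at most 1.\<close>
    have "norm (char ?P t - char ?Q t) \<le> 4 * (\<bar>t\<bar> ^ n / fact n)" for n
    proof -
      define T where "T = (\<Sum>k \<le> n. ((\<i> * t)^k / fact k) * (LINT x|?P. x^k))"
      have T': "T = (\<Sum>k \<le> n. ((\<i> * t)^k / fact k) * (LINT x|?Q. x^k))"
        unfolding T_def mP mQ moments ..
      have p: "0 \<le> 2 * \<bar>t\<bar>^n / fact n" by simp
      have "norm (char ?P t - T) \<le> (2 * \<bar>t\<bar>^n / fact n) * (LINT x|?P. \<bar>x\<bar> ^ n)"
        unfolding T_def by (rule P.char_approx1[OF iP])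
      also have "\<dots> \<le> (2 * \<bar>t\<bar>^n / fact n) * 1" by (rule mult_left_mono[OF aP p])
      finally have 1: "norm (char ?P t - T) \<le> 2 * \<bar>t\<bar>^n / fact n" by simp
      have "norm (char ?Q t - T) \<le> (2 * \<bar>t\<bar>^n / fact n) * (LINT x|?Q. \<bar>x\<bar> ^ n)"
        unfolding T' by (rule Q.char_approx1[OF iQ])
      also have "\<dots> \<le> (2 * \<bar>t\<bar>^n / fact n) * 1" by (rule mult_left_mono[OF aQ p])
      finally have 2: "norm (char ?Q t - T) \<le> 2 * \<bar>t\<bar>^n / fact n" by simp
      have "norm (char ?P t - char ?Q t) \<le> norm (char ?P t - T) + norm (char ?Q t - T)"
        using norm_triangle_ineq4[of "char ?P t - T" "char ?Q t - T"] by simp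
      with 1 2 show ?thesis by simp
    qed
    moreover have "(\<lambda>n. 4 * (\<bar>t\<bar> ^ n / fact n)) \<longlonglongrightarrow> 4 * 0"
      by (intro tendsto_mult tendsto_const summable_LIMSEQ_zero)
        (use summable_exp[of "\<bar>t\<bar>"] in \<open>simp add: field_simps\<close>)
    ultimately have "norm (char ?P t - char ?Q t) \<le> 0"
      by (intro LIMSEQ_le_const[of "\<lambda>n. 4 * (\<bar>t\<bar> ^ n / fact n)"]) auto
    then show "char ?P t = char ?Q t" by simp
  qed
  then have PQ: "?P = ?Q" by (rule Levy_uniqueness[OF rP rQ])
  define f where "f x = 1 / x - 1" for x :: real
  have fm[measurable]: "f \<in> borel_measurable borel" unfolding f_def by measurable
  have undo: "distr (distr R borel y) borel f = R" if R: "positive_law R" for R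
  proof -
    interpret R: positive_law R by fact
    have "distr (distr R borel y) borel f = distr R borel (f \<circ> y)"
      by (intro distr_distr) auto
    also have "\<dots> = distr R borel (\<lambda>t. t)"
    proof (intro distr_cong_AE refl)
      show "AE t in R. (f \<circ> y) t = t" using R.nonneg by eventually_elim (simp add: f_def y_def)
    qed auto
    also have "\<dots> = R" by (rule distr_id2) simp
    finally show ?thesis .
  qed
  show ?thesis using undo[OF \<mu>, unfolded PQ undo[OF \<nu>]] by (rule sym)
qed

lemma real_distribution_interval:
  assumes "real_distribution \<mu>" "0 < \<epsilon>"
  shows "\<exists>K>0. 1 - \<epsilon> < Sigma_Algebra.measure \<mu> {- K<..K}"
proof -
  interpret real_distribution \<mu> by fact
  let ?A = "\<lambda>n. {- real (Suc n)<..real (Suc n)}"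
  have "(\<lambda>n. prob (?A n)) \<longlonglongrightarrow> prob (\<Union>n. ?A n)"
    by (rule finite_Lim_measure_incseq) (auto simp: incseq_def)
  moreover have "x \<in> (\<Union>n. ?A n)" for x
  proof -
    obtain n where "\<bar>x\<bar> < real n" using reals_Archimedean2 by blast
    then show ?thesis by (intro UN_I[of n]) auto
  qed
  then have "(\<Union>n. ?A n) = UNIV" by blast
  ultimately have "(\<lambda>n. prob (?A n)) \<longlonglongrightarrow> 1" using prob_space by simp
  then have "\<forall>\<^sub>F n in sequentially. 1 - \<epsilon> < prob (?A n)"
    by (rule order_tendstoD(1)) (use assms(2) in simp)
  then obtain n where "1 - \<epsilon> < prob (?A n)" by (auto simp: eventually_sequentially)
  then show ?thesis by (intro exI[of _ "real (Suc n)"]) auto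
qed

text \<open>For t >= 0, 2 u / (t + u) - 1 is at most 1, and at most 0 when t > u. So a value of u
  m(u) close to 1 leaves little mass beyond u.\<close>

lemma positive_law_tail:
  assumes \<mu>: "positive_law \<mu>" and u: "0 < u"
  shows "1 - 2 * (1 - u * (LINT t|\<mu>. 1 / (t + u))) \<le> Sigma_Algebra.measure \<mu> {- u<..u}"
proof -
  interpret positive_law \<mu> by fact
  let ?I = "{- u<..u}"
  have "(LINT t|\<mu>. 2 * u * (1 / (t + u)) - 1) \<le> (LINT t|\<mu>. indicator ?I t)"
  proof (intro integral_mono_AE)
    show "integrable \<mu> (\<lambda>t. 2 * u * (1 / (t + u)) - 1)"
      by (intro Bochner_Integration.integrable_diff integrable_mult_right integrable_inverse_shift u integrable_const)
    show "integrable \<mu> (\<lambda>t. indicator ?I t :: real)"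
      by (intro integrable_const_bound[where B = 1]) auto
    show "AE t in \<mu>. 2 * u * (1 / (t + u)) - 1 \<le> indicator ?I t"
      using nonneg
    proof eventually_elim
      case (elim t)
      show ?case
      proof (cases "t \<le> u")
        case True
        have "2 * u * (1 / (t + u)) \<le> 2" using elim u by (simp add: field_simps)
        then show ?thesis using True elim u by simp
      next
        case False
        have "2 * u * (1 / (t + u)) \<le> 1" using False u by (simp add: field_simps)
        then show ?thesis using False by simp
      qed
    qed
  qed
  moreover have "(LINT t|\<mu>. 2 * u * (1 / (t + u)) - 1) = 2 * u * (LINT t|\<mu>. 1 / (t + u)) - 1"
  proof -
    have "(LINT t|\<mu>. 2 * u * (1 / (t + u)) - 1) = (LINT t|\<mu>. 2 * u * (1 / (t + u))) - (LINT t|\<mu>. 1)"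
      by (intro Bochner_Integration.integral_diff integrable_mult_right integrable_inverse_shift u integrable_const)
    also have "(LINT t|\<mu>. 2 * u * (1 / (t + u))) = 2 * u * (LINT t|\<mu>. 1 / (t + u))"
      by (rule integral_mult_right_zero)
    finally show ?thesis using prob_space by simp
  qed
  ultimately show ?thesis by simp
qed

lemma positive_limit_law:
  assumes \<mu>: "\<And>n. positive_law (\<mu> n)" and \<nu>: "real_distribution \<nu>" and conv: "weak_conv_m \<mu> \<nu>"
    and lim: "\<And>u. u \<in> \<rat> \<Longrightarrow> 0 < u \<Longrightarrow> (\<lambda>n. LINT t|\<mu> n. 1 / (t + u)) \<longlonglongrightarrow> m u"
  shows "positive_law \<nu>" and "\<And>u. u \<in> \<rat> \<Longrightarrow> 0 < u \<Longrightarrow> (LINT t|\<nu>. 1 / (t + u)) = m u"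
proof -
  interpret N: real_distribution \<nu> by fact
  have rd: "real_distribution (\<mu> n)" for n using \<mu>[of n] by (simp add: positive_law_def)
  have AE: "AE t in \<mu> n. 0 \<le> t" for n using \<mu>[of n] by (simp add: positive_law_def positive_law_axioms_def)
  \<comment> \<open>A bounded continuous test function that vanishes exactly on the half-line, so
    that weak limits cannot acquire negative mass.\<close>
  let ?g = "\<lambda>t::real. min 1 (max 0 (- t))"
  have "(\<lambda>n. LINT t|\<mu> n. ?g t) \<longlonglongrightarrow> (LINT t|\<nu>. ?g t)"
    by (rule weak_conv_imp_integral_bdd_continuous_conv[OF rd \<nu> conv, where B = 1]) (auto intro!: continuous_intros)
  moreover have "(LINT t|\<mu> n. ?g t) = 0" for n
    by (intro integral_eq_zero_AE) (use AE[of n] in \<open>eventually_elim, auto\<close>)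
  ultimately have z: "(LINT t|\<nu>. ?g t) = 0" by (simp add: LIMSEQ_const_iff)
  have ig: "integrable \<nu> ?g" by (intro N.integrable_const_bound[where B = 1]) auto
  have "AE t in \<nu>. ?g t = 0"
    using integral_nonneg_eq_0_iff_AE[OF ig] z by auto
  then have nn: "AE t in \<nu>. 0 \<le> t" by eventually_elim (auto simp: min_def max_def split: if_splits)
  then show pl: "positive_law \<nu>" using \<nu> by (simp add: positive_law_def positive_law_axioms_def)
  fix u :: real assume u: "u \<in> \<rat>" "0 < u"
  \<comment> \<open>1 / (t + u) has a pole at - u; cutting off at t = 0 makes it bounded and
    continuous and changes it only on null sets.\<close>
  let ?h = "\<lambda>t::real. 1 / (max 0 t + u)"
  have hb: "norm (?h t) \<le> 1 / u" for t using u(2) by (simp add: frac_le)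
  have hc: "isCont ?h t" for t
  proof -
    have "max 0 t + u \<noteq> 0" using u(2) by (simp add: max_def)
    then show ?thesis by (intro continuous_intros) auto
  qed
  have "(\<lambda>n. LINT t|\<mu> n. ?h t) \<longlonglongrightarrow> (LINT t|\<nu>. ?h t)"
    by (rule weak_conv_imp_integral_bdd_continuous_conv[OF rd \<nu> conv hc hb])
  moreover have "(LINT t|\<mu> n. ?h t) = (LINT t|\<mu> n. 1 / (t + u))" for n
  proof -
    interpret Mn: real_distribution "\<mu> n" by (rule rd)
    show ?thesis using AE[of n] by (intro integral_cong_AE) auto
  qed
  moreover have "(LINT t|\<nu>. ?h t) = (LINT t|\<nu>. 1 / (t + u))"
    using nn by (intro integral_cong_AE) auto
  ultimately have "(\<lambda>n. LINT t|\<mu> n. 1 / (t + u)) \<longlonglongrightarrow> (LINT t|\<nu>. 1 / (t + u))" by simp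
  then show "(LINT t|\<nu>. 1 / (t + u)) = m u" by (rule LIMSEQ_unique[OF _ lim[OF u]])
qed

text \<open>The condition u m(u) -> 1 along the integers prevents mass from escaping to infinity and
  gives tightness. Every subsequential limit has transform m on the rationals, so all of them
  coincide.\<close>

theorem weak_convergence_from_transforms:
  assumes \<mu>: "\<And>n. positive_law (\<mu> n)"
    and lim: "\<And>u. u \<in> \<rat> \<Longrightarrow> 0 < u \<Longrightarrow> (\<lambda>n. LINT t|\<mu> n. 1 / (t + u)) \<longlonglongrightarrow> m u"
    and mass: "(\<lambda>k. real (Suc k) * m (real (Suc k))) \<longlonglongrightarrow> 1"
  shows "\<exists>\<nu>. positive_law \<nu> \<and> weak_conv_m \<mu> \<nu> \<and> (\<forall>u\<in>\<rat>. 0 < u \<longrightarrow> (LINT t|\<nu>. 1 / (t + u)) = m u)"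
proof -
  have rd: "real_distribution (\<mu> n)" for n using \<mu>[of n] by (simp add: positive_law_def)
  have tight: "tight \<mu>"
    unfolding tight_def
  proof (intro conjI allI impI rd)
    fix \<epsilon> :: real assume e: "0 < \<epsilon>"
    have "\<forall>\<^sub>F k in sequentially. 1 - \<epsilon> / 4 < real (Suc k) * m (real (Suc k))"
      by (rule order_tendstoD(1)[OF mass]) (use e in simp)
    then obtain k where k: "1 - \<epsilon> / 4 < real (Suc k) * m (real (Suc k))" by (auto simp: eventually_sequentially)
    define u where "u = real (Suc k)"
    have u: "u \<in> \<rat>" "0 < u" by (auto simp: u_def simp del: of_nat_Suc)
    have "(\<lambda>n. u * (LINT t|\<mu> n. 1 / (t + u))) \<longlonglongrightarrow> u * m u" by (intro tendsto_intros lim u)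
    then have "\<forall>\<^sub>F n in sequentially. 1 - \<epsilon> / 4 < u * (LINT t|\<mu> n. 1 / (t + u))"
      by (rule order_tendstoD(1)) (use k in \<open>simp add: u_def\<close>)
    then obtain n0 where n0: "\<And>n. n0 \<le> n \<Longrightarrow> 1 - \<epsilon> / 4 < u * (LINT t|\<mu> n. 1 / (t + u))"
      by (auto simp: eventually_sequentially)
    have "\<forall>n. \<exists>K>0. 1 - \<epsilon> < Sigma_Algebra.measure (\<mu> n) {- K<..K}"
      using real_distribution_interval[OF rd e] by blast
    then obtain K where K: "\<And>n. 0 < K n" "\<And>n. 1 - \<epsilon> < Sigma_Algebra.measure (\<mu> n) {- K n<..K n}" by metis
    \<comment> \<open>The transforms control all but finitely many laws; the remaining ones are
      covered by their own intervals.\<close>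
    define b where "b = Max (insert u (K ` {..<n0}))"
    have ub: "u \<le> b" unfolding b_def by (rule Max_ge) auto
    have Kb: "K n \<le> b" if "n < n0" for n unfolding b_def by (rule Max_ge) (use that in auto)
    have "1 - \<epsilon> < Sigma_Algebra.measure (\<mu> n) {- b<..b}" for n
    proof -
      interpret Mn: real_distribution "\<mu> n" by (rule rd)
      show ?thesis
      proof (cases "n < n0")
        case True
        have "Mn.prob {- K n<..K n} \<le> Mn.prob {- b<..b}"
          using Kb[OF True] by (intro Mn.finite_measure_mono) auto
        then show ?thesis using K(2)[of n] by linarith
      next
        case False
        have "1 - \<epsilon> < 1 - 2 * (1 - u * (LINT t|\<mu> n. 1 / (t + u)))" using n0[of n] False e by simp
        also have "\<dots> \<le> Mn.prob {- u<..u}" by (rule positive_law_tail[OF \<mu> u(2)])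
        also have "\<dots> \<le> Mn.prob {- b<..b}" using ub by (intro Mn.finite_measure_mono) auto
        finally show ?thesis .
      qed
    qed
    moreover have "- b < b" using ub u(2) by simp
    ultimately show "\<exists>a b. a < b \<and> (\<forall>n. 1 - \<epsilon> < Sigma_Algebra.measure (\<mu> n) {a<..b})" by blast
  qed
  have sub: "positive_law \<nu> \<and> (\<forall>u\<in>\<rat>. 0 < u \<longrightarrow> (LINT t|\<nu>. 1 / (t + u)) = m u)"
    if s: "strict_mono s" and \<nu>: "real_distribution \<nu>" and conv: "weak_conv_m (\<mu> \<circ> s) \<nu>" for s :: "nat \<Rightarrow> nat" and \<nu>
  proof -
    have 1: "positive_law ((\<mu> \<circ> s) n)" for n using \<mu> by simp
    have 2: "(\<lambda>n. LINT t|(\<mu> \<circ> s) n. 1 / (t + u)) \<longlonglongrightarrow> m u" if "u \<in> \<rat>" "0 < u" for u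
      using LIMSEQ_subseq_LIMSEQ[OF lim[OF that] s] by (simp add: comp_def)
    show ?thesis using positive_limit_law[OF 1 \<nu> conv 2] by blast
  qed
  obtain r \<nu> where r: "strict_mono r" "real_distribution \<nu>" "weak_conv_m (\<mu> \<circ> id \<circ> r) \<nu>"
    using tight_imp_convergent_subsubsequence[OF tight, of id] by (auto simp: strict_mono_def)
  then have pl: "positive_law \<nu>" and tr: "\<forall>u\<in>\<rat>. 0 < u \<longrightarrow> (LINT t|\<nu>. 1 / (t + u)) = m u"
    using sub[of r \<nu>] by auto
  have "weak_conv_m \<mu> \<nu>"
  proof (rule tight_subseq_weak_converge[OF rd r(2) tight])
    fix s \<nu>' assume s: "strict_mono s" and \<nu>': "real_distribution \<nu>'" and conv: "weak_conv_m (\<mu> \<circ> s) \<nu>'"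
    have "\<nu>' = \<nu>"
      using sub[OF s \<nu>' conv] pl tr by (intro positive_law_eqI) auto
    then show "weak_conv_m (\<mu> \<circ> s) \<nu>" using conv by simp
  qed
  then show ?thesis using pl tr by blast
qed

section \<open>The limit theorem\<close>

text \<open>The equation forces m(u) <= 1 / u, so the integrand tends to 0 pointwise and is bounded
  by 1 / c; what is left of the equation is u m(u) -> 1. This rules out a loss of mass in the limit
  law.\<close>

lemma fixed_point_mass:
  fixes R :: "'q \<Rightarrow> real"
  assumes Q: "prob_space Q" and Rm[measurable]: "R \<in> borel_measurable Q" and R: "\<And>\<omega>. 0 < R \<omega>" and c: "0 < c"
    and m: "\<And>u. 0 < u \<Longrightarrow> 0 < m u" "\<And>u. 0 < u \<Longrightarrow> u * m u + (LINT \<omega>|Q. m u * R \<omega> / (1 + c * (m u * R \<omega>))) = 1"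
  shows "(\<lambda>k. real (Suc k) * m (real (Suc k))) \<longlonglongrightarrow> 1"
proof -
  interpret prob_space Q by fact
  define u where "u k = real (Suc k)" for k
  have u: "0 < u k" for k by (simp add: u_def)
  define I where "I k = (LINT \<omega>|Q. m (u k) * R \<omega> / (1 + c * (m (u k) * R \<omega>)))" for k
  have bd: "0 \<le> m (u k) * R \<omega> / (1 + c * (m (u k) * R \<omega>))" "m (u k) * R \<omega> / (1 + c * (m (u k) * R \<omega>)) \<le> 1 / c" for k \<omega>
    using saturate_le_inverse[of "m (u k) * R \<omega>" c] m(1)[OF u] R[of \<omega>] c by (auto simp: less_imp_le)
  have eq: "u k * m (u k) = 1 - I k" for k using m(2)[OF u[of k]] by (simp add: I_def)
  have I0: "0 \<le> I k" for k unfolding I_def by (intro integral_nonneg_AE AE_I2 bd)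
  have m0: "(\<lambda>k. m (u k)) \<longlonglongrightarrow> 0"
  proof (rule real_tendsto_sandwich)
    show "\<forall>\<^sub>F k in sequentially. 0 \<le> m (u k)" using m(1)[OF u] by (simp add: less_imp_le)
    show "\<forall>\<^sub>F k in sequentially. m (u k) \<le> inverse (real (Suc k))"
    proof (intro always_eventually allI)
      fix k
      have "m (u k) * u k \<le> 1" using eq[of k] I0[of k] by (simp add: mult.commute)
      then have "m (u k) \<le> 1 / u k" using u[of k] by (simp add: pos_le_divide_eq)
      then show "m (u k) \<le> inverse (real (Suc k))" by (simp only: u_def inverse_eq_divide)
    qed
    show "(\<lambda>k. inverse (real (Suc k))) \<longlonglongrightarrow> 0" by (rule LIMSEQ_inverse_real_of_nat)
  qed (rule tendsto_const)
  have "I \<longlonglongrightarrow> (LINT \<omega>|Q. 0)"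
    unfolding I_def
  proof (rule integral_dominated_convergence[where w = "\<lambda>_. 1 / c"])
    show "AE \<omega> in Q. (\<lambda>k. m (u k) * R \<omega> / (1 + c * (m (u k) * R \<omega>))) \<longlonglongrightarrow> 0"
    proof (rule AE_I2)
      fix \<omega>
      have "(\<lambda>k. m (u k) * R \<omega> / (1 + c * (m (u k) * R \<omega>))) \<longlonglongrightarrow> 0 * R \<omega> / (1 + c * (0 * R \<omega>))"
        by (intro tendsto_intros m0) simp
      then show "(\<lambda>k. m (u k) * R \<omega> / (1 + c * (m (u k) * R \<omega>))) \<longlonglongrightarrow> 0" by simp
    qed
    show "AE \<omega> in Q. norm (m (u k) * R \<omega> / (1 + c * (m (u k) * R \<omega>))) \<le> 1 / c" for k
    proof (rule AE_I2)
      fix \<omega> show "norm (m (u k) * R \<omega> / (1 + c * (m (u k) * R \<omega>))) \<le> 1 / c"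
        unfolding real_norm_def abs_of_nonneg[OF bd(1)] by (rule bd(2))
    qed
  qed auto
  then have "(\<lambda>k. 1 - I k) \<longlonglongrightarrow> 1 - 0" by (intro tendsto_diff tendsto_const) simp
  then have "(\<lambda>k. u k * m (u k)) \<longlonglongrightarrow> 1" unfolding eq by simp
  then show ?thesis unfolding u_def .
qed

text \<open>From R / (1 + c s R) = 1 / (1 / R + c s): the integral in the equation is the transform
  of the law of 1 / R at c s, and thus fits the theory of laws on the half-line.\<close>

lemma reciprocal_law:
  fixes R :: "'q \<Rightarrow> real"
  assumes Q: "prob_space Q" and Rm[measurable]: "R \<in> borel_measurable Q" and R: "\<And>\<omega>. 0 < R \<omega>"
  defines "\<kappa> \<equiv> distr Q borel (\<lambda>\<omega>. 1 / R \<omega>)"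
  shows "positive_law \<kappa>"
    and "(LINT t|\<kappa>. 1 / (t + c * m)) = (LINT \<omega>|Q. R \<omega> / (1 + c * (m * R \<omega>)))"
    and "positive_law.shifted_moment \<kappa> 1 (of_real c * s)
      = (LINT \<omega>|Q. complex_of_real (R \<omega>) / (1 + complex_of_real (c * R \<omega>) * s))"
proof -
  interpret prob_space Q by fact
  have mm: "(\<lambda>\<omega>. 1 / R \<omega>) \<in> borel_measurable Q" by measurable
  have R0: "R \<omega> \<noteq> 0" for \<omega> using R[of \<omega>] by simp
  have rd: "real_distribution \<kappa>" unfolding \<kappa>_def by (rule real_distribution_distr) (rule mm)
  have "AE t in \<kappa>. 0 \<le> t"
    unfolding \<kappa>_def by (subst AE_distr_iff[OF mm]) (auto simp: less_imp_le[OF R])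
  then show pl: "positive_law \<kappa>" using rd by (simp add: positive_law_def positive_law_axioms_def)
  have "1 / (1 / R \<omega> + c * m) = R \<omega> / (1 + c * (m * R \<omega>))" for \<omega>
  proof -
    have "1 / R \<omega> + c * m = (1 + c * (m * R \<omega>)) / R \<omega>" using R0[of \<omega>] by (simp add: field_simps)
    then show ?thesis by simp
  qed
  then show "(LINT t|\<kappa>. 1 / (t + c * m)) = (LINT \<omega>|Q. R \<omega> / (1 + c * (m * R \<omega>)))"
    unfolding \<kappa>_def by (subst integral_distr[OF mm]) auto
  have "1 / (complex_of_real (1 / R \<omega>) + of_real c * s) = complex_of_real (R \<omega>) / (1 + complex_of_real (c * R \<omega>) * s)" for \<omega>
  proof -
    have "complex_of_real (1 / R \<omega>) + of_real c * s = (1 + complex_of_real (c * R \<omega>) * s) / complex_of_real (R \<omega>)"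
      using R0[of \<omega>] by (simp add: field_simps)
    then show ?thesis by simp
  qed
  then show "positive_law.shifted_moment \<kappa> 1 (of_real c * s)
      = (LINT \<omega>|Q. complex_of_real (R \<omega>) / (1 + complex_of_real (c * R \<omega>) * s))"
    unfolding positive_law.transform_eq[OF pl] unfolding \<kappa>_def by (subst integral_distr[OF mm]) auto
qed

section \<open>Almost sure convergence\<close>

context standardized_law
begin

text \<open>The half of Borel-Cantelli that uses only summability, so the joint behaviour of the
  samples for different n is irrelevant. Independence within one n transports the tail bound from
  the product law.\<close>

lemma tmean_almost_surely:
  fixes d N :: "nat \<Rightarrow> nat" and c lam :: real
    and M :: "'m measure" and x :: "nat \<Rightarrow> nat \<Rightarrow> 'm \<Rightarrow> (nat set \<Rightarrow> real)"
  assumes d: "\<And>n. 1 \<le> n \<Longrightarrow> 1 \<le> d n \<and> d n \<le> n" and N: "\<And>n. 1 \<le> n \<Longrightarrow> 1 \<le> N n"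
    and lam: "(\<lambda>n. (real (d n))\<^sup>2 / real n) \<longlonglongrightarrow> lam" "0 \<le> lam"
    and c: "0 < c" "(\<lambda>n. real (n choose d n) / real (N n)) \<longlonglongrightarrow> c"
    and M: "prob_space M"
    and indep: "\<And>n. 1 \<le> n \<Longrightarrow> prob_space.indep_vars M (\<lambda>_. tensor_space n (d n)) (x n) {1..N n}"
    and law: "\<And>n \<alpha>. 1 \<le> n \<Longrightarrow> \<alpha> \<in> {1..N n} \<Longrightarrow>
       distr M (tensor_space n (d n)) (x n \<alpha>) = sqfree_tensor_law n (d n) D"
    and u: "0 < u" and lim: "(\<lambda>n. tmean_exp n (d n) (N n) u) \<longlonglongrightarrow> s"
  shows "AE \<omega> in M. (\<lambda>n. tmean n (d n) (N n) u (\<lambda>\<alpha>. x n \<alpha> \<omega>)) \<longlonglongrightarrow> s"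
proof -
  interpret M: prob_space M by fact
  \<comment> \<open>Restricted to the index set, because points of a product space are extensional;
    the resolvent does not see the difference.\<close>
  define X where "X n \<omega> = (\<lambda>\<alpha>\<in>{1..N n}. x n \<alpha> \<omega>)" for n \<omega>
  define L where "L n = sample_law n (d n) (N n)" for n
  have X: "X n \<in> measurable M (L n)" "distr M (L n) (X n) = L n" if n: "1 \<le> n" for n
  proof -
    have ne: "{1..N n} \<noteq> {}" using N[OF n] by auto
    have rv: "x n \<alpha> \<in> measurable M (tensor_space n (d n))" if "\<alpha> \<in> {1..N n}" for \<alpha>
      using indep[OF n] that unfolding M.indep_vars_def by blast
    have sL: "sets (L n) = sets (PiM {1..N n} (\<lambda>_. tensor_space n (d n)))"
      unfolding L_def by (intro sets_PiM_cong refl) (simp add: sqfree_tensor_law_def)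
    have "X n \<in> measurable M (PiM {1..N n} (\<lambda>_. tensor_space n (d n)))"
      unfolding X_def by (intro measurable_restrict rv)
    then show "X n \<in> measurable M (L n)" by (subst measurable_cong_sets[OF refl sL])
    have "distr M (L n) (X n) = distr M (PiM {1..N n} (\<lambda>_. tensor_space n (d n))) (X n)"
      by (intro distr_cong refl sL)
    also have "\<dots> = PiM {1..N n} (\<lambda>\<alpha>. distr M (tensor_space n (d n)) (x n \<alpha>))"
      using M.indep_vars_iff_distr_eq_PiM'[OF ne rv, THEN iffD1, OF _ indep[OF n]] unfolding X_def .
    also have "\<dots> = L n" unfolding L_def by (intro PiM_cong refl law n)
    finally show "distr M (L n) (X n) = L n" .
  qed
  have tX: "tmean n (d n) (N n) u (\<lambda>\<alpha>. x n \<alpha> \<omega>) = tmean n (d n) (N n) u (X n \<omega>)" for n \<omega>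
  proof -
    have "resolvent u (real (N n)) (dsubsets n (d n)) {1..N n} (\<lambda>\<alpha>. x n \<alpha> \<omega>)
        = resolvent u (real (N n)) (dsubsets n (d n)) {1..N n} (X n \<omega>)"
      by (rule resolvent_cong) (simp add: X_def)
    then show ?thesis unfolding tmean_def by (simp only:)
  qed
  let ?t = "\<lambda>n \<omega>. tmean n (d n) (N n) u (X n \<omega>)" and ?e = "\<lambda>n. tmean_exp n (d n) (N n) u"
  obtain n0 where n0: "\<And>n. n0 \<le> n \<Longrightarrow> 1 \<le> n \<and> 1 \<le> d n \<and> d n \<le> n \<and> 16 * d n \<le> n \<and> 1 \<le> N n
    \<and> c / 2 < real (n choose d n) / real (N n) \<and> n \<le> n choose d n"
    using eventually_regime[OF d N lam c] unfolding eventually_sequentially by blast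
  have close: "AE \<omega> in M. \<forall>\<^sub>F n in sequentially. \<bar>?t n \<omega> - ?e n\<bar> < \<epsilon>" if e: "0 < \<epsilon>" for \<epsilon>
  proof -
    define A where "A n = (if n0 \<le> n then {\<omega> \<in> space M. \<epsilon> \<le> \<bar>?t n \<omega> - ?e n\<bar>} else {})" for n
    \<comment> \<open>Eventually p >= n and p / N > c / 2, so the exponent p^2 / N is at least n c /
      2.\<close>
    define a where "a = \<epsilon>\<^sup>2 * u\<^sup>2 / 2 * (c / 2)"
    have a0: "0 < a" using e u c(1) by (simp add: a_def)
    have A: "A n \<in> sets M \<and> M.prob (A n) \<le> 2 * exp (- a) ^ n" for n
    proof (cases "n0 \<le> n")
      case True
      note r = n0[OF True]
      then have n: "1 \<le> n" by blast
      define W where "W = {y \<in> space (L n). \<epsilon> \<le> \<bar>tmean n (d n) (N n) u y - ?e n\<bar>}"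
      have m[measurable]: "tmean n (d n) (N n) u \<in> borel_measurable (L n)"
        unfolding L_def by (rule tmean_facts(1)) (use r u in auto)
      have W: "W \<in> sets (L n)" unfolding W_def by measurable
      have eq: "A n = X n -` W \<inter> space M"
        using True measurable_space[OF X(1)[OF n]] by (auto simp: A_def W_def)
      have "M.prob (A n) = Sigma_Algebra.measure (L n) W"
        using measure_distr[OF X(1)[OF n] W] unfolding eq X(2)[OF n] by (rule sym)
      also have "\<dots> \<le> 2 * exp (- (\<epsilon>\<^sup>2 * u\<^sup>2 / 2 * (real (n choose d n) * (real (n choose d n) / real (N n)))))"
        unfolding W_def L_def by (rule tmean_facts(3)) (use r u e in auto)
      also have "\<dots> \<le> 2 * exp (- a) ^ n"
      proof -
        have "real n * (c / 2) \<le> real (n choose d n) * (real (n choose d n) / real (N n))"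
          using r c(1) by (intro mult_mono) (auto simp: less_imp_le)
        then have "\<epsilon>\<^sup>2 * u\<^sup>2 / 2 * (real n * (c / 2)) \<le> \<epsilon>\<^sup>2 * u\<^sup>2 / 2 * (real (n choose d n) * (real (n choose d n) / real (N n)))"
          by (rule mult_left_mono) simp
        also have "\<epsilon>\<^sup>2 * u\<^sup>2 / 2 * (real n * (c / 2)) = - (real n * (- a))" by (simp add: a_def)
        finally show ?thesis unfolding exp_of_nat_mult[symmetric] by simp
      qed
      finally show ?thesis using measurable_sets[OF X(1)[OF n] W] eq by simp
    qed (simp add: A_def)
    have "AE \<omega> in M. \<forall>\<^sub>F n in sequentially. \<omega> \<in> space M - A n"
    proof (rule borel_cantelli_AE1)
      show "summable (\<lambda>n. M.prob (A n))"
      proof (rule summable_comparison_test')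
        show "summable (\<lambda>n. 2 * exp (- a) ^ n)"
          using a0 by (intro summable_mult summable_geometric) simp
        show "norm (M.prob (A n)) \<le> 2 * exp (- a) ^ n" if "n \<ge> 0" for n using A[of n] by simp
      qed
    qed (use A in \<open>auto simp: M.emeasure_eq_measure\<close>)
    then show ?thesis
    proof eventually_elim
      case (elim \<omega>)
      then show ?case using eventually_ge_at_top[of n0]
        by eventually_elim (auto simp: A_def)
    qed
  qed
  have "AE \<omega> in M. \<forall>k. \<forall>\<^sub>F n in sequentially. \<bar>?t n \<omega> - ?e n\<bar> < 1 / real (Suc k)"
    unfolding AE_all_countable by (intro allI close) simp
  then show ?thesis
  proof eventually_elim
    case (elim \<omega>)
    have "(\<lambda>n. ?t n \<omega> - ?e n) \<longlonglongrightarrow> 0"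
    proof (rule tendstoI)
      fix \<epsilon> :: real assume "0 < \<epsilon>"
      then obtain k where k: "1 / real (Suc k) < \<epsilon>" by (rule nat_approx_posE)
      from elim have "\<forall>\<^sub>F n in sequentially. \<bar>?t n \<omega> - ?e n\<bar> < 1 / real (Suc k)" by blast
      then show "\<forall>\<^sub>F n in sequentially. dist (?t n \<omega> - ?e n) 0 < \<epsilon>"
        by eventually_elim (use k in \<open>simp add: dist_real_def\<close>)
    qed
    from tendsto_add[OF this lim] show ?case unfolding tX by simp
  qed
qed

end

lemma esd_sample_cov:
  fixes x :: "nat \<Rightarrow> nat set \<Rightarrow> real"
  assumes d: "d \<le> n" and N: "1 \<le> N"
  defines "E \<equiv> esd (sample_cov n d N x)"
  shows "positive_law E"
    and "0 < u \<Longrightarrow> (LINT t|E. 1 / (t + u))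
      = ktrace (dsubsets n d) (resolvent u N (dsubsets n d) {1..N} x) / card (dsubsets n d)"
proof -
  have fin: "finite (dsubsets n d)" by (rule finite_dsubsets)
  have ne: "dsubsets n d \<noteq> {}"
  proof
    assume "dsubsets n d = {}"
    then have "card (dsubsets n d) = 0" by simp
    then show False using d by (simp add: card_dsubsets)
  qed
  have B: "finite {1..N}" by simp
  have N0: "0 < real N" using N by simp
  note g = esd_gram[OF fin ne B N0, where x = x, folded sample_cov_def, folded E_def]
  show "positive_law E"
    using g(1) real_distribution_esd[of "sample_cov n d N x", folded E_def]
    by (simp add: positive_law_def positive_law_axioms_def)
  assume "0 < u"
  then show "(LINT t|E. 1 / (t + u))
      = ktrace (dsubsets n d) (resolvent u N (dsubsets n d) {1..N} x) / card (dsubsets n d)"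
    by (rule g(2))
qed

theorem theorem2p1:
  fixes P :: "'b measure" and X :: "'b \<Rightarrow> real"
    and Q :: "'c measure" and Z R :: "'c \<Rightarrow> real"
    and M :: "'a measure" and x :: "nat \<Rightarrow> nat \<Rightarrow> 'a \<Rightarrow> (nat set \<Rightarrow> real)"
    and d p N :: "nat \<Rightarrow> nat"
    and S :: "nat \<Rightarrow> 'a \<Rightarrow> real Matrix.mat"
    and v lam c :: real and nu :: "real measure"
  assumes "prob_space P" and "X \<in> borel_measurable P"
    and "integrable P (\<lambda>\<omega>. X \<omega> ^ 4)"
    and "prob_space.expectation P X = 0"
    and "prob_space.expectation P (\<lambda>\<omega>. X \<omega> ^ 2) = 1"
    and v: "v = prob_space.expectation P (\<lambda>\<omega>. X \<omega> ^ 4) - 1"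
    and d: "\<And>n. 1 \<le> n \<Longrightarrow> 1 \<le> d n \<and> d n \<le> n"
    and p: "\<And>n. p n = n choose d n"
    and N: "\<And>n. 1 \<le> n \<Longrightarrow> 1 \<le> N n"
    and "prob_space M"
    and indep: "\<And>n. 1 \<le> n \<Longrightarrow>
       prob_space.indep_vars M (\<lambda>_. tensor_space n (d n)) (x n) {1..N n}"
    and law: "\<And>n \<alpha>. 1 \<le> n \<Longrightarrow> \<alpha> \<in> {1..N n} \<Longrightarrow>
       distr M (tensor_space n (d n)) (x n \<alpha>) = sqfree_tensor_law n (d n) (distr P borel X)"
    and S: "\<And>n \<omega>. S n \<omega> = sample_cov n (d n) (N n) (\<lambda>\<alpha>. x n \<alpha> \<omega>)"
    and "0 \<le> lam" and "(\<lambda>n. real (d n) ^ 2 / real n) \<longlonglongrightarrow> lam"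
    and "0 < c" and "(\<lambda>n. real (p n) / real (N n)) \<longlonglongrightarrow> c"
    and "prob_space Q" and "distributed Q lborel Z std_normal_density"
    and R: "\<And>\<omega>. R \<omega> = exp (sqrt (lam * v) * Z \<omega> - lam * v / 2)"
    and nu: "nu = distr Q borel R"
  shows "\<exists>\<mu>. real_distribution \<mu> \<and> (AE t in \<mu>. 0 \<le> t) \<and>
    (AE \<omega> in M. weak_conv_m (\<lambda>n. esd (S n \<omega>)) \<mu>) \<and>
    (\<forall>z. Im z > 0 \<longrightarrow>
       {s. Im s > 0 \<and>
           1 + z * s = s * (LINT r:{0..}|nu. complex_of_real r / (1 + complex_of_real (c * r) * s))}
         = {stieltjes \<mu> z} \<and>
       {s. Im s > 0 \<and>
           1 / s + z = (LINT \<omega>|Q. complex_of_real (R \<omega>) / (1 + complex_of_real (c * R \<omega>) * s))}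
         = {stieltjes \<mu> z})"
proof -
  interpret P: prob_space P by fact
  interpret Q: prob_space Q by fact
  interpret M: prob_space M by fact
  have [measurable]: "X \<in> borel_measurable P" by fact
  interpret standardized_law "distr P borel X" v
  proof (rule standardized_law.intro)
    show "prob_space (distr P borel X)" by (rule P.prob_space_distr) measurable
    show "integrable (distr P borel X) (\<lambda>t. t ^ 4)"
      using \<open>integrable P (\<lambda>\<omega>. X \<omega> ^ 4)\<close> by (subst integrable_distr_eq) auto
    show "(LINT t|distr P borel X. t) = 0"
      using \<open>prob_space.expectation P X = 0\<close> by (subst integral_distr) auto
    show "(LINT t|distr P borel X. t\<^sup>2) = 1"
      using \<open>prob_space.expectation P (\<lambda>\<omega>. X \<omega> ^ 2) = 1\<close> by (subst integral_distr) auto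
    show "v = (LINT t|distr P borel X. t ^ 4) - 1"
      unfolding v by (subst integral_distr) auto
  qed simp
  have lim_p: "(\<lambda>n. real (n choose d n) / real (N n)) \<longlonglongrightarrow> c"
    using \<open>(\<lambda>n. real (p n) / real (N n)) \<longlonglongrightarrow> c\<close> unfolding p .
  have [measurable]: "Z \<in> borel_measurable Q"
    using distributed_measurable[OF \<open>distributed Q lborel Z std_normal_density\<close>] by simp
  have R_eq: "R = (\<lambda>\<omega>. exp (sqrt (lam * v) * Z \<omega> - lam * v / 2))" by (rule ext) (rule R)
  have Rm[measurable]: "R \<in> borel_measurable Q" unfolding R_eq by measurable
  have R0: "0 < R \<omega>" for \<omega> by (simp add: R)
  have "\<forall>u\<in>{0<..}. \<exists>s. 0 < s \<and> u * s + (LINT \<omega>|Q. s * R \<omega> / (1 + c * (s * R \<omega>))) = 1"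
    using fixed_point_exists[OF \<open>prob_space Q\<close> Rm R0 \<open>0 < c\<close>] by blast
  from bchoice[OF this] obtain m where m: "0 < m u" "u * m u + (LINT \<omega>|Q. m u * R \<omega> / (1 + c * (m u * R \<omega>))) = 1"
    if "0 < u" for u by auto
  have mass: "(\<lambda>k. real (Suc k) * m (real (Suc k))) \<longlonglongrightarrow> 1"
    by (rule fixed_point_mass[OF \<open>prob_space Q\<close> Rm R0 \<open>0 < c\<close> m])
  \<comment> \<open>One event for all rational u at once; as they are countably many it still has
    full measure.\<close>
  define good where "good \<omega> \<longleftrightarrow> (\<forall>u\<in>{u\<in>\<rat>. 0 < u}. (\<lambda>n. tmean n (d n) (N n) u (\<lambda>\<alpha>. x n \<alpha> \<omega>)) \<longlonglongrightarrow> m u)" for \<omega>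
  have ctb: "countable {u\<in>\<rat>. 0 < (u::real)}" by (rule countable_subset[OF _ countable_rat]) auto
  have good: "AE \<omega> in M. good \<omega>"
    unfolding good_def AE_ball_countable[OF ctb]
  proof
    fix u :: real assume "u \<in> {u\<in>\<rat>. 0 < u}"
    then have u: "0 < u" by simp
    have mean: "(\<lambda>n. tmean_exp n (d n) (N n) u) \<longlonglongrightarrow> m u"
      using m[OF u] unfolding R_eq
      by (intro tmean_exp_tendsto[OF d N \<open>(\<lambda>n. real (d n) ^ 2 / real n) \<longlonglongrightarrow> lam\<close> \<open>0 \<le> lam\<close> \<open>0 < c\<close> lim_p u _
        \<open>prob_space Q\<close> \<open>distributed Q lborel Z std_normal_density\<close>])
    show "AE \<omega> in M. (\<lambda>n. tmean n (d n) (N n) u (\<lambda>\<alpha>. x n \<alpha> \<omega>)) \<longlonglongrightarrow> m u"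
      by (rule tmean_almost_surely[where lam = lam and c = c]) fact+
  qed
  have limit: "\<exists>\<nu>. positive_law \<nu> \<and> weak_conv_m (\<lambda>n. esd (S n \<omega>)) \<nu> \<and> (\<forall>u\<in>\<rat>. 0 < u \<longrightarrow> (LINT t|\<nu>. 1 / (t + u)) = m u)"
    if \<omega>: "good \<omega>" for \<omega>
  proof -
    \<comment> \<open>The hypotheses on d and N start at n = 1, so the sequence is shifted by one
      index; the weak limit is not affected.\<close>
    have esd: "positive_law (esd (S (Suc n) \<omega>))"
      "0 < u \<Longrightarrow> (LINT t|esd (S (Suc n) \<omega>). 1 / (t + u)) = tmean (Suc n) (d (Suc n)) (N (Suc n)) u (\<lambda>\<alpha>. x (Suc n) \<alpha> \<omega>)" for n u
      using esd_sample_cov[of "d (Suc n)" "Suc n" "N (Suc n)"] d[of "Suc n"] N[of "Suc n"] unfolding S tmean_def by auto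
    have "\<exists>\<nu>. positive_law \<nu> \<and> weak_conv_m (\<lambda>n. esd (S (Suc n) \<omega>)) \<nu> \<and> (\<forall>u\<in>\<rat>. 0 < u \<longrightarrow> (LINT t|\<nu>. 1 / (t + u)) = m u)"
    proof (rule weak_convergence_from_transforms[OF esd(1) _ mass])
      fix u :: real assume u: "u \<in> \<rat>" "0 < u"
      then have "(\<lambda>n. tmean n (d n) (N n) u (\<lambda>\<alpha>. x n \<alpha> \<omega>)) \<longlonglongrightarrow> m u" using \<omega> unfolding good_def by blast
      from LIMSEQ_Suc[OF this] show "(\<lambda>n. LINT t|esd (S (Suc n) \<omega>). 1 / (t + u)) \<longlonglongrightarrow> m u"
        unfolding esd(2)[OF u(2)] .
    qed
    then obtain \<nu> where \<nu>: "positive_law \<nu>" "weak_conv_m (\<lambda>n. esd (S (Suc n) \<omega>)) \<nu>"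
      "\<forall>u\<in>\<rat>. 0 < u \<longrightarrow> (LINT t|\<nu>. 1 / (t + u)) = m u" by blast
    have "weak_conv_m (\<lambda>n. esd (S n \<omega>)) \<nu>"
      using \<nu>(2) unfolding weak_conv_m_def weak_conv_def by (blast intro: LIMSEQ_imp_Suc)
    then show ?thesis using \<nu> by blast
  qed
  \<comment> \<open>A single good sample point fixes the candidate for the deterministic limit; at
    every other good point the limit has the same transform on the rationals and hence is the same
    law.\<close>
  obtain \<omega>0 where "good \<omega>0" using eventually_happens'[OF M.ae_filter_bot good] by blast
  from limit[OF this] obtain \<mu> where \<mu>: "positive_law \<mu>" "\<And>u. u \<in> \<rat> \<Longrightarrow> 0 < u \<Longrightarrow> (LINT t|\<mu>. 1 / (t + u)) = m u"
    by blast
  have conv: "AE \<omega> in M. weak_conv_m (\<lambda>n. esd (S n \<omega>)) \<mu>"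
    using good
  proof eventually_elim
    case (elim \<omega>)
    from limit[OF this] obtain \<nu> where \<nu>: "positive_law \<nu>" "weak_conv_m (\<lambda>n. esd (S n \<omega>)) \<nu>"
      "\<forall>u\<in>\<rat>. 0 < u \<longrightarrow> (LINT t|\<nu>. 1 / (t + u)) = m u" by blast
    have "\<mu> = \<nu>"
    proof (rule positive_law_eqI[OF \<mu>(1) \<nu>(1)])
      fix u :: real assume u: "u \<in> \<rat>" "0 < u"
      then have "(LINT t|\<nu>. 1 / (t + u)) = m u" using \<nu>(3) by blast
      then show "(LINT t|\<mu>. 1 / (t + u)) = (LINT t|\<nu>. 1 / (t + u))" using \<mu>(2)[OF u] by (simp only:)
    qed
    then show ?case using \<nu>(2) by (simp only:)
  qed
  let ?\<kappa> = "distr Q borel (\<lambda>\<omega>. 1 / R \<omega>)"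
  note rl = reciprocal_law[OF \<open>prob_space Q\<close> Rm R0]
  have char: "{s. 0 < Im s \<and> 1 + z * s = s * (LINT \<omega>|Q. complex_of_real (R \<omega>) / (1 + complex_of_real (c * R \<omega>) * s))}
      = {stieltjes \<mu> z}" if z: "0 < Im z" for z
    unfolding rl(3)[symmetric]
  proof (rule stieltjes_characterization[OF \<mu>(1) rl(1) \<open>0 < c\<close> _ z])
    fix u :: real assume u: "u \<in> \<rat>" "0 < u"
    have "(LINT \<omega>|Q. m u * R \<omega> / (1 + c * (m u * R \<omega>))) = m u * (LINT t|?\<kappa>. 1 / (t + c * m u))"
      unfolding rl(2) integral_mult_right_zero[symmetric] by (simp only: times_divide_eq_right)
    then show "1 - u * (LINT t|\<mu>. 1 / (t + u)) = (LINT t|\<mu>. 1 / (t + u)) * (LINT t|?\<kappa>. 1 / (t + c * (LINT t|\<mu>. 1 / (t + u))))"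
      unfolding \<mu>(2)[OF u] using m(2)[OF u(2)] by linarith
  qed
  have nu_int: "(LINT r:{0..}|nu. complex_of_real r / (1 + complex_of_real (c * r) * s))
      = (LINT \<omega>|Q. complex_of_real (R \<omega>) / (1 + complex_of_real (c * R \<omega>) * s))" for s
    unfolding nu set_lebesgue_integral_def by (subst integral_distr) (auto simp: less_imp_le[OF R0])
  have div: "1 / s + z = i \<longleftrightarrow> 1 + z * s = s * i" if "0 < Im s" for s z i :: complex
  proof -
    have "s \<noteq> 0" using that by auto
    then have "1 + z * s = s * (1 / s + z)" by (simp add: distrib_left)
    then show ?thesis using \<open>s \<noteq> 0\<close> by simp
  qed
  have "real_distribution \<mu> \<and> (AE t in \<mu>. 0 \<le> t)"
    using \<mu>(1) by (simp add: positive_law_def positive_law_axioms_def)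
  moreover have "{s. Im s > 0 \<and> 1 / s + z = (LINT \<omega>|Q. complex_of_real (R \<omega>) / (1 + complex_of_real (c * R \<omega>) * s))}
      = {stieltjes \<mu> z}" if z: "0 < Im z" for z
    unfolding char[OF z, symmetric] using div by blast
  ultimately show ?thesis
    unfolding nu_int using conv char by blast
qed

end
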